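(* There is an absolute constant $C>0$ such that the following holds. Suppose that $A \subset \mathbb{Z}$ is a finite non-empty set and $K$ is a real number with $|A+A| \leq K|A|$. Then $A$ is contained in a multidimensional arithmetic progression $P$ with $$\dim P \leq C K^{7/4}\log^3 K \quad\text{and}\quad |P| \leq \exp(C K^{7/4}\log^3 K)\,|A|.$$
   Context: $A+A=\{a+a':a,a'\in A\}$. A multidimensional arithmetic progression of dimension $d$ (for an integer $d\geq 0$) is a set of integers of the form $P=\{x_0+\ell_1x_1+\dots+\ell_dx_d : \ell_i\in\mathbb{Z},\ 0\leq \ell_i<L_i \text{ for } 1\leq i\leq d\}$ with $x_0,\dots,x_d\in\mathbb{Z}$ and $L_1,\dots,L_d$ positive integers (a single point when $d=0$); $|P|$ denotes its cardinality as a set, and $\dim P = d$. *)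

theory Defs
  imports Complex_Main "HOL-Library.Set_Algebras"
begin

text \<open>
  Dimension belongs to a presentation \<open>(x, L)\<close>, which need not be proper: the same set may
  have presentations of several dimensions, so the dimension is an argument of the
  predicate. The base point is \<open>x 0\<close>; apart from it, only the values of \<open>x\<close>, \<open>L\<close> and \<open>l\<close> at
  indices in \<open>{1..d}\<close> matter.
\<close>

definition multidim_progression :: "nat \<Rightarrow> int set \<Rightarrow> bool" where
  "multidim_progression d P \<longleftrightarrow>
     (\<exists>(x :: nat \<Rightarrow> int) (L :: nat \<Rightarrow> int).
        (\<forall>i\<in>{1..d}. 0 < L i) \<and>
        P = {x 0 + (\<Sum>i = 1..d. l i * x i) | l :: nat \<Rightarrow> int.
               \<forall>i\<in>{1..d}. 0 \<le> l i \<and> l i < L i})"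

end

theory Submission
  imports Defs "HOL-Number_Theory.Cong" "HOL-Computational_Algebra.Primes" "HOL-Library.FuncSet"
begin

text \<open>
  Ruzsa's model replaces a positive proportion of \<open>A\<close> by a dense subset \<open>X\<close> of \<open>\<int>/N\<close>, where
  Bogolyubov's theorem shows that \<open>2X - 2X\<close> contains a large progression of small dimension; this
  progression is pulled back to \<open>2A - 2A\<close>, and Chang's covering argument then captures all of \<open>A\<close>
  at the cost of about \<open>K\<close> new dimensions per doubling step.

  The exponent is won in the Bogolyubov step. By Croot--Sisask sampling, the popularity function of
  \<open>X + X\<close> is nearly invariant under \<open>kT - kT\<close> for a set \<open>T\<close> of density \<open>exp (- polylog K)\<close>. Smoothing
  it by \<open>k\<close> copies of \<open>T\<close> and \<open>-T\<close> with \<open>k\<close> of order \<open>log K\<close> makes all frequencies outside the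
  \<open>1/2\<close>-spectrum of \<open>T\<close> negligible, and by Chang's theorem that spectrum is spanned by polylogarithmically
  many characters. So the progression has dimension \<open>polylog K\<close>, the covering step takes \<open>polylog K\<close>
  rounds, and the total dimension is \<open>O (K log\<^sup>8 K)\<close>, which is stronger than the bound asked for.
\<close>

section \<open>Sumset growth\<close>

text \<open>The exponent 8 of the logarithm is assembled from the following losses. The Fourier
  coefficients of the popularity function have absolute sum at most \<open>K\<close>, so the
  smoothing weight off the spectrum, at most \<open>4 ^ -k\<close>, has to beat \<open>K\<close>;
  this is why \<open>k\<close> is of order \<open>log K\<close>. Each of the \<open>k\<close>
  smoothing steps costs one sampling error, so the accuracy must be of order
  \<open>1 / log K\<close>, and an exceptional set smaller than \<open>X\<close> by a power of
  \<open>K\<close> then takes \<open>m\<close> of order \<open>log^3 K\<close> samples. The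
  resulting \<open>T\<close> has density about \<open>K ^ -m\<close>, hence the dimension is of
  order \<open>m log K\<close>, that is \<open>log^4 K\<close>. A progression of dimension
  \<open>d\<close> found in a Bohr set is smaller than \<open>A\<close> by a factor
  \<open>exp (O (d^2))\<close>, mainly because the basis theorem loses \<open>4 ^ d\<close> in each
  direction. The covering step therefore runs for \<open>O (log^8 K)\<close> rounds, each adding
  \<open>O (K)\<close> generators. Trading \<open>log^5 K\<close> for \<open>K powr (3 / 4)\<close>
  is safe only when \<open>ln K\<close> is bounded below; near \<open>K = 1\<close> the set
  \<open>A\<close> is a single point.\<close>

definition diff_set :: "'a::ab_group_add set \<Rightarrow> 'a set \<Rightarrow> 'a set" where
  "diff_set A B = (\<lambda>(a, b). a - b) ` (A \<times> B)"

lemma finite_diff_set: "finite A \<Longrightarrow> finite B \<Longrightarrow> finite (diff_set A B)"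
  by (simp add: diff_set_def)

lemma diff_setI: "a \<in> A \<Longrightarrow> b \<in> B \<Longrightarrow> a - b \<in> diff_set A B"
  by (force simp: diff_set_def)

lemma diff_setE:
  assumes "x \<in> diff_set A B"
  obtains a b where "x = a - b" "a \<in> A" "b \<in> B"
  using assms by (auto simp: diff_set_def)

lemma card_translate:
  fixes A :: "'a::ab_group_add set"
  shows "card (A + {c}) = card A"
proof -
  have "A + {c} = (\<lambda>a. a + c) ` A" by (auto simp: set_plus_def)
  thus ?thesis by (simp add: card_image)
qed

text \<open>Petridis's argument: add the elements of \<open>C\<close> one at a time. If
  \<open>W\<close> collects the \<open>x\<close> for which \<open>x + c\<close> is already in
  \<open>X + C\<close>, then \<open>X + C\<close> gains exactly \<open>card X - card W\<close>
  points, while all of \<open>W + B + c\<close> is already in \<open>X + B + C\<close>, so the left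
  side gains at most \<open>card (X + B) - card (W + B)\<close>. Minimality of the ratio, applied to
  \<open>W\<close>, compares the two gains.\<close>

lemma petridis:
  fixes X B C :: "'a::ab_group_add set" and kap :: real
  assumes fin: "finite X" "finite B" "finite C"
    and le: "real (card (X + B)) \<le> kap * card X"
    and min: "\<And>Z. Z \<subseteq> X \<Longrightarrow> kap * card Z \<le> card (Z + B)"
  shows "real (card (X + B + C)) \<le> kap * card (X + C)"
  using fin(3)
proof (induction C rule: finite_induct)
  case empty
  show ?case by (simp add: set_plus_def)
next
  case (insert c C)
  define W where "W = {x \<in> X. x + c \<in> X + C}"
  have WX: "W \<subseteq> X" by (auto simp: W_def)
  have finW: "finite W" using WX fin(1) finite_subset by blast
  have WB: "W + B \<subseteq> X + B" using WX by (auto simp: set_plus_def)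
  have fXC: "finite (X + C)" "finite (X + B)" "finite (X + B + C)" "finite (W + B)"
    using fin insert finW by (auto intro: finite_set_plus)
  have e1: "X + insert c C = (X + C) \<union> ((X - W) + {c})"
  proof
    show "X + insert c C \<subseteq> (X + C) \<union> ((X - W) + {c})"
      by (auto simp: W_def elim!: set_plus_elim intro: set_plus_intro)
    show "(X + C) \<union> ((X - W) + {c}) \<subseteq> X + insert c C"
      by (auto simp: W_def elim!: set_plus_elim intro: set_plus_intro)
  qed
  have d1: "(X + C) \<inter> ((X - W) + {c}) = {}"
    by (auto simp: W_def elim!: set_plus_elim intro: set_plus_intro)
       (metis set_plus_intro)
  have c1: "real (card (X + insert c C)) = card (X + C) + (real (card X) - card W)"
  proof -
    have "card (X + insert c C) = card (X + C) + card ((X - W) + {c})"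
      unfolding e1 by (rule card_Un_disjoint) (use d1 fXC fin in \<open>auto intro: finite_set_plus\<close>)
    moreover have "real (card (X - W)) = real (card X) - card W"
      using WX fin(1) by (simp add: card_Diff_subset finW card_mono of_nat_diff)
    ultimately show ?thesis by (simp add: card_translate)
  qed
  have e2: "X + B + insert c C \<subseteq> (X + B + C) \<union> (((X + B) - (W + B)) + {c})"
  proof
    fix y assume "y \<in> X + B + insert c C"
    then obtain s e where y: "y = s + e" "s \<in> X + B" "e \<in> insert c C" by (meson set_plus_elim)
    show "y \<in> (X + B + C) \<union> (((X + B) - (W + B)) + {c})"
    proof (cases "e \<in> C \<or> s \<notin> W + B")
      case True
      thus ?thesis using y by (auto intro: set_plus_intro)
    next
      case False
      then obtain w b where wb: "s = w + b" "w \<in> W" "b \<in> B" by (meson set_plus_elim)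
      then obtain x e' where "w + c = x + e'" "x \<in> X" "e' \<in> C"
        unfolding W_def by (blast elim: set_plus_elim)
      hence "y = (x + b) + e'" "x + b \<in> X + B" "e' \<in> C"
        using y wb False by (auto simp: algebra_simps intro: set_plus_intro)
      thus ?thesis by (auto intro: set_plus_intro)
    qed
  qed
  have c2: "real (card (X + B + insert c C)) \<le> card (X + B + C) + (real (card (X + B)) - card (W + B))"
  proof -
    have "card (X + B + insert c C) \<le> card ((X + B + C) \<union> (((X + B) - (W + B)) + {c}))"
      by (rule card_mono) (use e2 fXC fin in \<open>auto intro: finite_set_plus\<close>)
    also have "\<dots> \<le> card (X + B + C) + card (((X + B) - (W + B)) + {c})" by (rule card_Un_le)
    also have "card (((X + B) - (W + B)) + {c}) = card (X + B) - card (W + B)"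
      by (simp add: card_translate card_Diff_subset fXC WB)
    finally show ?thesis using card_mono[OF fXC(2) WB] by linarith
  qed
  have "kap * card W \<le> card (W + B)" using min WX by blast
  hence "real (card (X + B + insert c C)) \<le> kap * card (X + C) + (kap * card X - kap * card W)"
    using c2 le insert.IH by linarith
  thus ?case unfolding c1 by (simp only: distrib_left right_diff_distrib)
qed

primrec multi_sum :: "nat \<Rightarrow> 'a::comm_monoid_add set \<Rightarrow> 'a set" where
  "multi_sum 0 A = {0}"
| "multi_sum (Suc n) A = A + multi_sum n A"

abbreviation sum_diff :: "nat \<Rightarrow> nat \<Rightarrow> 'a::ab_group_add set \<Rightarrow> 'a set" where
  "sum_diff n m A \<equiv> diff_set (multi_sum n A) (multi_sum m A)"

lemma finite_multi_sum: "finite A \<Longrightarrow> finite (multi_sum n A)"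
  by (induction n) (auto intro: finite_set_plus)

text \<open>Supplies the minimality that \<open>petridis\<close> asks for: \<open>X\<close>
  minimises \<open>card (Z + B) / card Z\<close> over the non-empty subsets of \<open>A\<close>, and
  comparison with \<open>A\<close> itself bounds the minimum \<open>kap\<close>.\<close>

lemma exists_min_ratio:
  fixes A B :: "'a::ab_group_add set"
  assumes fin: "finite A" "finite B" and ne: "A \<noteq> {}"
  obtains X and kap :: real where "X \<subseteq> A" "X \<noteq> {}" "real (card (X + B)) = kap * card X"
    "\<And>Z. Z \<subseteq> X \<Longrightarrow> kap * card Z \<le> card (Z + B)" "kap * card A \<le> card (A + B)" "kap \<ge> 0"
proof -
  define S where "S = Pow A - {{}}"
  define r where "r Z = real (card (Z + B)) / card Z" for Z
  have finS: "finite S" "S \<noteq> {}" using fin ne by (auto simp: S_def)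
  define X where "X = arg_min_on r S"
  have XS: "X \<in> S" unfolding X_def using finS by (rule arg_min_if_finite)
  have least: "r X \<le> r Z" if "Z \<in> S" for Z
    unfolding X_def using finS that by (rule arg_min_least)
  have pos: "card Z > 0" if "Z \<in> S" for Z
    using that fin(1) by (auto simp: S_def card_gt_0_iff intro: finite_subset)
  have ge: "r X * card Z \<le> card (Z + B)" if "Z \<subseteq> A" for Z
  proof (cases "Z = {}")
    case False
    hence "Z \<in> S" using that by (auto simp: S_def)
    thus ?thesis using least[of Z] pos[of Z] by (simp add: r_def field_simps)
  qed (simp add: set_plus_def)
  show ?thesis
  proof (rule that[of X "r X"])
    show "real (card (X + B)) = r X * card X" using pos[OF XS] by (simp add: r_def)
    show "r X \<ge> 0" by (simp add: r_def)
  qed (use XS ge in \<open>auto simp: S_def\<close>)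
qed

text \<open>Fix one representation \<open>d = p d - q d\<close> of each difference. The pair
  \<open>(x + p d, x + q d)\<close> determines \<open>d\<close> as the difference of its entries,
  and then \<open>x\<close>.\<close>

lemma card_ruzsa_triangle:
  fixes X Y Z :: "'a::ab_group_add set"
  assumes fin: "finite X" "finite Y" "finite Z"
  shows "card X * card (diff_set Y Z) \<le> card (X + Y) * card (X + Z)"
proof -
  let ?D = "diff_set Y Z"
  have "\<forall>d. \<exists>yz. d \<in> ?D \<longrightarrow> d = fst yz - snd yz \<and> fst yz \<in> Y \<and> snd yz \<in> Z"
    by (auto simp: diff_set_def)
  then obtain f where f: "\<forall>d. d \<in> ?D \<longrightarrow> d = fst (f d) - snd (f d) \<and> fst (f d) \<in> Y \<and> snd (f d) \<in> Z"
    by (rule choice[THEN exE])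
  define p q where "p d = fst (f d)" and "q d = snd (f d)" for d
  have pq: "d = p d - q d \<and> p d \<in> Y \<and> q d \<in> Z" if "d \<in> ?D" for d
    using f that unfolding p_def q_def by blast
  have "inj_on (\<lambda>(x,d). (x + p d, x + q d)) (X \<times> ?D)"
  proof (rule inj_onI)
    fix u v assume *: "u \<in> X \<times> ?D" "v \<in> X \<times> ?D"
      "(case u of (x,d) \<Rightarrow> (x + p d, x + q d)) = (case v of (x,d) \<Rightarrow> (x + p d, x + q d))"
    obtain x d x' d' where uv: "u = (x,d)" "v = (x',d')" by fastforce
    have eq: "x + p d = x' + p d'" "x + q d = x' + q d'" using *(3) uv by auto
    have dd: "d \<in> ?D" "d' \<in> ?D" using *(1,2) unfolding uv by blast+
    have "d = (x + p d) - (x + q d)" using pq[OF dd(1)] by (simp add: algebra_simps)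
    also have "\<dots> = (x' + p d') - (x' + q d')" unfolding eq ..
    also have "\<dots> = d'" using pq[OF dd(2)] by (simp add: algebra_simps)
    finally show "u = v" using eq uv by simp
  qed
  moreover have "(\<lambda>(x,d). (x + p d, x + q d)) ` (X \<times> ?D) \<subseteq> (X + Y) \<times> (X + Z)"
  proof (rule image_subsetI)
    fix u assume "u \<in> X \<times> ?D"
    then obtain x d where u: "u = (x,d)" "x \<in> X" "d \<in> ?D" by blast
    thus "(case u of (x,d) \<Rightarrow> (x + p d, x + q d)) \<in> (X + Y) \<times> (X + Z)"
      using pq[OF u(3)] by (auto intro: set_plus_intro)
  qed
  moreover have "finite ((X + Y) \<times> (X + Z))" using fin by (auto intro: finite_set_plus)
  ultimately have "card (X \<times> ?D) \<le> card ((X + Y) \<times> (X + Z))" by (rule card_inj_on_le)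
  thus ?thesis by (simp add: card_cartesian_product)
qed

text \<open>Iterating \<open>petridis\<close> controls sums \<open>X + multi_sum n A\<close> only
  for the minimising subset \<open>X\<close>. The triangle inequality with \<open>X\<close> as pivot
  then removes \<open>X\<close> from the left side, and \<open>card X \<le> card A\<close>
  finishes.\<close>

theorem plunnecke:
  fixes A :: "'a::ab_group_add set" and K :: real
  assumes fin: "finite A" and ne: "A \<noteq> {}" and K: "real (card (A + A)) \<le> K * card A"
  shows "real (card (sum_diff n m A)) \<le> K ^ (n + m) * card A"
proof -
  obtain X and kap :: real where X: "X \<subseteq> A" "X \<noteq> {}" "real (card (X + A)) = kap * card X"
    "\<And>Z. Z \<subseteq> X \<Longrightarrow> kap * card Z \<le> card (Z + A)" "kap * card A \<le> card (A + A)" "kap \<ge> 0"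
    using exists_min_ratio[OF fin fin ne] by blast
  have finX: "finite X" using X(1) fin finite_subset by blast
  have cA: "card A > 0" "card X > 0" using fin ne X(2) finX by (auto simp: card_gt_0_iff)
  have "kap * card A \<le> K * card A" using X(5) K by linarith
  hence kK: "kap \<le> K" using cA by simp
  hence K0: "K \<ge> 0" using X(6) by linarith
  have b: "real (card (X + multi_sum n A)) \<le> kap ^ n * card X" for n
  proof (induction n)
    case 0 thus ?case by (simp add: card_translate)
  next
    case (Suc n)
    have "X + multi_sum (Suc n) A = X + A + multi_sum n A" by (simp add: add.assoc)
    also have "real (card \<dots>) \<le> kap * card (X + multi_sum n A)"
      by (rule petridis) (use X fin finX finite_multi_sum in auto)
    also have "\<dots> \<le> kap * (kap ^ n * card X)" using Suc X(6) by (intro mult_left_mono)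
    finally show ?case by (simp add: mult.assoc)
  qed
  let ?D = "sum_diff n m A"
  have "real (card X) * card ?D \<le> real (card (X + multi_sum n A)) * card (X + multi_sum m A)"
    using card_ruzsa_triangle[OF finX finite_multi_sum[OF fin] finite_multi_sum[OF fin], of n m]
    by (simp only: of_nat_mult[symmetric] of_nat_le_iff)
  also have "\<dots> \<le> (kap ^ n * card X) * (kap ^ m * card X)"
    using b X(6) by (intro mult_mono) auto
  finally have "real (card X) * card ?D \<le> real (card X) * (kap ^ (n+m) * card X)"
    by (simp add: power_add algebra_simps)
  hence "card ?D \<le> kap ^ (n+m) * card X" using cA by simp
  also have "\<dots> \<le> K ^ (n+m) * card A"
    using kK X(6) X(1) K0 card_mono[OF fin X(1)] by (intro mult_mono power_mono) auto
  finally show ?thesis .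
qed

section \<open>Ruzsa's model\<close>

lemma pigeonhole_fiber:
  assumes "finite A" "finite B" "f ` A \<subseteq> B" "B \<noteq> {}"
  obtains b where "b \<in> B" "card A \<le> card B * card {a \<in> A. f a = b}"
proof -
  let ?F = "\<lambda>b. {a \<in> A. f a = b}"
  have "\<exists>b\<in>B. card A \<le> card B * card (?F b)"
  proof (rule ccontr)
    assume "\<not> ?thesis"
    hence lt: "card B * card (?F b) < card A" if "b \<in> B" for b using that by (auto simp: not_le)
    have "(\<Union>b\<in>B. ?F b) = A" using assms(3) by blast
    hence "card A \<le> (\<Sum>b\<in>B. card (?F b))"
      using card_UN_le[OF assms(2), of ?F] by (simp only:)
    hence "card B * card A \<le> (\<Sum>b\<in>B. card B * card (?F b))"
      by (simp only: sum_distrib_left[symmetric] mult_le_mono2)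
    also have "\<dots> < (\<Sum>b\<in>B. card A)" using lt assms by (intro sum_strict_mono) auto
    finally show False by simp
  qed
  thus ?thesis using that by blast
qed

lemma card_multiples_le:
  fixes p N :: int
  assumes "N > 0" "p > 0"
  shows "N * card {r\<in>{1..p-1}. N dvd r} \<le> p - 1"
proof -
  have "{r\<in>{1..p-1}. N dvd r} \<subseteq> (\<lambda>k. N * k) ` {1..(p-1) div N}"
  proof
    fix r assume r: "r \<in> {r\<in>{1..p-1}. N dvd r}"
    then obtain k where k: "r = N * k" by (auto elim: dvdE)
    have "k \<ge> 1" using r k assms by (simp add: zero_less_mult_iff int_one_le_iff_zero_less)
    moreover have "k \<le> (p - 1) div N"
    proof -
      have "k = (N * k) div N" using assms by simp
      also have "\<dots> \<le> (p - 1) div N" using r k assms by (intro zdiv_mono1) auto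
      finally show ?thesis .
    qed
    ultimately show "r \<in> (\<lambda>k. N * k) ` {1..(p-1) div N}" using k by auto
  qed
  hence "card {r\<in>{1..p-1}. N dvd r} \<le> card ((\<lambda>k. N * k) ` {1..(p-1) div N})"
    by (intro card_mono) auto
  also have "\<dots> \<le> card {1..(p-1) div N}" by (rule card_image_le) simp
  also have "\<dots> = nat ((p - 1) div N)" by simp
  finally have "int (card {r\<in>{1..p-1}. N dvd r}) \<le> int (nat ((p - 1) div N))"
    by (rule of_nat_mono)
  also have "\<dots> = (p - 1) div N" using assms by (simp add: pos_imp_zdiv_nonneg_iff)
  finally have "int (card {r\<in>{1..p-1}. N dvd r}) \<le> (p - 1) div N" .
  hence "N * card {r\<in>{1..p-1}. N dvd r} \<le> N * ((p - 1) div N)"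
    using assms by (intro mult_left_mono) auto
  also have "\<dots> \<le> p - 1" using pos_mod_sign[OF assms(1), of "p - 1"] by (simp flip: minus_mod_eq_mult_div)
  finally show ?thesis .
qed

text \<open>Multiplication by \<open>d\<close> permutes the non-zero residues mod \<open>p\<close>,
  so the bad \<open>q\<close> are as rare as the multiples of \<open>N\<close> among
  \<open>1..p-1\<close>.\<close>

lemma card_bad_multipliers_le:
  fixes p N d :: int
  assumes "prime p" "N > 0" "\<not> p dvd d"
  shows "N * card {q\<in>{1..p-1}. N dvd (q * d) mod p} \<le> p - 1"
proof -
  have p: "p > 1" using assms(1) prime_gt_1_int by blast
  have "card {q\<in>{1..p-1}. N dvd (q * d) mod p} \<le> card {r\<in>{1..p-1}. N dvd r}"
  proof (rule card_inj_on_le[where f = "\<lambda>q. (q * d) mod p"])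
    show "inj_on (\<lambda>q. (q * d) mod p) {q\<in>{1..p-1}. N dvd (q * d) mod p}"
    proof (rule inj_onI)
      fix x y assume "x \<in> {q\<in>{1..p-1}. N dvd (q * d) mod p}" "y \<in> {q\<in>{1..p-1}. N dvd (q * d) mod p}"
        and eq: "x * d mod p = y * d mod p"
      hence *: "1 \<le> x" "x \<le> p - 1" "1 \<le> y" "y \<le> p - 1" by auto
      have "p dvd (x - y) * d" using eq by (simp add: mod_eq_dvd_iff left_diff_distrib)
      hence "p dvd x - y" using assms by (simp add: prime_dvd_mult_iff)
      hence "x mod p = y mod p" by (simp add: mod_eq_dvd_iff)
      thus "x = y" using * by simp
    qed
    show "(\<lambda>q. (q * d) mod p) ` {q\<in>{1..p-1}. N dvd (q * d) mod p} \<subseteq> {r\<in>{1..p-1}. N dvd r}"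
    proof
      fix y assume "y \<in> (\<lambda>q. (q * d) mod p) ` {q\<in>{1..p-1}. N dvd (q * d) mod p}"
      then obtain q where y: "y = (q * d) mod p" "N dvd y" and q: "1 \<le> q" "q \<le> p - 1" by auto
      have "\<not> p dvd q" using q by (auto dest: zdvd_imp_le)
      hence "\<not> p dvd q * d" using assms by (simp add: prime_dvd_mult_iff)
      hence "q * d mod p \<noteq> 0" by (simp add: dvd_eq_mod_eq_0)
      moreover have "q * d mod p \<ge> 0" "q * d mod p < p" using p by auto
      ultimately show "y \<in> {r\<in>{1..p-1}. N dvd r}" using y by auto
    qed
  qed (rule finite_subset[of _ "{1..p-1}"]; auto)
  hence "N * card {q\<in>{1..p-1}. N dvd (q * d) mod p} \<le> N * card {r\<in>{1..p-1}. N dvd r}"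
    using assms by (intro mult_left_mono) auto
  also have "\<dots> \<le> p - 1" using assms p by (intro card_multiples_le) auto
  finally show ?thesis .
qed

text \<open>Union bound: each non-zero \<open>d\<close> spoils at most a fraction
  \<open>1 / N\<close> of the multipliers, and there are fewer than \<open>N\<close> such
  \<open>d\<close>. The bound on \<open>D\<close> by \<open>p\<close> keeps every non-zero
  \<open>d\<close> non-zero mod \<open>p\<close>.\<close>

lemma exists_good_multiplier:
  fixes D :: "int set"
  assumes fin: "finite D" and N: "N > int (card D)" and p: "prime p" and D: "\<And>d. d \<in> D \<Longrightarrow> \<bar>d\<bar> < p"
  obtains q :: int where "\<And>d. d \<in> D \<Longrightarrow> N dvd (q * d) mod p \<Longrightarrow> d = 0"
proof -
  have p1: "p > 1" using p prime_gt_1_int by blast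
  define bad where "bad d = {q\<in>{1..p-1}. N dvd (q * d) mod p}" for d
  have "N * card (bad d) \<le> p - 1" if "d \<in> D - {0}" for d
    unfolding bad_def
  proof (rule card_bad_multipliers_le)
    show "\<not> p dvd d" using that D[of d] dvd_imp_le_int[of d p] p1 by auto
  qed (use p N in auto)
  hence "(\<Sum>d\<in>D - {0}. N * card (bad d)) \<le> (\<Sum>d\<in>D - {0}. p - 1)" by (rule sum_mono)
  also have "\<dots> = int (card (D - {0})) * (p - 1)" by simp
  also have "\<dots> \<le> int (card D) * (p - 1)"
    using p1 fin by (intro mult_right_mono) (auto intro: card_mono)
  also have "\<dots> < N * (p - 1)" using N p1 by simp
  finally have "N * int (\<Sum>d\<in>D - {0}. card (bad d)) < N * (p - 1)"
    by (simp add: sum_distrib_left)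
  hence "int (\<Sum>d\<in>D - {0}. card (bad d)) < p - 1" using N by simp
  hence lt: "(\<Sum>d\<in>D - {0}. card (bad d)) < nat (p - 1)" by linarith
  have "card (\<Union>d\<in>D - {0}. bad d) \<le> (\<Sum>d\<in>D - {0}. card (bad d))"
    using fin by (intro card_UN_le) auto
  hence "card (\<Union>d\<in>D - {0}. bad d) < card {1..p-1}" using lt by simp
  moreover have "finite (bad d)" for d
    unfolding bad_def by (rule finite_subset[of _ "{1..p-1}"]) auto
  hence "finite (\<Union>d\<in>D - {0}. bad d)" using fin by blast
  ultimately have "\<not> {1..p-1} \<subseteq> (\<Union>d\<in>D - {0}. bad d)"
    using card_mono not_le by blast
  then obtain q where "q \<in> {1..p-1}" "q \<notin> (\<Union>d\<in>D - {0}. bad d)" by blast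
  thus ?thesis using that[of q] by (auto simp: bad_def)
qed

text \<open>With \<open>k\<close> equal to the length of the lists, the conclusion says that the two
  sums differ by less than \<open>p\<close>, so reduction mod \<open>p\<close> causes no
  wrap-around. Non-empty lists are what keeps the inequality strict.\<close>

lemma sum_list_diff_bound:
  fixes psi :: "'a \<Rightarrow> int" and k p :: int
  assumes "length xs = length ys" "\<And>a b. a \<in> S \<Longrightarrow> b \<in> S \<Longrightarrow> k * \<bar>psi a - psi b\<bar> < p"
    "set xs \<subseteq> S" "set ys \<subseteq> S" "xs \<noteq> []" "k > 0"
  shows "k * \<bar>sum_list (map psi xs) - sum_list (map psi ys)\<bar> < length xs * p"
  using assms(1,3,4,5)
proof (induction xs ys rule: list_induct2)
  case (Cons x xs y ys)
  have 1: "k * \<bar>psi x - psi y\<bar> < p" using Cons assms by simp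
  have "k * \<bar>sum_list (map psi (x # xs)) - sum_list (map psi (y # ys))\<bar>
      \<le> k * (\<bar>psi x - psi y\<bar> + \<bar>sum_list (map psi xs) - sum_list (map psi ys)\<bar>)"
    using assms(6) by (intro mult_left_mono) auto
  moreover have "k * \<bar>sum_list (map psi xs) - sum_list (map psi ys)\<bar> \<le> length xs * p"
    using Cons by (cases "xs = []") auto
  ultimately show ?case using 1 by (simp add: algebra_simps)
qed simp

lemma ex_prime_gt_int: "\<exists>p::int. prime p \<and> p > n"
proof -
  obtain p :: nat where "prime p" "p > nat n" using bigger_prime by blast
  thus ?thesis by (intro exI[of _ "int p"]) auto
qed

text \<open>Lists of length \<open>s\<close> stand for sums of \<open>s\<close> terms with
  repetition. The equivalence makes \<open>psi\<close> a Freiman isomorphism of order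
  \<open>s\<close> onto its image in the integers mod \<open>N\<close>, so relations can be carried
  in both directions.\<close>

definition freiman_embedding :: "nat \<Rightarrow> int \<Rightarrow> int set \<Rightarrow> (int \<Rightarrow> int) \<Rightarrow> bool" where
  "freiman_embedding s N A psi \<longleftrightarrow>
     (\<forall>xs ys. set xs \<subseteq> A \<longrightarrow> set ys \<subseteq> A \<longrightarrow> length xs = s \<longrightarrow> length ys = s \<longrightarrow>
        (N dvd sum_list (map psi xs) - sum_list (map psi ys) \<longleftrightarrow> sum_list xs = sum_list ys))"

lemma sum_list_in_multi_sum: "set xs \<subseteq> A \<Longrightarrow> sum_list xs \<in> multi_sum (length xs) A"
  by (induction xs) (auto intro: set_plus_intro)

text \<open>Multiplying by \<open>q\<close> mod a large prime preserves additive relations only up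
  to multiples of \<open>p\<close>. Restricting to elements whose residues lie in a common interval
  of length \<open>p / s\<close> costs a factor \<open>s\<close> in size and makes differences of
  \<open>s\<close>-fold sums smaller than \<open>p\<close>. The choice of \<open>q\<close> then
  guarantees that the further reduction mod \<open>N\<close> creates no new relation.\<close>

theorem ruzsa_model:
  fixes A :: "int set" and s :: nat
  assumes fin: "finite A" and ne: "A \<noteq> {}" and s: "s > 0"
    and N: "N > int (card (sum_diff s s A))"
  obtains A' psi where "A' \<subseteq> A" "A' \<noteq> {}" "card A \<le> s * card A'" "freiman_embedding s N A' psi"
proof -
  define D where "D = sum_diff s s A"
  have finD: "finite D" unfolding D_def by (intro finite_diff_set finite_multi_sum fin)
  obtain p :: int where p: "prime p" "p > Max (abs ` insert 0 D)"
    using ex_prime_gt_int by blast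
  have Dp: "\<bar>d\<bar> < p" if "d \<in> D" for d
  proof -
    have "\<bar>d\<bar> \<le> Max (abs ` insert 0 D)" using that finD by (intro Max_ge) auto
    thus ?thesis using p by linarith
  qed
  have p0: "p > 0" using p(1) prime_gt_0_int by blast
  obtain q where q: "\<And>d. d \<in> D \<Longrightarrow> N dvd (q * d) mod p \<Longrightarrow> d = 0"
    using exists_good_multiplier[OF finD N[folded D_def] p(1) Dp] by blast
  define r where "r a = (q * a) mod p" for a
  \<comment> \<open>The index of the interval of length \<open>p / s\<close> containing the residue
    \<open>r a\<close>.\<close>
  define c where "c a = nat (int s * r a div p)" for a
  have r: "r a \<ge> 0" "r a < p" for a using p0 by (auto simp: r_def)
  have cA: "c ` A \<subseteq> {..<s}"
  proof clarify
    fix a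
    have "int s * r a div p < int s"
    proof (rule ccontr)
      assume "\<not> int s * r a div p < int s"
      hence "int s * p \<le> (int s * r a div p) * p" using p0 by (intro mult_right_mono) auto
      also have "\<dots> \<le> int s * r a" using p0 by (simp flip: minus_mod_eq_div_mult)
      finally show False using r[of a] s by simp
    qed
    moreover have "int s * r a div p \<ge> 0" using r[of a] p0 by (simp add: pos_imp_zdiv_nonneg_iff)
    ultimately show "c a < s" by (simp add: c_def)
  qed
  have "{..<s} \<noteq> {}" using s by (simp add: lessThan_empty_iff)
  then obtain j where j: "card A \<le> s * card {a\<in>A. c a = j}"
    using pigeonhole_fiber[OF fin finite_lessThan cA] by (metis card_lessThan)
  define A' where "A' = {a\<in>A. c a = j}"
  have A'A: "A' \<subseteq> A" by (auto simp: A'_def)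
  have close: "int s * \<bar>r a - r b\<bar> < p" if "a \<in> A'" "b \<in> A'" for a b
  proof -
    have nn: "int s * r x div p \<ge> 0" for x using r[of x] p0 by (simp add: pos_imp_zdiv_nonneg_iff)
    have "int s * r a div p = int s * r b div p"
      using that nn[of a] nn[of b] by (auto simp: A'_def c_def)
    hence "int s * r a - int s * r b = (int s * r a) mod p - (int s * r b) mod p"
      by (simp add: minus_div_mult_eq_mod[symmetric])
    moreover have "\<bar>(int s * r a) mod p - (int s * r b) mod p\<bar> < p"
      using pos_mod_bound[OF p0, of "int s * r a"] pos_mod_sign[OF p0, of "int s * r a"]
         pos_mod_bound[OF p0, of "int s * r b"] pos_mod_sign[OF p0, of "int s * r b"] by linarith
    moreover have "int s * \<bar>r a - r b\<bar> = \<bar>int s * r a - int s * r b\<bar>"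
      by (simp add: abs_mult flip: right_diff_distrib)
    ultimately show ?thesis by simp
  qed
  have cong: "[sum_list (map r xs) = q * sum_list xs] (mod p)" for xs
  proof (induction xs)
    case (Cons x xs)
    have "[r x = q * x] (mod p)" by (simp add: r_def)
    from cong_add[OF this Cons] show ?case by (simp add: distrib_left)
  qed simp
  have main: "d = 0 \<longleftrightarrow> N dvd e"
    if "set xs \<subseteq> A'" "set ys \<subseteq> A'" "length xs = s" "length ys = s"
      and d: "d = sum_list xs - sum_list ys" and e: "e = sum_list (map r xs) - sum_list (map r ys)" for xs ys d e
  proof -
    have "s * \<bar>e\<bar> < length xs * p"
      unfolding e by (rule sum_list_diff_bound[OF _ close]) (use that s in auto)
    hence ep: "\<bar>e\<bar> < p" using that s by simp
    have mem: "sum_list xs \<in> multi_sum s A" "sum_list ys \<in> multi_sum s A"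
      using sum_list_in_multi_sum[of xs A] sum_list_in_multi_sum[of ys A] that A'A by auto
    have dD: "d \<in> D" "- d \<in> D"
      using diff_setI[OF mem] diff_setI[OF mem(2) mem(1)] by (simp_all add: D_def d)
    have ed: "[e = q * d] (mod p)"
      using cong_diff[OF cong[of xs] cong[of ys]] by (simp add: d e right_diff_distrib)
    show ?thesis
    proof
      assume "d = 0"
      hence "p dvd e" using ed by (simp add: cong_0_iff)
      hence "e = 0" using ep dvd_imp_le_int[of e p] by fastforce
      thus "N dvd e" by simp
    next
      assume Ne: "N dvd e"
      show "d = 0"
      \<comment> \<open>Only the representative in \<open>0..p-1\<close> is covered by the choice of
        \<open>q\<close>. For negative \<open>e\<close> the argument is run with \<open>- d\<close>,
        which lies in \<open>D\<close> because \<open>D\<close> is symmetric.\<close>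
      proof (cases "e \<ge> 0")
        case True
        hence "e = (q * d) mod p" using ed ep by (simp add: cong_def)
        thus ?thesis using q[OF dD(1)] Ne by simp
      next
        case False
        have "[- e = q * (- d)] (mod p)" using ed by (simp add: cong_minus_minus_iff)
        hence "- e = (q * (- d)) mod p" using False ep by (simp add: cong_def)
        hence "- d = 0" using q[OF dD(2)] Ne by (metis dvd_minus_iff)
        thus ?thesis by simp
      qed
    qed
  qed
  show ?thesis
  proof (rule that[OF A'A])
    show "card A \<le> s * card A'" using j by (simp add: A'_def)
    thus "A' \<noteq> {}" using fin ne by (auto simp: card_gt_0_iff)
    show "freiman_embedding s N A' r"
      unfolding freiman_embedding_def using main by (metis eq_iff_diff_eq_0)
  qed
qed

section \<open>Almost periodicity by sampling\<close>

text \<open>For negative \<open>x\<close>, multiply by \<open>1 - x \<le> exp (- x)\<close>: the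
  product \<open>(1 + x + x^2) (1 - x)\<close> is \<open>1 - x^3\<close>, which is at least
  1.\<close>

lemma exp_le_quadratic: "x \<le> (1::real) \<Longrightarrow> exp x \<le> 1 + x + x\<^sup>2"
proof (cases "x \<ge> 0")
  case False
  have sq: "1 + x + x\<^sup>2 = (x + 1/2)\<^sup>2 + 3/4" by (simp add: power2_eq_square algebra_simps)
  have "1 \<le> 1 - x ^ 3" using False by (simp add: power_le_zero_eq)
  also have "\<dots> = (1 + x + x\<^sup>2) * (1 - x)" by (simp add: algebra_simps power2_eq_square power3_eq_cube)
  also have "\<dots> \<le> (1 + x + x\<^sup>2) * exp (- x)"
    using exp_ge_add_one_self[of "- x"] by (intro mult_left_mono) (auto simp: sq)
  finally have "1 * exp x \<le> (1 + x + x\<^sup>2) * exp (- x) * exp x" by (intro mult_right_mono) auto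
  thus ?thesis by (simp add: mult.assoc flip: exp_add)
qed (auto intro: exp_bound)

lemma sum_exp_centered_le:
  fixes u :: "'a \<Rightarrow> real" and s :: real
  assumes fin: "finite X" and u: "\<And>a. a \<in> X \<Longrightarrow> \<bar>u a\<bar> \<le> 1" and z: "(\<Sum>a\<in>X. u a) = 0"
    and s: "\<bar>s\<bar> \<le> 1"
  shows "(\<Sum>a\<in>X. exp (s * u a)) \<le> card X * exp (s\<^sup>2)"
proof -
  have "exp (s * u a) \<le> 1 + s * u a + s\<^sup>2" if "a \<in> X" for a
  proof -
    have "\<bar>s * u a\<bar> \<le> 1" using u[OF that] s by (simp add: abs_mult mult_le_one)
    hence "exp (s * u a) \<le> 1 + s * u a + (s * u a)\<^sup>2" by (intro exp_le_quadratic) auto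
    moreover have "(s * u a)\<^sup>2 \<le> s\<^sup>2 * 1"
      unfolding power_mult_distrib using u[OF that] by (intro mult_left_mono) (auto simp: abs_square_le_1)
    ultimately show ?thesis by simp
  qed
  hence "(\<Sum>a\<in>X. exp (s * u a)) \<le> (\<Sum>a\<in>X. 1 + s * u a + s\<^sup>2)" by (rule sum_mono)
  also have "\<dots> = card X * (1 + s\<^sup>2)"
  proof -
    have "(\<Sum>a\<in>X. 1 + s * u a + s\<^sup>2) = real (card X) + s * (\<Sum>a\<in>X. u a) + real (card X) * s\<^sup>2"
      by (simp add: sum.distrib flip: sum_distrib_left)
    thus ?thesis unfolding z by (simp add: distrib_left)
  qed
  also have "\<dots> \<le> card X * exp (s\<^sup>2)" by (intro mult_left_mono) auto
  finally show ?thesis .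
qed

text \<open>Chernoff's method by counting: bound the number of bad tuples by an exponential moment,
  which factors over the coordinates; the mean-zero hypothesis removes the linear term in each
  factor.\<close>

lemma card_upper_deviation_le:
  fixes u :: "'a \<Rightarrow> real" and \<epsilon> :: real
  assumes fin: "finite X" and u: "\<And>a. a \<in> X \<Longrightarrow> \<bar>u a\<bar> \<le> 1" and z: "(\<Sum>a\<in>X. u a) = 0"
    and \<epsilon>: "0 \<le> \<epsilon>" "\<epsilon> \<le> 2"
  shows "real (card {c \<in> PiE {..<m} (\<lambda>_. X). (\<Sum>i<m. u (c i)) > \<epsilon> * m}) \<le> exp (- \<epsilon>\<^sup>2 * m / 4) * real (card X) ^ m"
proof -
  \<comment> \<open>This minimises \<open>s^2 - s \<epsilon>\<close>, with value
    \<open>- \<epsilon>^2 / 4\<close>. The hypothesis \<open>\<epsilon> \<le> 2\<close> ensures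
    \<open>s \<le> 1\<close>, as the quadratic bound on \<open>exp\<close> requires.\<close>
  define s where "s = \<epsilon> / 2"
  let ?P = "PiE {..<m} (\<lambda>_. X)"
  let ?B = "{c \<in> ?P. (\<Sum>i<m. u (c i)) > \<epsilon> * m}"
  have finP: "finite ?P" using fin by (intro finite_PiE) auto
  have "exp (s * \<epsilon> * m) * card ?B = (\<Sum>c\<in>?B. exp (s * \<epsilon> * m))" by simp
  also have "\<dots> \<le> (\<Sum>c\<in>?B. exp (s * (\<Sum>i<m. u (c i))))"
  proof (rule sum_mono)
    fix c assume "c \<in> ?B"
    hence "s * (\<epsilon> * m) \<le> s * (\<Sum>i<m. u (c i))" using \<epsilon> by (intro mult_left_mono) (auto simp: s_def)
    thus "exp (s * \<epsilon> * m) \<le> exp (s * (\<Sum>i<m. u (c i)))" by (simp add: mult.assoc)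
  qed
  also have "\<dots> \<le> (\<Sum>c\<in>?P. exp (s * (\<Sum>i<m. u (c i))))"
    using finP by (intro sum_mono2) auto
  also have "\<dots> = (\<Sum>c\<in>?P. \<Prod>i<m. exp (s * u (c i)))"
    by (simp add: sum_distrib_left exp_sum)
  also have "\<dots> = (\<Prod>i<m. \<Sum>a\<in>X. exp (s * u a))"
    by (rule prod_sum_PiE[symmetric]) (use fin in auto)
  also have "\<dots> = (\<Sum>a\<in>X. exp (s * u a)) ^ m" by simp
  also have "\<dots> \<le> (card X * exp (s\<^sup>2)) ^ m"
    using \<epsilon> by (intro power_mono sum_exp_centered_le fin u z sum_nonneg) (auto simp: s_def)
  also have "\<dots> = exp (s\<^sup>2 * m) * real (card X) ^ m"
    by (simp add: power_mult_distrib exp_of_nat_mult[symmetric] mult.commute)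
  finally have "card ?B \<le> exp (s\<^sup>2 * m) * real (card X) ^ m / exp (s * \<epsilon> * m)"
    by (simp add: field_simps)
  also have "\<dots> = exp (s\<^sup>2 * m - s * \<epsilon> * m) * real (card X) ^ m"
    by (simp add: exp_diff)
  also have "s\<^sup>2 * m - s * \<epsilon> * m = - \<epsilon>\<^sup>2 * m / 4" by (simp add: s_def power2_eq_square field_simps)
  finally show ?thesis .
qed

lemma card_deviation_le:
  fixes u :: "'a \<Rightarrow> real" and \<epsilon> :: real
  assumes fin: "finite X" and u: "\<And>a. a \<in> X \<Longrightarrow> \<bar>u a\<bar> \<le> 1" and z: "(\<Sum>a\<in>X. u a) = 0"
    and \<epsilon>: "0 \<le> \<epsilon>" "\<epsilon> \<le> 2"
  shows "real (card {c \<in> PiE {..<m} (\<lambda>_. X). \<bar>\<Sum>i<m. u (c i)\<bar> > \<epsilon> * m}) \<le> 2 * exp (- \<epsilon>\<^sup>2 * m / 4) * real (card X) ^ m"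
proof -
  let ?P = "PiE {..<m} (\<lambda>_. X)"
  let ?B = "\<lambda>u. {c \<in> ?P. (\<Sum>i<m. u (c i)) > \<epsilon> * m}"
  have finP: "finite ?P" using fin by (intro finite_PiE) auto
  have "{c \<in> ?P. \<bar>\<Sum>i<m. u (c i)\<bar> > \<epsilon> * m} \<subseteq> ?B u \<union> ?B (\<lambda>a. - u a)"
  proof
    fix c assume "c \<in> {c \<in> ?P. \<bar>\<Sum>i<m. u (c i)\<bar> > \<epsilon> * m}"
    hence "c \<in> ?P" and *: "\<bar>\<Sum>i<m. u (c i)\<bar> > \<epsilon> * m" by blast+
    from * have "\<epsilon> * m < (\<Sum>i<m. u (c i)) \<or> \<epsilon> * m < - (\<Sum>i<m. u (c i))"
      by (cases "0 \<le> (\<Sum>i<m. u (c i))") (simp_all only: abs_of_nonneg abs_of_neg not_le simp_thms)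
    with \<open>c \<in> ?P\<close>
    show "c \<in> ?B u \<union> ?B (\<lambda>a. - u a)"
      unfolding sum_negf Un_iff mem_Collect_eq by blast
  qed
  hence "card {c \<in> ?P. \<bar>\<Sum>i<m. u (c i)\<bar> > \<epsilon> * m} \<le> card (?B u \<union> ?B (\<lambda>a. - u a))"
    using finP by (intro card_mono) auto
  also have "\<dots> \<le> card (?B u) + card (?B (\<lambda>a. - u a))" by (rule card_Un_le)
  finally have "real (card {c \<in> ?P. \<bar>\<Sum>i<m. u (c i)\<bar> > \<epsilon> * m}) \<le> real (card (?B u)) + real (card (?B (\<lambda>a. - u a)))"
    by linarith
  moreover have "real (card (?B u)) \<le> exp (- \<epsilon>\<^sup>2 * m / 4) * real (card X) ^ m"
    by (rule card_upper_deviation_le) (use assms in auto)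
  moreover have "real (card (?B (\<lambda>a. - u a))) \<le> exp (- \<epsilon>\<^sup>2 * m / 4) * real (card X) ^ m"
    by (rule card_upper_deviation_le) (use assms in \<open>auto simp: sum_negf\<close>)
  ultimately show ?thesis by linarith
qed

text \<open>Markov's inequality in counting form.\<close>

lemma many_small_values:
  fixes h :: "'a \<Rightarrow> real" and b :: real
  assumes fin: "finite P" and nn: "\<And>c. c \<in> P \<Longrightarrow> 0 \<le> h c" and b: "b > 0"
    and le: "(\<Sum>c\<in>P. h c) \<le> b * card P"
  shows "real (card P) \<le> 2 * card {c \<in> P. h c \<le> 2 * b}"
proof -
  let ?G = "{c \<in> P. h c \<le> 2 * b}"
  have "2 * b * card (P - ?G) = (\<Sum>c\<in>P - ?G. 2 * b)" by simp
  also have "\<dots> \<le> (\<Sum>c\<in>P - ?G. h c)" by (rule sum_mono) auto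
  also have "\<dots> \<le> (\<Sum>c\<in>P. h c)" using fin nn by (intro sum_mono2) auto
  also have "\<dots> \<le> b * card P" by (rule le)
  finally have "2 * card (P - ?G) \<le> real (card P)" using b by simp
  moreover have "card (P - ?G) = card P - card ?G" using fin by (intro card_Diff_subset) auto
  moreover have "card ?G \<le> card P" using fin by (intro card_mono) auto
  ultimately show ?thesis by linarith
qed

lemma sum_card_swap:
  assumes "finite P" "finite G"
  shows "(\<Sum>c\<in>P. card {x \<in> G. R c x}) = (\<Sum>x\<in>G. card {c \<in> P. R c x})"
proof -
  show ?thesis using assms sum.swap[of "\<lambda>c x. if R c x then 1 else (0::nat)" G P]
    by (simp add: sum.If_cases Int_def)
qed

text \<open>Residue classes are represented by subsets of \<open>{0..<N}\<close>, while functions on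
  them are periodic functions on all integers, so that translation needs no reduction.\<close>

definition cyc_ind :: "int \<Rightarrow> int set \<Rightarrow> int \<Rightarrow> real" where
  "cyc_ind N C x = of_bool (x mod N \<in> C)"

lemma cyc_ind_range: "0 \<le> cyc_ind N C x" "cyc_ind N C x \<le> 1"
  by (auto simp: cyc_ind_def)

lemma cyc_ind_cong: "x mod N = y mod N \<Longrightarrow> cyc_ind N C x = cyc_ind N C y"
  by (simp add: cyc_ind_def)

text \<open>With \<open>C\<close> the sumset of \<open>X\<close> mod \<open>N\<close>, this is the
  popularity function: it equals 1 at every point of \<open>X\<close>, and wherever it is positive
  some translate by an element of \<open>X\<close> meets \<open>C\<close>.\<close>

definition cyc_avg :: "int \<Rightarrow> int set \<Rightarrow> int set \<Rightarrow> int \<Rightarrow> real" where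
  "cyc_avg N C X x = (\<Sum>a\<in>X. cyc_ind N C (x + a)) / card X"

lemma average_range:
  fixes h :: "'a \<Rightarrow> real"
  assumes "\<And>i. 0 \<le> h i" "\<And>i. h i \<le> 1"
  shows "0 \<le> (\<Sum>i\<in>I. h i) / card I" "(\<Sum>i\<in>I. h i) / card I \<le> 1"
proof -
  show "0 \<le> (\<Sum>i\<in>I. h i) / card I" using assms by (intro divide_nonneg_nonneg sum_nonneg) auto
  have "(\<Sum>i\<in>I. h i) \<le> (\<Sum>i\<in>I. 1)" using assms by (intro sum_mono) auto
  thus "(\<Sum>i\<in>I. h i) / card I \<le> 1" by (simp add: divide_le_eq)
qed

lemma cyc_avg_range: "0 \<le> cyc_avg N C X x" "cyc_avg N C X x \<le> 1"
  unfolding cyc_avg_def by (rule average_range; rule cyc_ind_range)+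

lemma cyc_avg_cong: "x mod N = y mod N \<Longrightarrow> cyc_avg N C X x = cyc_avg N C X y"
  unfolding cyc_avg_def
  by (intro arg_cong2[where f = "(/)"] sum.cong cyc_ind_cong refl) (metis mod_add_left_eq)

text \<open>
  Sampling \<open>m\<close> points of \<open>X\<close> determines \<open>cyc_avg N C X\<close> up to \<open>\<epsilon>\<close> off a small exceptional set.
  Translating a sample by \<open>t \<in> X\<close> lands in \<open>C\<^sup>m\<close>, so by pigeonhole many \<open>t\<close> share one translated
  sample, whose empirical mean is the function \<open>g\<close>.
\<close>

theorem croot_sisask:
  fixes N :: int and X C :: "int set" and \<epsilon> :: real and m :: nat
  assumes N: "N > 0" and X: "X \<subseteq> {0..<N}" "X \<noteq> {}" and C: "C \<subseteq> {0..<N}"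
    and XC: "\<And>x y. x \<in> X \<Longrightarrow> y \<in> X \<Longrightarrow> (x + y) mod N \<in> C"
    and \<epsilon>: "0 \<le> \<epsilon>" "\<epsilon> \<le> 1" and m: "m > 0"
  obtains T g where "T \<subseteq> X" "card X ^ (m + 1) \<le> 2 * card C ^ m * card T"
    "\<And>t Y. t \<in> T \<Longrightarrow> finite Y \<Longrightarrow> inj_on (\<lambda>y. y mod N) Y \<Longrightarrow>
      (\<Sum>y\<in>Y. \<bar>cyc_avg N C X (y + t) - g y\<bar>) \<le> \<epsilon> * card Y + 4 * exp (- \<epsilon>\<^sup>2 * m / 4) * N"
proof -
  define f where "f = cyc_avg N C X"
  define q where "q = cyc_ind N C"
  define P where "P = PiE {..<m} (\<lambda>_. X)"
  define G where "G = {0..<N}"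
  define \<delta> where "\<delta> = 2 * exp (- \<epsilon>\<^sup>2 * m / 4)"
  define E where "E c = {x \<in> G. \<bar>f x - (\<Sum>i<m. q (x + c i)) / m\<bar> > \<epsilon>}" for c
  have finX: "finite X" "finite C" "finite G" using X C by (auto simp: G_def intro: finite_subset)
  have finP: "finite P" using finX by (auto simp: P_def intro: finite_PiE)
  have cP: "card P = card X ^ m" by (simp add: P_def card_PiE)
  have cX: "card X > 0" using finX X by (simp add: card_gt_0_iff)
  have dev: "real (card {c \<in> P. x \<in> E c}) \<le> \<delta> * card P" if "x \<in> G" for x
  proof -
    define u where "u a = q (x + a) - f x" for a
    have "\<bar>u a\<bar> \<le> 1" for a
      using cyc_ind_range[of N C "x + a"] cyc_avg_range[of N C X x] by (simp add: u_def q_def f_def)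
    moreover have "(\<Sum>a\<in>X. u a) = 0"
      using cX by (simp add: u_def sum_subtractf f_def cyc_avg_def q_def)
    moreover have "{c \<in> P. x \<in> E c} = {c \<in> P. \<bar>\<Sum>i<m. u (c i)\<bar> > \<epsilon> * m}"
    proof -
      have "\<bar>f x - (\<Sum>i<m. q (x + c i)) / m\<bar> > \<epsilon> \<longleftrightarrow> \<bar>\<Sum>i<m. u (c i)\<bar> > \<epsilon> * m" for c
      proof -
        have "f x - (\<Sum>i<m. q (x + c i)) / m = - (\<Sum>i<m. u (c i)) / m"
          using m by (simp add: u_def sum_subtractf field_simps)
        hence "\<bar>f x - (\<Sum>i<m. q (x + c i)) / m\<bar> = \<bar>\<Sum>i<m. u (c i)\<bar> / m" by simp
        thus ?thesis using m by (simp add: less_divide_eq)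
      qed
      thus ?thesis using that by (auto simp: E_def)
    qed
    ultimately show ?thesis
      using card_deviation_le[of X u \<epsilon> m] finX \<epsilon> cP by (simp add: P_def \<delta>_def)
  qed
  have "(\<Sum>c\<in>P. card (E c)) = (\<Sum>c\<in>P. card {x \<in> G. x \<in> E c})"
    by (rule sum.cong) (auto simp: E_def intro!: arg_cong[where f = card])
  also have "\<dots> = (\<Sum>x\<in>G. card {c \<in> P. x \<in> E c})"
    using sum_card_swap[of P G "\<lambda>c x. x \<in> E c"] finP finX by blast
  finally have "(\<Sum>c\<in>P. real (card (E c))) = (\<Sum>x\<in>G. real (card {c \<in> P. x \<in> E c}))"
    by (simp only: of_nat_sum[symmetric])
  also have "\<dots> \<le> (\<Sum>x\<in>G. \<delta> * card P)" by (rule sum_mono) (rule dev)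
  also have "\<dots> = (\<delta> * N) * card P" using N by (simp add: G_def)
  finally have sumE: "(\<Sum>c\<in>P. real (card (E c))) \<le> (\<delta> * N) * card P" .
  \<comment> \<open>At least half of all samples have an exceptional set of at most twice the
    average size. This factor 2 and the one in \<open>\<delta>\<close> make up the 4 in the error
    term; the half explains the 2 in the lower bound for \<open>card T\<close>.\<close>
  define Good where "Good = {c \<in> P. real (card (E c)) \<le> 2 * (\<delta> * N)}"
  have Good: "real (card P) \<le> 2 * card Good"
    unfolding Good_def by (rule many_small_values[OF finP _ _ sumE]) (use N in \<open>auto simp: \<delta>_def\<close>)
  define sh where "sh = (\<lambda>(c, t). \<lambda>i\<in>{..<m}. (c i + t) mod N)"
  define PC where "PC = PiE {..<m} (\<lambda>_. C)"
  have finG: "finite Good" using finP by (simp add: Good_def)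
  have GP: "Good \<subseteq> P" by (auto simp: Good_def)
  have im: "sh ` (Good \<times> X) \<subseteq> PC"
  proof
    fix w assume "w \<in> sh ` (Good \<times> X)"
    then obtain c t where "w = sh (c, t)" "c \<in> P" "t \<in> X" using GP by blast
    thus "w \<in> PC" using XC by (auto simp: sh_def PC_def P_def PiE_iff)
  qed
  obtain x0 where x0: "x0 \<in> X" using X by blast
  have "PC \<noteq> {}" using XC[OF x0 x0] by (auto simp: PC_def PiE_eq_empty_iff)
  moreover have "finite PC" using finX by (auto simp: PC_def intro: finite_PiE)
  ultimately obtain u where u: "u \<in> PC" "card (Good \<times> X) \<le> card PC * card {ct \<in> Good \<times> X. sh ct = u}"
    using pigeonhole_fiber[of "Good \<times> X" PC sh] finG finX(1) im by blast
  define T where "T = snd ` {ct \<in> Good \<times> X. sh ct = u}"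
  \<comment> \<open>For fixed \<open>t\<close> the translated sample determines the original one, as
    elements of \<open>X\<close> are determined by their residues. Hence counting pairs in the fibre
    is the same as counting translations \<open>t\<close>.\<close>
  have "inj_on snd {ct \<in> Good \<times> X. sh ct = u}"
  proof (rule inj_onI)
    fix a b assume a: "a \<in> {ct \<in> Good \<times> X. sh ct = u}" and b: "b \<in> {ct \<in> Good \<times> X. sh ct = u}"
      and ab: "snd a = snd b"
    have P: "fst a \<in> P" "fst b \<in> P" using a b GP by auto
    have "fst a i = fst b i" if i: "i < m" for i
    proof -
      have "sh a i = sh b i" using a b by simp
      hence "(fst a i + snd a) mod N = (fst b i + snd a) mod N"
        using i ab by (simp add: sh_def case_prod_unfold)
      hence "fst a i mod N = fst b i mod N" by (simp add: mod_eq_dvd_iff)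
      moreover have "fst a i \<in> X" "fst b i \<in> X" using P i by (auto simp: P_def PiE_iff)
      ultimately show ?thesis using X by (simp add: subset_iff mod_pos_pos_trivial)
    qed
    hence "fst a = fst b" using P unfolding P_def by (intro PiE_ext[of "fst a" "{..<m}" "\<lambda>_. X"]) auto
    thus "a = b" using ab by (simp add: prod_eq_iff)
  qed
  hence cT: "card T = card {ct \<in> Good \<times> X. sh ct = u}" unfolding T_def by (rule card_image)
  show ?thesis
  proof (rule that[of T "\<lambda>y. (\<Sum>i<m. q (y + u i)) / m"])
    show "T \<subseteq> X" by (auto simp: T_def)
    have "card X ^ (m + 1) \<le> 2 * card Good * card X" using Good cP by (simp flip: of_nat_mult of_nat_power)
    also have "\<dots> \<le> 2 * (card C ^ m * card T)"
      using u(2) cT by (simp add: card_cartesian_product PC_def card_PiE)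
    finally show "card X ^ (m + 1) \<le> 2 * card C ^ m * card T" by simp
  next
    fix t Y assume t: "t \<in> T" and Y: "finite Y" "inj_on (\<lambda>y. y mod N) Y"
    from t obtain c where c: "c \<in> Good" "sh (c, t) = u" by (auto simp: T_def)
    let ?g = "\<lambda>y. (\<Sum>i<m. q (y + u i)) / m"
    have g: "?g y = (\<Sum>i<m. q ((y + t) mod N + c i)) / m" for y
    proof -
      have "q (y + u i) = q ((y + t) mod N + c i)" if "i < m" for i
      proof -
        have ui: "u i = (c i + t) mod N" using c(2) that by (auto simp: sh_def)
        have "(y + u i) mod N = ((y + t) mod N + c i) mod N"
          unfolding ui by (simp add: mod_simps algebra_simps)
        thus ?thesis unfolding q_def by (rule cyc_ind_cong)
      qed
      thus ?thesis by simp
    qed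
    have pt: "\<bar>f (y + t) - ?g y\<bar> \<le> \<epsilon> + of_bool ((y + t) mod N \<in> E c)" for y
    proof -
      have fm: "f (y + t) = f ((y + t) mod N)" unfolding f_def by (rule cyc_avg_cong) simp
      have inG: "(y + t) mod N \<in> G" using N by (simp add: G_def)
      show ?thesis
      proof (cases "(y + t) mod N \<in> E c")
        case False
        thus ?thesis unfolding g fm using inG by (simp add: E_def)
      next
        case True
        have "0 \<le> ?g y" "?g y \<le> 1"
          using average_range[of "\<lambda>i. q (y + u i)" "{..<m}"] by (simp_all add: q_def cyc_ind_range)
        thus ?thesis using True cyc_avg_range[of N C X "y + t"] \<epsilon> by (simp add: f_def abs_le_iff)
      qed
    qed
    have "(\<Sum>y\<in>Y. \<bar>f (y + t) - ?g y\<bar>) \<le> (\<Sum>y\<in>Y. \<epsilon> + of_bool ((y + t) mod N \<in> E c))"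
      by (rule sum_mono) (rule pt)
    also have "\<dots> = \<epsilon> * card Y + card {y \<in> Y. (y + t) mod N \<in> E c}"
      using Y by (simp add: sum.distrib of_bool_def sum.If_cases Int_def)
    \<comment> \<open>Distinct points of \<open>Y\<close> stay distinct mod \<open>N\<close> after
      translation, so each exceptional residue is hit at most once.\<close>
    also have "card {y \<in> Y. (y + t) mod N \<in> E c} \<le> card (E c)"
    proof (rule card_inj_on_le[where f = "\<lambda>y. (y + t) mod N"])
      show "inj_on (\<lambda>y. (y + t) mod N) {y \<in> Y. (y + t) mod N \<in> E c}"
      proof (rule inj_onI)
        fix y z assume "y \<in> {y \<in> Y. (y + t) mod N \<in> E c}" "z \<in> {y \<in> Y. (y + t) mod N \<in> E c}"
          "(y + t) mod N = (z + t) mod N"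
        hence "y \<in> Y" "z \<in> Y" "y mod N = z mod N" by (auto simp: mod_eq_dvd_iff)
        thus "y = z" using Y(2) by (auto dest: inj_onD)
      qed
    qed (auto simp: E_def finX)
    also have "real (card (E c)) \<le> 2 * (\<delta> * N)" using c(1) by (simp add: Good_def)
    finally show "(\<Sum>y\<in>Y. \<bar>cyc_avg N C X (y + t) - ?g y\<bar>) \<le> \<epsilon> * card Y + 4 * exp (- \<epsilon>\<^sup>2 * m / 4) * N"
      by (simp add: f_def \<delta>_def)
  qed
qed

section \<open>Characters and Chang's theorem\<close>

definition chr :: "int \<Rightarrow> int \<Rightarrow> complex" where
  "chr N k = cis (2 * pi * k / N)"

lemma chr_add: "chr N (a + b) = chr N a * chr N b"
  by (simp add: chr_def cis_mult add_divide_distrib distrib_left)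

lemma chr_0 [simp]: "chr N 0 = 1"
  by (simp add: chr_def)

lemma norm_chr [simp]: "norm (chr N k) = 1"
  by (simp add: chr_def)

lemma cnj_chr: "cnj (chr N k) = chr N (- k)"
  by (simp add: chr_def cis_cnj)

lemma chr_eq_1:
  assumes "N dvd k" "N \<noteq> 0"
  shows "chr N k = 1"
proof -
  obtain j where "k = N * j" using assms by (auto elim: dvdE)
  hence "2 * pi * k / N = 2 * pi * j" using assms by simp
  thus ?thesis by (simp add: chr_def cis_multiple_2pi)
qed

lemma chr_neq_1:
  assumes "\<not> N dvd k" "N > 0"
  shows "chr N k \<noteq> 1"
proof
  assume "chr N k = 1"
  hence "cos (2 * pi * k / N) = 1" by (metis chr_def cis.sel(1) one_complex.sel(1))
  then obtain j :: int where "2 * pi * k / N = j * 2 * pi" by (auto simp: cos_one_2pi_int)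
  hence "real_of_int k = real_of_int (j * N)" using assms by (simp add: field_simps)
  hence "k = j * N" by linarith
  thus False using assms by simp
qed

lemma chr_cong:
  assumes "[a = b] (mod N)" "N \<noteq> 0"
  shows "chr N a = chr N b"
proof -
  have "chr N a = chr N (b + (a - b))" by simp
  also have "\<dots> = chr N b * chr N (a - b)" by (rule chr_add)
  also have "chr N (a - b) = 1" using assms by (intro chr_eq_1) (simp_all add: cong_iff_dvd_diff)
  finally show ?thesis by simp
qed

lemma norm_cis_minus_1_le: "norm (cis x - 1) \<le> \<bar>x\<bar>"
proof -
  have "(norm (cis x - 1))\<^sup>2 = (cos x - 1)\<^sup>2 + (sin x)\<^sup>2" by (simp add: cmod_power2)
  also have "\<dots> = 2 - 2 * cos x" using sin_cos_squared_add[of x] by (simp add: power2_eq_square algebra_simps)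
  also have "\<dots> = (2 * sin (x / 2))\<^sup>2" using cos_double_sin[of "x / 2"] by (simp add: power2_eq_square)
  finally have "(norm (cis x - 1))\<^sup>2 = (2 * sin (x / 2))\<^sup>2" .
  hence "norm (cis x - 1) = \<bar>2 * sin (x / 2)\<bar>"
    by (metis norm_ge_zero power2_eq_iff_nonneg abs_ge_zero power2_abs)
  thus ?thesis using abs_sin_x_le_abs_x[of "x / 2"] by simp
qed

lemma norm_chr_minus_1_le:
  fixes N z :: int and \<delta> :: real
  assumes "N > 0" "\<bar>of_int (k - N * z)\<bar> \<le> \<delta> * of_int N"
  shows "norm (chr N k - 1) \<le> 2 * pi * \<delta>"
proof -
  have "chr N k = chr N (k - N * z)" using assms by (intro chr_cong) (simp_all add: cong_iff_dvd_diff)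
  hence "norm (chr N k - 1) \<le> \<bar>2 * pi * real_of_int (k - N * z) / N\<bar>"
    using norm_cis_minus_1_le unfolding chr_def by metis
  also have "\<dots> = 2 * pi * (\<bar>real_of_int (k - N * z)\<bar> / N)"
    using assms(1) by (simp only: abs_mult abs_divide) simp
  also have "\<dots> \<le> 2 * pi * \<delta>"
    using assms by (intro mult_left_mono) (simp_all add: divide_le_eq)
  finally show ?thesis .
qed

lemma sum_mod_shift:
  fixes g :: "int \<Rightarrow> 'a::comm_monoid_add"
  assumes "N > 0"
  shows "(\<Sum>x\<in>{0..<N}. g ((x + t) mod N)) = (\<Sum>x\<in>{0..<N}. g x)"
proof (rule sum.reindex_bij_witness[where i = "\<lambda>x. (x - t) mod N" and j = "\<lambda>x. (x + t) mod N"])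
qed (use assms in \<open>auto simp: mod_simps\<close>)

lemma sum_chr:
  assumes N: "N > 0"
  shows "(\<Sum>x\<in>{0..<N}. chr N (k * x)) = (if N dvd k then of_int N else 0)"
proof (cases "N dvd k")
  case True
  hence "chr N (k * x) = 1" for x using N by (intro chr_eq_1) auto
  thus ?thesis using True N by simp
next
  case False
  let ?S = "\<Sum>x\<in>{0..<N}. chr N (k * x)"
  have "?S = (\<Sum>x\<in>{0..<N}. chr N (k * ((x + 1) mod N)))"
    by (rule sum_mod_shift[OF N, symmetric])
  also have "\<dots> = (\<Sum>x\<in>{0..<N}. chr N (k * x) * chr N k)"
  proof (rule sum.cong[OF refl])
    fix x
    have "chr N (k * ((x + 1) mod N)) = chr N (k * x + k)"
      using N by (intro chr_cong) (auto simp: cong_def mod_simps distrib_left)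
    thus "chr N (k * ((x + 1) mod N)) = chr N (k * x) * chr N k" by (simp add: chr_add)
  qed
  also have "\<dots> = ?S * chr N k" by (simp add: sum_distrib_right)
  finally have "?S * (chr N k - 1) = 0" by (simp add: algebra_simps)
  thus ?thesis using chr_neq_1[OF False N] False by simp
qed

section \<open>Dissociated sets, Riesz products and the large spectrum\<close>

definition dissociated :: "int \<Rightarrow> int set \<Rightarrow> bool" where
  "dissociated N S \<longleftrightarrow> (\<forall>u. (\<forall>l\<in>S. u l \<in> {-1, 0, 1}) \<longrightarrow> N dvd (\<Sum>l\<in>S. u l * l) \<longrightarrow> (\<forall>l\<in>S. u l = 0))"

lemma dissociatedD:
  assumes "dissociated N S" "N dvd (\<Sum>l\<in>S. u l * l)" "\<And>l. l \<in> S \<Longrightarrow> u l \<in> {-1, 0, 1}" "l \<in> S"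
  shows "u l = 0"
  using assms unfolding dissociated_def by blast

text \<open>For real \<open>a\<close> and \<open>b\<close>, this is \<open>N\<close> times a Fourier
  coefficient of the Riesz product with factors \<open>a + 2 b Re (c l chr N (l x))\<close>. Leaving
  \<open>mu\<close> free allows induction over \<open>S\<close>: each new factor shifts
  \<open>mu\<close> by \<open>0\<close>, \<open>s\<close> or \<open>- s\<close>.\<close>

definition riesz_sum :: "int \<Rightarrow> complex \<Rightarrow> complex \<Rightarrow> (int \<Rightarrow> complex) \<Rightarrow> int set \<Rightarrow> int \<Rightarrow> complex" where
  "riesz_sum N a b c S mu = (\<Sum>x\<in>{0..<N}.
     (\<Prod>l\<in>S. a + b * (c l * chr N (l * x) + cnj (c l) * chr N (- l * x))) * chr N (mu * x))"

lemma riesz_sum_insert: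
  assumes "finite S" "s \<notin> S"
  shows "riesz_sum N a b c (insert s S) mu = a * riesz_sum N a b c S mu +
    b * c s * riesz_sum N a b c S (mu + s) + b * cnj (c s) * riesz_sum N a b c S (mu - s)"
proof -
  define R where "R x = (\<Prod>l\<in>S. a + b * (c l * chr N (l * x) + cnj (c l) * chr N (- l * x)))" for x
  have "riesz_sum N a b c (insert s S) mu = (\<Sum>x\<in>{0..<N}. a * (R x * chr N (mu * x)) +
      b * c s * (R x * chr N ((mu + s) * x)) + b * cnj (c s) * (R x * chr N ((mu - s) * x)))"
    unfolding riesz_sum_def
  proof (rule sum.cong[OF refl])
    fix x
    have "chr N ((mu + s) * x) = chr N (s * x) * chr N (mu * x)"
      "chr N ((mu - s) * x) = chr N (- s * x) * chr N (mu * x)"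
      by (simp_all flip: chr_add add: algebra_simps)
    thus "(\<Prod>l\<in>insert s S. a + b * (c l * chr N (l * x) + cnj (c l) * chr N (- l * x))) * chr N (mu * x)
      = a * (R x * chr N (mu * x)) + b * c s * (R x * chr N ((mu + s) * x))
          + b * cnj (c s) * (R x * chr N ((mu - s) * x))"
      unfolding R_def prod.insert[OF assms] by (simp only:) (simp add: algebra_simps)
  qed
  thus ?thesis by (simp only: sum.distrib sum_distrib_left R_def riesz_sum_def)
qed

lemma sum_insert_update:
  fixes u :: "int \<Rightarrow> int"
  assumes "finite S" "s \<notin> S"
  shows "(\<Sum>l\<in>insert s S. (u(s := e)) l * l) = e * s + (\<Sum>l\<in>S. u l * l)"
  using assms by (auto intro!: sum.cong)

text \<open>Expanding the product yields only the frequencies \<open>mu + \<Sum> u l * l\<close>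
  with \<open>u l\<close> in \<open>{-1, 0, 1}\<close>; if none is divisible by \<open>N\<close>,
  orthogonality kills every term.\<close>

lemma riesz_sum_eq_0:
  assumes N: "N > 0" and fin: "finite S"
    and no: "\<And>u. (\<forall>l\<in>S. u l \<in> {-1, 0, 1}) \<Longrightarrow> \<not> N dvd mu + (\<Sum>l\<in>S. u l * l)"
  shows "riesz_sum N a b c S mu = 0"
  using fin no
proof (induction S arbitrary: mu rule: finite_induct)
  case empty
  thus ?case using sum_chr[OF N, of mu] by (simp add: riesz_sum_def)
next
  case (insert s S)
  have IH: "riesz_sum N a b c S (mu + e * s) = 0" if "e \<in> {-1, 0, 1}" for e
  proof (rule insert.IH)
    fix u :: "int \<Rightarrow> int" assume "\<forall>l\<in>S. u l \<in> {-1, 0, 1}"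
    hence "\<not> N dvd mu + (\<Sum>l\<in>insert s S. (u(s := e)) l * l)" by (intro insert.prems) (use that in auto)
    thus "\<not> N dvd mu + e * s + (\<Sum>l\<in>S. u l * l)"
      unfolding sum_insert_update[OF insert.hyps] by (simp only: add.assoc not_False_eq_True)
  qed
  show ?case unfolding riesz_sum_insert[OF insert.hyps] using IH[of 0] IH[of 1] IH[of "-1"] by simp
qed

lemma dissociated_insertD:
  assumes "dissociated N (insert s S)" "s \<notin> S" "finite S"
  shows "dissociated N S"
  unfolding dissociated_def
proof (intro allI impI)
  fix u assume *: "\<forall>l\<in>S. u l \<in> {-1, 0, 1}" "N dvd (\<Sum>l\<in>S. u l * l)"
  have dv: "N dvd (\<Sum>l\<in>insert s S. (u(s := 0)) l * l)"
    unfolding sum_insert_update[OF assms(3,2)] using *(2) by simp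
  show "\<forall>l\<in>S. u l = 0"
  proof
    fix l assume l: "l \<in> S"
    have "(u(s := 0)) l = 0"
    proof (rule dissociatedD[OF assms(1) dv])
      show "(u(s := 0)) l \<in> {-1, 0, 1}" if "l \<in> insert s S" for l
        using that *(1) by (cases "l = s") simp_all
    qed (use l in simp)
    thus "u l = 0" using l assms(2) by (cases "l = s") simp_all
  qed
qed

text \<open>Only the constant term survives: a contribution from the coefficients at
  \<open>s\<close> or \<open>- s\<close> would be a relation in which \<open>s\<close> occurs with
  coefficient 1 or -1, contrary to dissociativity.\<close>

lemma riesz_sum_mean:
  assumes N: "N > 0" and fin: "finite S" and dis: "dissociated N S"
  shows "riesz_sum N a b c S 0 = of_int N * a ^ card S"
  using fin dis
proof (induction S rule: finite_induct)
  case empty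
  thus ?case using N by (simp add: riesz_sum_def)
next
  case (insert s S)
  have z: "riesz_sum N a b c S (e * s) = 0" if e: "e \<in> {-1, 1}" for e
  proof (rule riesz_sum_eq_0[OF N insert.hyps(1)], rule notI)
    fix u :: "int \<Rightarrow> int" assume u: "\<forall>l\<in>S. u l \<in> {-1, 0, 1}" and "N dvd e * s + (\<Sum>l\<in>S. u l * l)"
    hence dv: "N dvd (\<Sum>l\<in>insert s S. (u(s := e)) l * l)" by (simp only: sum_insert_update[OF insert.hyps])
    have "(u(s := e)) s = 0"
    proof (rule dissociatedD[OF insert.prems dv])
      show "(u(s := e)) l \<in> {-1, 0, 1}" if "l \<in> insert s S" for l
        using that u e by (cases "l = s") auto
    qed simp
    thus False using e by auto
  qed
  have "riesz_sum N a b c S 0 = of_int N * a ^ card S"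
    using insert dissociated_insertD by blast
  thus ?case
    unfolding riesz_sum_insert[OF insert.hyps] using z[of 1] z[of "-1"] insert.hyps by simp
qed

definition spec_sum :: "int \<Rightarrow> int set \<Rightarrow> int \<Rightarrow> complex" where
  "spec_sum N T k = (\<Sum>t\<in>T. chr N (k * t))"

lemma exp_ge_tangent: "exp x \<ge> exp y * (1 + (x - y))" for x y :: real
proof -
  have "exp y * (1 + (x - y)) \<le> exp y * exp (x - y)"
    by (intro mult_left_mono exp_ge_add_one_self) auto
  thus ?thesis by (simp flip: exp_add)
qed

text \<open>Compare two estimates for the exponential moment of \<open>F\<close>, a sum of
  characters from \<open>S\<close> rotated so that each has a real positive sum over
  \<open>T\<close>. On \<open>T\<close> the average of \<open>F\<close> is at least
  \<open>card S / 2\<close>. Over all residues the moment is dominated by the mean of a Riesz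
  product, which dissociativity evaluates to \<open>(1 + s^2) ^ card S\<close> per residue.\<close>

theorem chang:
  assumes N: "N > 0" and T: "T \<subseteq> {0..<N}" "T \<noteq> {}" and S: "finite S" "dissociated N S"
    and large: "\<And>l. l \<in> S \<Longrightarrow> norm (spec_sum N T l) \<ge> card T / 2"
  shows "card S \<le> 16 * ln (N / card T)"
proof -
  define c where "c l = cnj (sgn (spec_sum N T l))" for l
  define p where "p l x = Re (c l * chr N (l * x))" for l x
  \<comment> \<open>The argument yields \<open>(s / 2 - s^2) card S \<le> ln (N / card T)\<close>;
    the choice \<open>1/4\<close> maximises the left coefficient, with value
    \<open>1/16\<close>.\<close>
  define s :: real where "s = 1/4"
  define F where "F x = (\<Sum>l\<in>S. p l x)" for x
  have finT: "finite T" using T finite_subset by blast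
  have cT: "card T > 0" using finT T by (simp add: card_gt_0_iff)
  have T0: "spec_sum N T l \<noteq> 0" if "l \<in> S" for l using large[OF that] cT by auto
  have nc: "norm (c l) = 1" if "l \<in> S" for l using T0[OF that] by (simp add: c_def norm_sgn)
  have p1: "\<bar>p l x\<bar> \<le> 1" if "l \<in> S" for l x
  proof -
    have "\<bar>p l x\<bar> \<le> norm (c l * chr N (l * x))" unfolding p_def by (rule abs_Re_le_cmod)
    thus ?thesis using nc[OF that] by (simp add: norm_mult)
  qed
  have sum_p: "(\<Sum>t\<in>T. p l t) = norm (spec_sum N T l)" for l
  proof -
    have "(\<Sum>t\<in>T. p l t) = Re (c l * spec_sum N T l)"
      by (simp add: p_def spec_sum_def sum_distrib_left)
    also have "c l * spec_sum N T l = norm (spec_sum N T l)"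
    proof (cases "spec_sum N T l = 0")
      case False
      have "c l * spec_sum N T l = spec_sum N T l * cnj (spec_sum N T l) / norm (spec_sum N T l)"
        by (simp add: c_def sgn_div_norm scaleR_conv_of_real field_simps)
      also have "\<dots> = (complex_of_real (norm (spec_sum N T l)))\<^sup>2 / complex_of_real (norm (spec_sum N T l))"
        by (simp only: complex_norm_square[symmetric] of_real_power)
      finally show ?thesis using False by (simp add: power2_eq_square)
    qed simp
    finally show ?thesis by simp
  qed
  have expF: "exp (s * F x) \<le> (\<Prod>l\<in>S. (1 + s\<^sup>2) + s * p l x)" for x
  proof -
    have "exp (s * F x) = (\<Prod>l\<in>S. exp (s * p l x))"
      unfolding F_def sum_distrib_left by (rule exp_sum[OF S(1)])
    also have "\<dots> \<le> (\<Prod>l\<in>S. (1 + s\<^sup>2) + s * p l x)"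
    proof (rule prod_mono, safe)
      fix l assume l: "l \<in> S"
      have b: "\<bar>s * p l x\<bar> \<le> 1" using p1[OF l, of x] by (simp add: s_def)
      have "exp (s * p l x) \<le> 1 + s * p l x + (s * p l x)\<^sup>2" using b by (intro exp_le_quadratic) auto
      moreover have "(s * p l x)\<^sup>2 \<le> s\<^sup>2 * 1"
        unfolding power_mult_distrib using p1[OF l, of x] by (intro mult_left_mono) (auto simp: abs_square_le_1)
      ultimately show "exp (s * p l x) \<le> (1 + s\<^sup>2) + s * p l x" by simp
    qed simp
    finally show ?thesis .
  qed
  have prod_c: "complex_of_real (\<Prod>l\<in>S. (1 + s\<^sup>2) + s * p l x) =
      (\<Prod>l\<in>S. of_real (1 + s\<^sup>2) + of_real (s / 2) * (c l * chr N (l * x) + cnj (c l) * chr N (- l * x)))" for x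
  proof -
    have "complex_of_real ((1 + s\<^sup>2) + s * p l x) =
       of_real (1 + s\<^sup>2) + of_real (s / 2) * (c l * chr N (l * x) + cnj (c l) * chr N (- l * x))" for l
    proof -
      have "c l * chr N (l * x) + cnj (c l) * chr N (- l * x) = complex_of_real (2 * p l x)"
        using complex_add_cnj[of "c l * chr N (l * x)"] by (simp add: p_def cnj_chr)
      thus ?thesis by simp
    qed
    thus ?thesis by (simp only: of_real_prod)
  qed
  have "complex_of_real (\<Sum>x\<in>{0..<N}. \<Prod>l\<in>S. (1 + s\<^sup>2) + s * p l x) = of_int N * of_real (1 + s\<^sup>2) ^ card S"
    unfolding of_real_sum prod_c
    by (rule riesz_sum_mean[OF N S, unfolded riesz_sum_def mult_zero_left chr_0 mult_1_right])
  also have "\<dots> = complex_of_real (of_int N * (1 + s\<^sup>2) ^ card S)" by simp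
  finally have mean: "(\<Sum>x\<in>{0..<N}. \<Prod>l\<in>S. (1 + s\<^sup>2) + s * p l x) = of_int N * (1 + s\<^sup>2) ^ card S"
    by (simp only: of_real_eq_iff)
  define m0 where "m0 = s * card S / 2"
  have "(\<Sum>t\<in>T. F t) = (\<Sum>l\<in>S. norm (spec_sum N T l))"
    unfolding F_def by (subst sum.swap) (simp only: sum_p)
  also have "\<dots> \<ge> (\<Sum>l\<in>S. real (card T) / 2)" by (rule sum_mono) (rule large)
  finally have sF: "(\<Sum>t\<in>T. s * F t) \<ge> card T * m0"
    unfolding m0_def s_def sum_distrib_left[symmetric] by (simp add: mult.commute)
  \<comment> \<open>Jensen's inequality for \<open>exp\<close>, carried out with the tangent line at
    \<open>m0\<close>, a lower bound for the mean of \<open>s F\<close> on \<open>T\<close>.\<close>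
  have "card T * exp m0 \<le> exp m0 * (card T + ((\<Sum>t\<in>T. s * F t) - card T * m0))"
    using sF by (simp add: mult.commute)
  also have "\<dots> = (\<Sum>t\<in>T. exp m0 * (1 + (s * F t - m0)))"
    by (simp add: sum.distrib sum_subtractf flip: sum_distrib_left)
  also have "\<dots> \<le> (\<Sum>t\<in>T. exp (s * F t))" by (rule sum_mono) (rule exp_ge_tangent)
  also have "\<dots> \<le> (\<Sum>x\<in>{0..<N}. exp (s * F x))" using T by (intro sum_mono2) auto
  also have "\<dots> \<le> (\<Sum>x\<in>{0..<N}. \<Prod>l\<in>S. (1 + s\<^sup>2) + s * p l x)" by (rule sum_mono) (rule expF)
  also have "\<dots> = of_int N * (1 + s\<^sup>2) ^ card S" by (rule mean)
  also have "\<dots> \<le> of_int N * exp (s\<^sup>2) ^ card S"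
    using N by (intro mult_left_mono power_mono) auto
  also have "exp (s\<^sup>2) ^ card S = exp (card S / 16)"
    by (simp add: s_def power2_eq_square flip: exp_of_nat_mult)
  finally have "exp m0 / exp (card S / 16) \<le> N / card T"
    using cT by (simp add: field_simps)
  hence "exp (card S / 16) \<le> N / card T"
    by (simp add: m0_def s_def flip: exp_diff)
  hence "ln (exp (real (card S) / 16)) \<le> ln (N / card T)"
    using N cT by (intro ln_mono) auto
  thus ?thesis by simp
qed

text \<open>Take a dissociated subset of the spectrum of largest size. Adding any other
  \<open>k\<close> of the spectrum creates a relation, which must involve \<open>k\<close> with
  coefficient 1 or -1 and can therefore be solved for \<open>k\<close>.\<close>

theorem spectrum_spanned:
  assumes N: "N > 0" and T: "T \<subseteq> {0..<N}" "T \<noteq> {}"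
  obtains L where "L \<subseteq> {0..<N}" "card L \<le> 16 * ln (N / card T)"
    "\<And>k. k \<in> {0..<N} \<Longrightarrow> norm (spec_sum N T k) \<ge> card T / 2 \<Longrightarrow>
       \<exists>u. (\<forall>l\<in>L. u l \<in> {-1, 0, 1}) \<and> N dvd k - (\<Sum>l\<in>L. u l * l)"
proof -
  define Sp where "Sp = {k \<in> {0..<N}. norm (spec_sum N T k) \<ge> card T / 2}"
  have finSp: "finite Sp" unfolding Sp_def by (rule finite_subset[of _ "{0..<N}"]) auto
  define F where "F = {S. S \<subseteq> Sp \<and> dissociated N S}"
  have "F \<subseteq> Pow Sp" by (auto simp: F_def)
  hence finF: "finite F" using finSp by (simp add: finite_subset)
  have "{} \<in> F" by (simp add: F_def dissociated_def)
  then obtain L where L: "L \<in> F" "\<And>S. S \<in> F \<Longrightarrow> card S \<le> card L"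
  proof -
    have "finite (card ` F)" "card ` F \<noteq> {}" using finF \<open>{} \<in> F\<close> by auto
    hence "Max (card ` F) \<in> card ` F" by (rule Max_in)
    then obtain L where "L \<in> F" "card L = Max (card ` F)" by auto
    thus ?thesis using finF by (intro that[of L]) auto
  qed
  have LS: "L \<subseteq> Sp" "dissociated N L" using L(1) by (auto simp: F_def)
  have finL: "finite L" using LS finSp finite_subset by blast
  show ?thesis
  proof (rule that[of L])
    show "L \<subseteq> {0..<N}" using LS by (auto simp: Sp_def)
    show "card L \<le> 16 * ln (N / card T)"
      by (rule chang[OF N T finL LS(2)]) (use LS(1) in \<open>auto simp: Sp_def\<close>)
  next
    fix k assume k: "k \<in> {0..<N}" "norm (spec_sum N T k) \<ge> card T / 2"
    show "\<exists>u. (\<forall>l\<in>L. u l \<in> {-1, 0, 1}) \<and> N dvd k - (\<Sum>l\<in>L. u l * l)"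
    proof (cases "k \<in> L")
      case True
      have "(\<Sum>l\<in>L. (if l = k then 1 else 0) * l) = (\<Sum>l\<in>L. if l = k then k else 0)"
        by (rule sum.cong) auto
      also have "\<dots> = k" using True finL by simp
      finally show ?thesis by (intro exI[of _ "\<lambda>l. if l = k then 1 else 0"]) auto
    next
      case False
      have "insert k L \<notin> F"
        using L(2)[of "insert k L"] False finL by auto
      moreover have "insert k L \<subseteq> Sp" using k LS by (auto simp: Sp_def)
      ultimately have "\<not> dissociated N (insert k L)" by (auto simp: F_def)
      then obtain u where u: "\<forall>l\<in>insert k L. u l \<in> {-1, 0, 1}" "N dvd (\<Sum>l\<in>insert k L. u l * l)"
        and nz: "\<exists>l\<in>insert k L. u l \<noteq> 0"
        unfolding dissociated_def by blast
      have sum: "(\<Sum>l\<in>insert k L. u l * l) = u k * k + (\<Sum>l\<in>L. u l * l)"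
        using False finL by simp
      have "u k \<noteq> 0"
      proof
        assume 0: "u k = 0"
        hence dv: "N dvd (\<Sum>l\<in>L. u l * l)" using u(2) sum by simp
        have "u l = 0" if "l \<in> L" for l by (rule dissociatedD[OF LS(2) dv _ that]) (use u(1) in auto)
        thus False using nz 0 by auto
      qed
      hence e: "u k * u k = 1" "u k \<in> {-1, 1}" using u(1) by auto
      have "N dvd u k * (u k * k + (\<Sum>l\<in>L. u l * l))" using u(2) sum by simp
      also have "u k * (u k * k + (\<Sum>l\<in>L. u l * l)) = k - (\<Sum>l\<in>L. (- u k * u l) * l)"
        using e(1) by (simp add: distrib_left sum_negf sum_distrib_left mult.assoc flip: mult.assoc[of "u k" "u k"])
      finally show ?thesis
        using e(2) u(1) by (intro exI[of _ "\<lambda>l. - u k * u l"]) auto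
    qed
  qed
qed

text \<open>The usual condition that every \<open>l b / N\<close> is within \<open>\<delta>\<close>
  of an integer, multiplied through by \<open>N\<close>.\<close>

definition bohr :: "int \<Rightarrow> int set \<Rightarrow> real \<Rightarrow> int set" where
  "bohr N L \<delta> = {b. \<forall>l\<in>L. \<exists>z::int. \<bar>of_int (l * b - N * z)\<bar> \<le> \<delta> * of_int N}"

lemma norm_chr_minus_1_bohr:
  fixes \<delta> :: real
  assumes N: "N > 0" and b: "b \<in> bohr N L \<delta>" and fin: "finite L" 
    and u: "\<forall>l\<in>L. u l \<in> {-1, 0, 1}" "N dvd k - (\<Sum>l\<in>L. u l * l)"
  shows "norm (chr N (k * b) - 1) \<le> 2 * pi * (card L * \<delta>)"
proof -
  have "\<forall>l\<in>L. \<exists>z::int. \<bar>of_int (l * b - N * z)\<bar> \<le> \<delta> * of_int N" using b by (simp add: bohr_def)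
  then obtain z :: "int \<Rightarrow> int" where z: "\<And>l. l \<in> L \<Longrightarrow> \<bar>real_of_int (l * b - N * z l)\<bar> \<le> \<delta> * of_int N"
    by metis
  obtain j where j: "k - (\<Sum>l\<in>L. u l * l) = N * j" using u(2) by (auto elim: dvdE)
  define w where "w = (\<Sum>l\<in>L. u l * z l) + j * b"
  have k: "k = (\<Sum>l\<in>L. u l * l) + N * j" using j by simp
  have "k * b - N * w = (\<Sum>l\<in>L. u l * (l * b - N * z l))"
    unfolding k w_def by (simp add: algebra_simps sum_distrib_left sum_distrib_right sum_subtractf)
  hence "\<bar>real_of_int (k * b - N * w)\<bar> = \<bar>\<Sum>l\<in>L. of_int (u l) * real_of_int (l * b - N * z l)\<bar>"
    by (simp only: of_int_sum of_int_mult)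
  also have "\<dots> \<le> (\<Sum>l\<in>L. \<bar>of_int (u l) * real_of_int (l * b - N * z l)\<bar>)" by (rule sum_abs)
  also have "\<dots> \<le> (\<Sum>l\<in>L. \<delta> * of_int N)"
  proof (rule sum_mono)
    fix l assume l: "l \<in> L"
    have "\<bar>real_of_int (u l)\<bar> \<le> 1" using u(1) l by auto
    hence "\<bar>real_of_int (u l)\<bar> * \<bar>real_of_int (l * b - N * z l)\<bar> \<le> 1 * (\<delta> * of_int N)"
      using z[OF l] by (intro mult_mono) auto
    thus "\<bar>of_int (u l) * real_of_int (l * b - N * z l)\<bar> \<le> \<delta> * of_int N" by (simp only: abs_mult mult_1)
  qed
  also have "\<dots> = (card L * \<delta>) * of_int N" by simp
  finally show ?thesis by (rule norm_chr_minus_1_le[OF N])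
qed

section \<open>Smoothing and Bogolyubov's theorem\<close>

lemma spec_sum_cnj: "cnj (spec_sum N C k) = (\<Sum>c\<in>C. chr N (- (k * c)))"
  by (simp add: spec_sum_def cnj_chr)

lemma parseval:
  assumes N: "N > 0" and C: "C \<subseteq> {0..<N}"
  shows "(\<Sum>k\<in>{0..<N}. (norm (spec_sum N C k))\<^sup>2) = real_of_int N * card C"
proof -
  have finC: "finite C" using C finite_subset by blast
  have "complex_of_real (\<Sum>k\<in>{0..<N}. (norm (spec_sum N C k))\<^sup>2) = (\<Sum>k\<in>{0..<N}. spec_sum N C k * cnj (spec_sum N C k))"
    by (simp only: of_real_sum complex_norm_square)
  also have "\<dots> = (\<Sum>k\<in>{0..<N}. \<Sum>c\<in>C. \<Sum>d\<in>C. chr N ((c - d) * k))"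
    unfolding spec_sum_cnj unfolding spec_sum_def sum_product
    by (intro sum.cong refl) (simp add: algebra_simps flip: chr_add)
  also have "\<dots> = (\<Sum>c\<in>C. \<Sum>k\<in>{0..<N}. \<Sum>d\<in>C. chr N ((c - d) * k))" by (rule sum.swap)
  also have "\<dots> = (\<Sum>c\<in>C. \<Sum>d\<in>C. \<Sum>k\<in>{0..<N}. chr N ((c - d) * k))"
    by (intro sum.cong refl sum.swap)
  also have "\<dots> = (\<Sum>c\<in>C. \<Sum>d\<in>C. if d = c then of_int N else 0)"
  proof (intro sum.cong refl)
    fix c d assume cd: "c \<in> C" "d \<in> C"
    have "N dvd c - d \<longleftrightarrow> d = c"
    proof
      assume "N dvd c - d"
      hence "c mod N = d mod N" by (simp add: mod_eq_dvd_iff)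
      thus "d = c" using cd C by (auto simp: subset_iff)
    qed simp
    thus "(\<Sum>k\<in>{0..<N}. chr N ((c - d) * k)) = (if d = c then of_int N else 0)"
      by (simp only: sum_chr[OF N])
  qed
  also have "\<dots> = complex_of_real (real_of_int N * card C)" using finC by simp
  finally show ?thesis by (simp only: of_real_eq_iff)
qed

lemma cyc_ind_fourier:
  assumes N: "N > 0" and C: "C \<subseteq> {0..<N}"
  shows "of_int N * complex_of_real (cyc_ind N C y) = (\<Sum>k\<in>{0..<N}. cnj (spec_sum N C k) * chr N (k * y))"
proof -
  have finC: "finite C" using C finite_subset by blast
  have "(\<Sum>k\<in>{0..<N}. cnj (spec_sum N C k) * chr N (k * y)) = (\<Sum>k\<in>{0..<N}. \<Sum>c\<in>C. chr N ((y - c) * k))"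
    unfolding spec_sum_cnj sum_distrib_right
    by (intro sum.cong refl) (simp add: algebra_simps flip: chr_add)
  also have "\<dots> = (\<Sum>c\<in>C. \<Sum>k\<in>{0..<N}. chr N ((y - c) * k))" by (rule sum.swap)
  also have "\<dots> = (\<Sum>c\<in>C. if c = y mod N then of_int N else 0)"
  proof (intro sum.cong refl)
    fix c assume c: "c \<in> C"
    have "N dvd y - c \<longleftrightarrow> c = y mod N"
      using c C by (auto simp: subset_iff mod_eq_dvd_iff[symmetric])
    thus "(\<Sum>k\<in>{0..<N}. chr N ((y - c) * k)) = (if c = y mod N then of_int N else 0)"
      by (simp only: sum_chr[OF N])
  qed
  also have "\<dots> = of_int N * complex_of_real (cyc_ind N C y)" using finC by (simp add: cyc_ind_def)
  finally show ?thesis by simp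
qed

lemma cyc_avg_fourier:
  assumes N: "N > 0" and C: "C \<subseteq> {0..<N}" and X: "X \<subseteq> {0..<N}" "X \<noteq> {}"
  shows "complex_of_real (cyc_avg N C X y) =
    (\<Sum>k\<in>{0..<N}. cnj (spec_sum N C k) * spec_sum N X k * chr N (k * y)) / (of_int N * card X)"
proof -
  have finX: "finite X" using X finite_subset by blast
  have cX: "card X > 0" using finX X by (simp add: card_gt_0_iff)
  have "of_int N * (of_nat (card X) * complex_of_real (cyc_avg N C X y)) = (\<Sum>a\<in>X. of_int N * complex_of_real (cyc_ind N C (y + a)))"
  proof -
    have "real (card X) * cyc_avg N C X y = (\<Sum>a\<in>X. cyc_ind N C (y + a))"
      using cX by (simp add: cyc_avg_def)
    hence "of_nat (card X) * complex_of_real (cyc_avg N C X y) = complex_of_real (\<Sum>a\<in>X. cyc_ind N C (y + a))"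
      by (metis of_real_mult of_real_of_nat_eq)
    thus ?thesis by (simp add: sum_distrib_left)
  qed
  also have "\<dots> = (\<Sum>a\<in>X. \<Sum>k\<in>{0..<N}. cnj (spec_sum N C k) * chr N (k * (y + a)))"
    by (simp only: cyc_ind_fourier[OF N C])
  also have "\<dots> = (\<Sum>k\<in>{0..<N}. \<Sum>a\<in>X. cnj (spec_sum N C k) * chr N (k * (y + a)))" by (rule sum.swap)
  also have "\<dots> = (\<Sum>k\<in>{0..<N}. cnj (spec_sum N C k) * spec_sum N X k * chr N (k * y))"
    unfolding spec_sum_def[of N X]
    by (intro sum.cong refl) (simp add: sum_distrib_left sum_distrib_right distrib_left chr_add mult_ac)
  finally have "(of_int N * of_nat (card X)) * complex_of_real (cyc_avg N C X y) =
     (\<Sum>k\<in>{0..<N}. cnj (spec_sum N C k) * spec_sum N X k * chr N (k * y))" by (simp only: mult.assoc)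
  moreover have "of_int N * of_nat (card X) \<noteq> (0::complex)" using N cX by simp
  ultimately show ?thesis by (simp add: field_simps)
qed

text \<open>Averaging over differences \<open>t - t'\<close> rather than over \<open>T\<close> alone
  makes the Fourier multiplier \<open>norm (spec_sum N T k)^2 / (card T)^2\<close> real and
  contained in \<open>[0, 1]\<close>.\<close>

primrec smooth :: "int set \<Rightarrow> (int \<Rightarrow> real) \<Rightarrow> nat \<Rightarrow> int \<Rightarrow> real" where
  "smooth T f 0 = f"
| "smooth T f (Suc j) = (\<lambda>y. (\<Sum>t\<in>T. \<Sum>t'\<in>T. smooth T f j (y + (t - t'))) / (card T)\<^sup>2)"

lemma smooth_fourier:
  assumes f: "\<And>y. complex_of_real (f y) = (\<Sum>k\<in>G. a k * chr N (k * y))"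
  shows "complex_of_real (smooth T f j y) = (\<Sum>k\<in>G. a k * of_real (((norm (spec_sum N T k))\<^sup>2 / (card T)\<^sup>2) ^ j) * chr N (k * y))"
proof (induction j arbitrary: y)
  case 0
  show ?case by (simp add: f)
next
  case (Suc j)
  define w where "w k = complex_of_real (((norm (spec_sum N T k))\<^sup>2 / (card T)\<^sup>2) ^ j)" for k
  have "complex_of_real (smooth T f (Suc j) y) = (\<Sum>t\<in>T. \<Sum>t'\<in>T. \<Sum>k\<in>G. a k * w k * chr N (k * (y + (t - t')))) / of_nat ((card T)\<^sup>2)"
    using Suc by (simp add: w_def)
  also have "(\<Sum>t\<in>T. \<Sum>t'\<in>T. \<Sum>k\<in>G. a k * w k * chr N (k * (y + (t - t'))))
     = (\<Sum>t\<in>T. \<Sum>k\<in>G. \<Sum>t'\<in>T. a k * w k * chr N (k * (y + (t - t'))))"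
    by (intro sum.cong refl sum.swap)
  also have "\<dots> = (\<Sum>k\<in>G. \<Sum>t\<in>T. \<Sum>t'\<in>T. a k * w k * chr N (k * (y + (t - t'))))"
    by (rule sum.swap)
  also have "\<dots> = (\<Sum>k\<in>G. a k * w k * chr N (k * y) * (spec_sum N T k * cnj (spec_sum N T k)))"
  proof (intro sum.cong refl)
    fix k
    have "chr N (k * (y + (t - t'))) = chr N (k * y) * (chr N (k * t) * chr N (- (k * t')))" for t t'
      by (simp add: algebra_simps flip: chr_add)
    thus "(\<Sum>t\<in>T. \<Sum>t'\<in>T. a k * w k * chr N (k * (y + (t - t')))) =
       a k * w k * chr N (k * y) * (spec_sum N T k * cnj (spec_sum N T k))"
      unfolding spec_sum_cnj unfolding spec_sum_def sum_product
      by (simp only: sum_distrib_left mult.assoc)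
  qed
  also have "\<dots> / of_nat ((card T)\<^sup>2) = (\<Sum>k\<in>G. a k * (w k * of_real ((norm (spec_sum N T k))\<^sup>2 / (card T)\<^sup>2)) * chr N (k * y))"
    unfolding sum_divide_distrib by (intro sum.cong refl) (simp flip: complex_norm_square)
  finally show ?case by (simp only: w_def power_Suc2 of_real_mult)
qed

lemma inj_on_mod_shift:
  fixes Y :: "int set"
  assumes "inj_on (\<lambda>y. y mod N) Y"
  shows "inj_on (\<lambda>y. y mod N) ((\<lambda>y. y + s) ` Y)"
proof (rule inj_onI)
  fix u v assume "u \<in> (\<lambda>y. y + s) ` Y" "v \<in> (\<lambda>y. y + s) ` Y" and eq: "u mod N = v mod N"
  then obtain y z where yz: "u = y + s" "v = z + s" "y \<in> Y" "z \<in> Y" by auto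
  hence "y mod N = z mod N" using eq by (simp add: mod_eq_dvd_iff)
  thus "u = v" using assms yz by (auto dest: inj_onD)
qed

text \<open>Both \<open>f (y - t' + t)\<close> and \<open>f (y - t' + t')\<close>, which is
  \<open>f y\<close>, are compared with \<open>g (y - t')\<close>, so one more averaging costs
  \<open>2 e\<close>. The hypothesis on \<open>Y\<close> is invariant under translation, which is
  what lets the induction pass from \<open>Y\<close> to its shifts.\<close>

lemma smooth_near:
  fixes e :: real and M :: nat
  assumes T: "finite T" "T \<noteq> {}"
    and near: "\<And>t Y. t \<in> T \<Longrightarrow> finite Y \<Longrightarrow> inj_on (\<lambda>y. y mod N) Y \<Longrightarrow> card Y = M \<Longrightarrow>
      (\<Sum>y\<in>Y. \<bar>f (y + t) - g y\<bar>) \<le> e"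
    and Y: "finite Y" "inj_on (\<lambda>y. y mod N) Y" "card Y = M"
  shows "(\<Sum>y\<in>Y. \<bar>smooth T f j y - f y\<bar>) \<le> 2 * real j * e"
  using Y
proof (induction j arbitrary: Y)
  case 0
  thus ?case by simp
next
  case (Suc j)
  have cT: "card T > 0" using T by (simp add: card_gt_0_iff)
  have shift: "(\<Sum>y\<in>Y. h (y + s)) = (\<Sum>y\<in>(\<lambda>y. y + s) ` Y. h y)" for h :: "int \<Rightarrow> real" and s
    by (subst sum.reindex) (auto simp: inj_on_def)
  have Ys: "finite ((\<lambda>y. y + s) ` Y)" "inj_on (\<lambda>y. y mod N) ((\<lambda>y. y + s) ` Y)" "card ((\<lambda>y. y + s) ` Y) = M" for s
    using Suc.prems inj_on_mod_shift[of N Y s] by (auto simp: card_image inj_on_def)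
  have one: "(\<Sum>y\<in>Y. \<bar>smooth T f j (y + (t - t')) - f y\<bar>) \<le> 2 * real (Suc j) * e" if t: "t \<in> T" "t' \<in> T" for t t'
  proof -
    have "(\<Sum>y\<in>Y. \<bar>smooth T f j (y + (t - t')) - f y\<bar>)
      \<le> (\<Sum>y\<in>Y. \<bar>smooth T f j (y + (t - t')) - f (y + (t - t'))\<bar> + (\<bar>f ((y + (- t')) + t) - g (y + (- t'))\<bar>
           + \<bar>f ((y + (- t')) + t') - g (y + (- t'))\<bar>))"
      by (rule sum_mono) (simp add: algebra_simps)
    also have "\<dots> = (\<Sum>y\<in>Y. \<bar>smooth T f j (y + (t - t')) - f (y + (t - t'))\<bar>)
       + ((\<Sum>y\<in>Y. \<bar>f ((y + (- t')) + t) - g (y + (- t'))\<bar>) + (\<Sum>y\<in>Y. \<bar>f ((y + (- t')) + t') - g (y + (- t'))\<bar>))"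
      by (simp only: sum.distrib)
    also have "\<dots> \<le> 2 * real j * e + (e + e)"
    proof (intro add_mono)
      show "(\<Sum>y\<in>Y. \<bar>smooth T f j (y + (t - t')) - f (y + (t - t'))\<bar>) \<le> 2 * real j * e"
        unfolding shift[of "\<lambda>y. \<bar>smooth T f j y - f y\<bar>"] using Suc.IH[OF Ys] by simp
      show "(\<Sum>y\<in>Y. \<bar>f ((y + (- t')) + t) - g (y + (- t'))\<bar>) \<le> e"
        unfolding shift[of "\<lambda>y. \<bar>f (y + t) - g y\<bar>"] by (rule near[OF t(1)]) (rule Ys)+
      show "(\<Sum>y\<in>Y. \<bar>f ((y + (- t')) + t') - g (y + (- t'))\<bar>) \<le> e"
        unfolding shift[of "\<lambda>y. \<bar>f (y + t') - g y\<bar>"] by (rule near[OF t(2)]) (rule Ys)+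
    qed
    finally show ?thesis by (simp add: algebra_simps)
  qed
  have "(card T)\<^sup>2 * (\<Sum>y\<in>Y. \<bar>smooth T f (Suc j) y - f y\<bar>) = (\<Sum>y\<in>Y. \<bar>\<Sum>t\<in>T. \<Sum>t'\<in>T. (smooth T f j (y + (t - t')) - f y)\<bar>)"
  proof -
    have "(card T)\<^sup>2 * \<bar>smooth T f (Suc j) y - f y\<bar> = \<bar>\<Sum>t\<in>T. \<Sum>t'\<in>T. (smooth T f j (y + (t - t')) - f y)\<bar>" for y
    proof -
      have "(\<Sum>t\<in>T. \<Sum>t'\<in>T. (smooth T f j (y + (t - t')) - f y)) = (\<Sum>t\<in>T. \<Sum>t'\<in>T. smooth T f j (y + (t - t'))) - (card T)\<^sup>2 * f y"
        by (simp add: sum_subtractf power2_eq_square)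
      also have "\<dots> = (card T)\<^sup>2 * (smooth T f (Suc j) y - f y)"
        using cT by (simp add: field_simps)
      finally show ?thesis by (simp add: abs_mult)
    qed
    thus ?thesis by (simp only: sum_distrib_left)
  qed
  also have "\<dots> \<le> (\<Sum>y\<in>Y. \<Sum>t\<in>T. \<Sum>t'\<in>T. \<bar>smooth T f j (y + (t - t')) - f y\<bar>)"
    by (intro sum_mono order.trans[OF sum_abs] sum_abs)
  also have "\<dots> = (\<Sum>t\<in>T. \<Sum>y\<in>Y. \<Sum>t'\<in>T. \<bar>smooth T f j (y + (t - t')) - f y\<bar>)" by (rule sum.swap)
  also have "\<dots> = (\<Sum>t\<in>T. \<Sum>t'\<in>T. \<Sum>y\<in>Y. \<bar>smooth T f j (y + (t - t')) - f y\<bar>)"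
    by (intro sum.cong refl sum.swap)
  also have "\<dots> \<le> (\<Sum>t\<in>T. \<Sum>t'\<in>T. 2 * real (Suc j) * e)" by (intro sum_mono one)
  also have "\<dots> = (card T)\<^sup>2 * (2 * real (Suc j) * e)" by (simp add: power2_eq_square)
  finally show ?case using cT by simp
qed

lemma norm_spec_sum_le: "norm (spec_sum N T k) \<le> card T"
proof -
  have "norm (spec_sum N T k) \<le> (\<Sum>t\<in>T. norm (chr N (k * t)))" unfolding spec_sum_def by (rule norm_sum)
  thus ?thesis by simp
qed

text \<open>It suffices that the sum of \<open>f (x + b)\<close> over \<open>x\<close> in
  \<open>X\<close> is positive, since then some \<open>x + b + a\<close> lies in \<open>C\<close>
  mod \<open>N\<close>. As \<open>f\<close> is 1 on \<open>X\<close>, this follows once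
  \<open>f\<close> is close to its smoothing \<open>h\<close> on both \<open>X\<close> and
  \<open>X + b\<close>, and \<open>h\<close> changes by at most \<open>1/4\<close> under translation
  by \<open>b\<close>.\<close>

theorem bogolyubov_cyclic:
  fixes N :: int and X :: "int set" and K \<epsilon> :: real and m k :: nat
  defines "C \<equiv> (\<lambda>(x, y). (x + y) mod N) ` (X \<times> X)"
  assumes N: "N > 0" and X: "X \<subseteq> {0..<N}" "X \<noteq> {}" and K: "card C \<le> K * card X" "1 \<le> K"
    and \<epsilon>: "0 \<le> \<epsilon>" "\<epsilon> \<le> 1" and m: "m > 0"
    and c1: "16 * k * (\<epsilon> * card X + 4 * exp (- \<epsilon>\<^sup>2 * m / 4) * N) \<le> card X"
    and c2: "8 * K \<le> 4 ^ k"
  obtains L where "L \<subseteq> {0..<N}" "card L \<le> 16 * ln (2 * K ^ m * N / card X)"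
    "\<And>\<delta> b. 8 * K * pi * card L * \<delta> \<le> 1 \<Longrightarrow> b \<in> bohr N L \<delta> \<Longrightarrow>
      \<exists>x\<in>X. \<exists>a\<in>X. \<exists>y\<in>X. \<exists>z\<in>X. N dvd b + x + a - y - z"
proof -
  define f where "f = cyc_avg N C X"
  define e where "e = \<epsilon> * card X + 4 * exp (- \<epsilon>\<^sup>2 * m / 4) * N"
  have finX: "finite X" using X finite_subset by blast
  have cX: "card X > 0" using finX X by (simp add: card_gt_0_iff)
  have C: "C \<subseteq> {0..<N}" using N by (auto simp: C_def)
  have XC: "(x + y) mod N \<in> C" if "x \<in> X" "y \<in> X" for x y using that by (auto simp: C_def)
  obtain T g where T: "T \<subseteq> X" "card X ^ (m + 1) \<le> 2 * card C ^ m * card T"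
    and near: "\<And>t Y. t \<in> T \<Longrightarrow> finite Y \<Longrightarrow> inj_on (\<lambda>y. y mod N) Y \<Longrightarrow>
      (\<Sum>y\<in>Y. \<bar>f (y + t) - g y\<bar>) \<le> \<epsilon> * card Y + 4 * exp (- \<epsilon>\<^sup>2 * m / 4) * N"
    unfolding f_def by (rule croot_sisask[OF N X C XC \<epsilon> m]) (assumption, assumption, rule that[unfolded f_def], assumption+)
  have finT: "finite T" using T finX finite_subset by blast
  have "card T \<noteq> 0" using T(2) cX by (intro notI) simp
  hence cT: "card T > 0" "T \<noteq> {}" by auto
  have TN: "T \<subseteq> {0..<N}" using T X by blast
  obtain L where L: "L \<subseteq> {0..<N}" "card L \<le> 16 * ln (N / card T)"
    "\<And>k. k \<in> {0..<N} \<Longrightarrow> norm (spec_sum N T k) \<ge> card T / 2 \<Longrightarrow>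
       \<exists>\<epsilon>. (\<forall>l\<in>L. \<epsilon> l \<in> {-1, 0, 1}) \<and> N dvd k - (\<Sum>l\<in>L. \<epsilon> l * l)"
    using spectrum_spanned[OF N TN cT(2)] by blast
  have finL: "finite L" using L finite_subset by blast
  define h where "h = smooth T f k"
  have hf: "(\<Sum>y\<in>Y. \<bar>h y - f y\<bar>) \<le> 2 * real k * e" if Y: "finite Y" "inj_on (\<lambda>y. y mod N) Y" "card Y = card X" for Y
    unfolding h_def
  proof (rule smooth_near[OF finT cT(2) _ Y])
    fix t Y' assume "t \<in> T" "finite Y'" "inj_on (\<lambda>y. y mod N) Y'" "card Y' = card X"
    thus "(\<Sum>y\<in>Y'. \<bar>f (y + t) - g y\<bar>) \<le> e" using near[of t Y'] by (simp add: e_def)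
  qed
  define W where "W j = ((norm (spec_sum N T j))\<^sup>2 / (card T)\<^sup>2) ^ k" for j
  define a where "a j = cnj (spec_sum N C j) * spec_sum N X j / (of_int N * card X)" for j
  have f_four: "complex_of_real (f y) = (\<Sum>j\<in>{0..<N}. a j * chr N (j * y))" for y
    unfolding f_def cyc_avg_fourier[OF N C X] a_def by (simp add: sum_divide_distrib)
  have h_four: "complex_of_real (h y) = (\<Sum>j\<in>{0..<N}. a j * of_real (W j) * chr N (j * y))" for y
    unfolding h_def W_def by (rule smooth_fourier[OF f_four])
  \<comment> \<open>The inequality between the arithmetic and geometric means and Parseval give the
    mean of \<open>card C\<close> and \<open>card X\<close>, relative to
    \<open>card X\<close>.\<close>
  have sum_a: "(\<Sum>j\<in>{0..<N}. norm (a j)) \<le> K"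
  proof -
    have "(\<Sum>j\<in>{0..<N}. norm (spec_sum N C j) * norm (spec_sum N X j))
       \<le> (\<Sum>j\<in>{0..<N}. ((norm (spec_sum N C j))\<^sup>2 + (norm (spec_sum N X j))\<^sup>2) / 2)"
    proof (rule sum_mono)
      fix j
      show "norm (spec_sum N C j) * norm (spec_sum N X j)
        \<le> ((norm (spec_sum N C j))\<^sup>2 + (norm (spec_sum N X j))\<^sup>2) / 2"
        using sum_squares_bound[of "norm (spec_sum N C j)" "norm (spec_sum N X j)"] by simp
    qed
    also have "\<dots> = ((\<Sum>j\<in>{0..<N}. (norm (spec_sum N C j))\<^sup>2) + (\<Sum>j\<in>{0..<N}. (norm (spec_sum N X j))\<^sup>2)) / 2"
      by (simp only: sum.distrib sum_divide_distrib[symmetric])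
    also have "\<dots> = (of_int N * real (card C) + of_int N * real (card X)) / 2"
      by (simp only: parseval[OF N C] parseval[OF N X(1)])
    also have "\<dots> \<le> (of_int N * (K * card X) + of_int N * (K * card X)) / 2"
    proof -
      have "real (card X) \<le> K * card X" using K(2) by (simp add: mult_le_cancel_right1)
      thus ?thesis using K(1) N by (intro divide_right_mono add_mono mult_left_mono) auto
    qed
    also have "\<dots> = K * (N * card X)" by simp
    finally have "(\<Sum>j\<in>{0..<N}. norm (spec_sum N C j) * norm (spec_sum N X j)) / (N * card X) \<le> K"
      using N cX by (simp add: divide_le_eq)
    moreover have "norm (a j) = norm (spec_sum N C j) * norm (spec_sum N X j) / (N * card X)" for j
      using N by (simp add: a_def norm_divide norm_mult)
    ultimately show ?thesis by (simp add: sum_divide_distrib)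
  qed
  have main: "\<exists>x\<in>X. \<exists>a\<in>X. \<exists>y\<in>X. \<exists>z\<in>X. N dvd b + x + a - y - z"
    if \<delta>: "8 * K * pi * card L * \<delta> \<le> 1" and b: "b \<in> bohr N L \<delta>" for \<delta> b
  proof -
    have W: "0 \<le> W j" "W j \<le> 1" for j
    proof -
      have "(norm (spec_sum N T j))\<^sup>2 \<le> (real (card T))\<^sup>2" using norm_spec_sum_le by (intro power_mono) auto
      thus "0 \<le> W j" "W j \<le> 1" unfolding W_def using cT by (auto intro!: power_le_one)
    qed
    \<comment> \<open>On the spectrum \<open>b\<close> moves the character by little, since the
      frequency is spanned by \<open>L\<close>; off it the weight is at most \<open>4 ^ -k\<close>
      while the character moves by at most 2, and \<open>c2\<close> makes
      \<open>2 / 4 ^ k \<le> 1 / (4 K)\<close>.\<close>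
    have Wchr: "W j * norm (chr N (j * b) - 1) \<le> 1 / (4 * K)" if j: "j \<in> {0..<N}" for j
    proof (cases "norm (spec_sum N T j) \<ge> card T / 2")
      case True
      obtain u where "\<forall>l\<in>L. u l \<in> {-1, 0, 1}" "N dvd j - (\<Sum>l\<in>L. u l * l)"
        using L(3)[OF j True] by blast
      hence "norm (chr N (j * b) - 1) \<le> 2 * pi * (card L * \<delta>)"
        by (rule norm_chr_minus_1_bohr[OF N b finL])
      also have "\<dots> \<le> 1 / (4 * K)" using \<delta> K(2) by (simp add: field_simps)
      finally have "W j * norm (chr N (j * b) - 1) \<le> 1 * (1 / (4 * K))"
        using W by (intro mult_mono) auto
      thus ?thesis by simp
    next
      case False
      have "(norm (spec_sum N T j))\<^sup>2 \<le> (card T / 2)\<^sup>2" using False by (intro power_mono) auto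
      hence "(norm (spec_sum N T j))\<^sup>2 / (card T)\<^sup>2 \<le> 1 / 4" using cT by (simp add: power_divide field_simps)
      hence "W j \<le> (1 / 4) ^ k" unfolding W_def by (intro power_mono) auto
      moreover have "norm (chr N (j * b) - 1) \<le> 2"
        using norm_triangle_ineq4[of "chr N (j * b)" 1] by simp
      ultimately have "W j * norm (chr N (j * b) - 1) \<le> (1 / 4) ^ k * 2" using W by (intro mult_mono) auto
      also have "\<dots> \<le> 1 / (4 * K)" using c2 K(2) by (simp add: field_simps)
      finally show ?thesis .
    qed
    have hb: "\<bar>h (x + b) - h x\<bar> \<le> 1 / 4" for x
    proof -
      have "complex_of_real (h (x + b) - h x) = (\<Sum>j\<in>{0..<N}. a j * of_real (W j) * chr N (j * x) * (chr N (j * b) - 1))"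
        by (simp add: h_four sum_subtractf[symmetric] distrib_left chr_add algebra_simps)
      hence "\<bar>h (x + b) - h x\<bar> = norm (\<Sum>j\<in>{0..<N}. a j * of_real (W j) * chr N (j * x) * (chr N (j * b) - 1))"
        by (metis norm_of_real real_norm_def)
      also have "\<dots> \<le> (\<Sum>j\<in>{0..<N}. norm (a j * of_real (W j) * chr N (j * x) * (chr N (j * b) - 1)))"
        by (rule norm_sum)
      also have "\<dots> = (\<Sum>j\<in>{0..<N}. norm (a j) * (W j * norm (chr N (j * b) - 1)))"
        using W by (simp add: norm_mult mult.assoc)
      also have "\<dots> \<le> (\<Sum>j\<in>{0..<N}. norm (a j) * (1 / (4 * K)))"
        by (intro sum_mono mult_left_mono Wchr) auto
      also have "\<dots> = (\<Sum>j\<in>{0..<N}. norm (a j)) * (1 / (4 * K))" by (simp only: sum_distrib_right)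
      also have "\<dots> \<le> K * (1 / (4 * K))" using sum_a K(2) by (intro mult_right_mono) auto
      also have "\<dots> = 1 / 4" using K(2) by simp
      finally show ?thesis .
    qed
    have fX: "f x = 1" if "x \<in> X" for x
      using that XC cX by (simp add: f_def cyc_avg_def cyc_ind_def)
    have Xinj: "inj_on (\<lambda>y. y mod N) X" using X(1) by (auto simp: inj_on_def subset_iff)
    have n1: "(\<Sum>x\<in>X. \<bar>h x - f x\<bar>) \<le> 2 * real k * e" by (rule hf[OF finX Xinj refl])
    have "(\<Sum>x\<in>X. \<bar>h (x + b) - f (x + b)\<bar>) = (\<Sum>x\<in>(\<lambda>x. x + b) ` X. \<bar>h x - f x\<bar>)"
      by (subst sum.reindex) (auto simp: inj_on_def)
    also have "\<dots> \<le> 2 * real k * e"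
      by (rule hf) (use finX inj_on_mod_shift[OF Xinj] in \<open>auto simp: card_image inj_on_def\<close>)
    finally have n2: "(\<Sum>x\<in>X. \<bar>h (x + b) - f (x + b)\<bar>) \<le> 2 * real k * e" .
    have "(\<Sum>x\<in>X. 1 - f (x + b)) \<le> (\<Sum>x\<in>X. \<bar>h x - f x\<bar> + \<bar>h (x + b) - f (x + b)\<bar> + 1 / 4)"
    proof (rule sum_mono)
      fix x assume "x \<in> X"
      thus "1 - f (x + b) \<le> \<bar>h x - f x\<bar> + \<bar>h (x + b) - f (x + b)\<bar> + 1 / 4"
        using hb[of x] fX[of x] by linarith
    qed
    also have "\<dots> \<le> 2 * real k * e + 2 * real k * e + card X / 4"
    proof -
      have "(\<Sum>x\<in>X. \<bar>h x - f x\<bar> + \<bar>h (x + b) - f (x + b)\<bar> + 1 / 4)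
        = (\<Sum>x\<in>X. \<bar>h x - f x\<bar>) + (\<Sum>x\<in>X. \<bar>h (x + b) - f (x + b)\<bar>) + card X / 4"
        by (simp add: sum.distrib)
      thus ?thesis using n1 n2 by linarith
    qed
    \<comment> \<open>By \<open>c1\<close> the two smoothing errors add up to at most
      \<open>card X / 4\<close>, so the total loss is at most half of \<open>card X\<close>.\<close>
    also have "\<dots> < card X"
    proof -
      have "16 * (real k * e) \<le> card X" using c1 by (simp add: e_def)
      moreover have "2 * real k * e + 2 * real k * e = 4 * (real k * e)" by simp
      moreover have "0 < real (card X)" using cX by simp
      ultimately show ?thesis by linarith
    qed
    finally have "(\<Sum>x\<in>X. f (x + b)) > 0" by (simp add: sum_subtractf)
    then obtain x where x: "x \<in> X" "f (x + b) > 0"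
      by (metis not_less sum_nonpos)
    hence "(\<Sum>a\<in>X. cyc_ind N C (x + b + a)) > 0" using cX by (simp add: f_def cyc_avg_def zero_less_divide_iff)
    then obtain a where a: "a \<in> X" "cyc_ind N C (x + b + a) > 0"
      by (metis not_less sum_nonpos)
    hence "(x + b + a) mod N \<in> C" by (simp add: cyc_ind_def split: if_splits)
    then obtain y z where yz: "y \<in> X" "z \<in> X" "(x + b + a) mod N = (y + z) mod N" by (auto simp: C_def)
    hence "N dvd b + x + a - y - z" by (simp add: mod_eq_dvd_iff algebra_simps)
    thus ?thesis using x a yz by blast
  qed
  \<comment> \<open>Small doubling turns the size bound from sampling into
    \<open>card T \<ge> card X / (2 K ^ m)\<close>, the density that enters the bound on
    \<open>card L\<close>.\<close>
  have "real (card X) * real (card X) ^ m \<le> 2 * real (card C) ^ m * card T"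
  proof -
    have "real (card X ^ (m + 1)) \<le> real (2 * card C ^ m * card T)" by (rule of_nat_mono) (rule T(2))
    thus ?thesis by simp
  qed
  also have "\<dots> \<le> 2 * (K * card X) ^ m * card T"
    using K by (intro mult_right_mono mult_left_mono power_mono) auto
  finally have "real (card X) \<le> 2 * K ^ m * card T"
    using cX by (simp add: power_mult_distrib)
  hence "N / card T \<le> 2 * K ^ m * N / card X"
    using cT cX N by (simp add: field_simps)
  hence "ln (N / card T) \<le> ln (2 * K ^ m * N / card X)" using N cT by (intro ln_mono) auto
  hence "card L \<le> 16 * ln (2 * K ^ m * N / card X)" using L(2) by linarith
  thus ?thesis using that[OF L(1)] main by blast
qed

section \<open>Discrete groups and progressions in Bohr sets\<close>

text \<open>Inserting 0 gives the expected value 0 on an empty index set and changes nothing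
  otherwise.\<close>

definition sup_norm :: "'i set \<Rightarrow> ('i \<Rightarrow> real) \<Rightarrow> real" where
  "sup_norm I v = Max (insert 0 ((\<lambda>i. \<bar>v i\<bar>) ` I))"

lemma sup_norm_le_iff: "finite I \<Longrightarrow> sup_norm I v \<le> r \<longleftrightarrow> 0 \<le> r \<and> (\<forall>i\<in>I. \<bar>v i\<bar> \<le> r)"
  by (simp add: sup_norm_def)

lemma sup_norm_nonneg: "finite I \<Longrightarrow> 0 \<le> sup_norm I v"
  by (simp add: sup_norm_def)

lemma abs_le_sup_norm: "finite I \<Longrightarrow> i \<in> I \<Longrightarrow> \<bar>v i\<bar> \<le> sup_norm I v"
  using sup_norm_le_iff[of I v "sup_norm I v"] by simp

lemma sup_norm_attained:
  assumes "finite I" "sup_norm I v > 0"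
  obtains i where "i \<in> I" "\<bar>v i\<bar> = sup_norm I v"
proof -
  have "sup_norm I v \<in> insert 0 ((\<lambda>i. \<bar>v i\<bar>) ` I)"
    unfolding sup_norm_def using assms by (intro Max_in) auto
  thus ?thesis using assms that by auto
qed

definition int_span_independent :: "nat \<Rightarrow> (nat \<Rightarrow> 'i \<Rightarrow> real) \<Rightarrow> bool" where
  "int_span_independent n v \<longleftrightarrow>
     (\<forall>c::nat \<Rightarrow> int. (\<forall>i. (\<Sum>j<n. of_int (c j) * v j i) = 0) \<longrightarrow> (\<forall>j<n. c j = 0))"

text \<open>A discrete subgroup of the real functions supported on \<open>I\<close>. Full rank is
  not demanded, so that no rank has to be tracked when projecting.\<close>

definition discrete_group :: "'i set \<Rightarrow> ('i \<Rightarrow> real) set \<Rightarrow> bool" where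
  "discrete_group I G \<longleftrightarrow> (\<lambda>_. 0) \<in> G \<and> (\<forall>u\<in>G. \<forall>v\<in>G. (\<lambda>i. u i - v i) \<in> G) \<and>
     (\<forall>v\<in>G. \<forall>i. i \<notin> I \<longrightarrow> v i = 0) \<and> (\<forall>r. finite {v \<in> G. sup_norm I v \<le> r})"

lemma discrete_group_add:
  assumes "discrete_group I G" "u \<in> G" "v \<in> G"
  shows "(\<lambda>i. u i + v i) \<in> G"
proof -
  have sub: "\<And>u v. u \<in> G \<Longrightarrow> v \<in> G \<Longrightarrow> (\<lambda>i. u i - v i) \<in> G" and z: "(\<lambda>_. 0) \<in> G"
    using assms(1) by (simp_all add: discrete_group_def)
  show ?thesis using sub[OF assms(2) sub[OF z assms(3)]] by simp
qed

lemma discrete_group_int_mult: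
  fixes k :: int
  assumes dg: "discrete_group I G" and u: "u \<in> G"
  shows "(\<lambda>i. of_int k * u i) \<in> G"
proof (induction k rule: int_induct[of _ 0])
  case base
  show ?case using dg by (simp add: discrete_group_def)
next
  case (step1 k)
  show ?case using discrete_group_add[OF dg step1(2) u] by (simp add: distrib_right add.commute)
next
  case (step2 k)
  have "(\<lambda>i. of_int k * u i - u i) \<in> G" using dg step2(2) u by (simp add: discrete_group_def)
  thus ?case by (simp add: left_diff_distrib)
qed

lemma card_le_fibers:
  fixes M :: real
  assumes "finite A" "\<And>y. y \<in> f ` A \<Longrightarrow> real (card {a \<in> A. f a = y}) \<le> M"
  shows "real (card A) \<le> card (f ` A) * M"
proof -
  have "(\<Union>y\<in>f ` A. {a \<in> A. f a = y}) = A" by blast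
  hence "card A \<le> (\<Sum>y\<in>f ` A. card {a \<in> A. f a = y})"
    using card_UN_le[of "f ` A" "\<lambda>y. {a \<in> A. f a = y}"] assms(1) by simp
  hence "real (card A) \<le> (\<Sum>y\<in>f ` A. real (card {a \<in> A. f a = y}))"
    unfolding of_nat_sum[symmetric] by (rule of_nat_mono)
  also have "\<dots> \<le> (\<Sum>y\<in>f ` A. M)" by (rule sum_mono) (rule assms(2))
  finally show ?thesis by simp
qed

lemma shortest_vector:
  assumes dg: "discrete_group I G" and I: "finite I" and ne: "G \<noteq> {\<lambda>_. 0}"
  obtains w where "w \<in> G" "sup_norm I w > 0" "\<And>u. u \<in> G \<Longrightarrow> u \<noteq> (\<lambda>_. 0) \<Longrightarrow> sup_norm I w \<le> sup_norm I u"
proof -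
  have z: "(\<lambda>_. 0) \<in> G" and fin: "\<And>r. finite {v \<in> G. sup_norm I v \<le> r}"
    and supp: "\<And>v i. v \<in> G \<Longrightarrow> i \<notin> I \<Longrightarrow> v i = 0"
    using dg by (simp_all add: discrete_group_def)
  obtain u where u: "u \<in> G" "u \<noteq> (\<lambda>_. 0)" using ne z by blast
  define S where "S = {v \<in> G. sup_norm I v \<le> sup_norm I u} - {\<lambda>_. 0}"
  have S: "finite S" "S \<noteq> {}" using fin u by (auto simp: S_def)
  define w where "w = arg_min_on (sup_norm I) S"
  have wS: "w \<in> S" unfolding w_def using S by (rule arg_min_if_finite)
  have least: "sup_norm I w \<le> sup_norm I v" if "v \<in> S" for v
    unfolding w_def using S that by (rule arg_min_least)
  have le: "sup_norm I w \<le> sup_norm I v" if "v \<in> G" "v \<noteq> (\<lambda>_. 0)" for v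
  proof (cases "sup_norm I v \<le> sup_norm I u")
    case True
    thus ?thesis using that least by (simp add: S_def)
  next
    case False
    thus ?thesis using wS by (simp add: S_def)
  qed
  have w: "w \<in> G" "w \<noteq> (\<lambda>_. 0)" using wS by (simp_all add: S_def)
  then obtain i where i: "w i \<noteq> 0" by blast
  hence "i \<in> I" using supp w by blast
  hence "\<bar>w i\<bar> \<le> sup_norm I w" using I by (rule abs_le_sup_norm[rotated])
  hence "sup_norm I w > 0" using i by linarith
  thus ?thesis using that w le by blast
qed

text \<open>
  Induction on the number of coordinates: project along a shortest vector \<open>w\<close>, killing a coordinate
  at which \<open>w\<close> attains its norm, and lift a basis of the image back. Lifts are at most twice as long
  as their images because no nonzero vector is shorter than \<open>w\<close>. This loses \<open>4 ^ d\<close> against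
  Minkowski's second theorem, which is harmless here.
\<close>

theorem discrete_group_basis:
  assumes "finite I" "discrete_group I G" "card I = d"
  shows "\<exists>n v. n \<le> d \<and> (\<forall>j<n. v j \<in> G \<and> sup_norm I (v j) > 0) \<and> int_span_independent n v \<and>
    (\<forall>r\<ge>0. card {u \<in> G. sup_norm I u \<le> r} \<le> (\<Prod>j<n. 1 + 4 ^ d * r / sup_norm I (v j)))"
  using assms
proof (induction d arbitrary: I G)
  case 0
  hence "G \<subseteq> {\<lambda>_. 0}" by (auto simp: discrete_group_def)
  hence "card {u \<in> G. sup_norm I u \<le> r} \<le> card {\<lambda>_::'a. 0::real}" for r
    by (intro card_mono) auto
  thus ?case by (intro exI[of _ 0]) (auto simp: int_span_independent_def)
next
  case (Suc d)
  note I = \<open>finite I\<close> and dg = \<open>discrete_group I G\<close>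
  show ?case
  proof (cases "G = {\<lambda>_. 0}")
    case True
    hence "card {u \<in> G. sup_norm I u \<le> r} \<le> card {\<lambda>_::'a. 0::real}" for r
      by (intro card_mono) auto
    thus ?thesis by (intro exI[of _ 0]) (auto simp: int_span_independent_def)
  next
    case False
    have sub: "\<And>u v. u \<in> G \<Longrightarrow> v \<in> G \<Longrightarrow> (\<lambda>i. u i - v i) \<in> G" and z: "(\<lambda>_. 0) \<in> G"
      and fin: "\<And>r. finite {v \<in> G. sup_norm I v \<le> r}"
      and supp: "\<And>v i. v \<in> G \<Longrightarrow> i \<notin> I \<Longrightarrow> v i = 0"
      using dg by (simp_all add: discrete_group_def)
    obtain w where w: "w \<in> G" "sup_norm I w > 0"
      and shortest: "\<And>u. u \<in> G \<Longrightarrow> u \<noteq> (\<lambda>_. 0) \<Longrightarrow> sup_norm I w \<le> sup_norm I u"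
      using shortest_vector[OF dg I False] by blast
    define nu where "nu = sup_norm I w"
    have nu: "nu > 0" using w by (simp add: nu_def)
    obtain i0 where i0: "i0 \<in> I" "\<bar>w i0\<bar> = nu" unfolding nu_def using sup_norm_attained[OF I w(2)] by blast
    have wi0: "w i0 \<noteq> 0" using i0 nu by auto
    have wle: "\<bar>w i\<bar> \<le> nu" if "i \<in> I" for i unfolding nu_def using I that by (rule abs_le_sup_norm)
    define J where "J = I - {i0}"
    have J: "finite J" "card J = d" using I i0 Suc.prems by (auto simp: J_def)
    define pr where "pr u = (\<lambda>i. u i - (u i0 / w i0) * w i)" for u :: "'a \<Rightarrow> real"
    \<comment> \<open>Subtracting the nearest integer multiple of \<open>w\<close> leaves the
      projection unchanged and a component along \<open>w\<close> of at most half its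
      length.\<close>
    have reduce: "\<exists>x\<in>G. pr x = pr u \<and> sup_norm I x \<le> sup_norm J (pr u) + nu / 2" if u: "u \<in> G" for u
    proof -
      define k where "k = round (u i0 / w i0)"
      define x where "x = (\<lambda>i. u i - of_int k * w i)"
      have x: "x \<in> G" unfolding x_def by (intro sub u discrete_group_int_mult[OF dg w(1)])
      have px: "pr x = pr u" unfolding pr_def x_def using wi0 by (auto simp: fun_eq_iff field_simps)
      define s where "s = x i0 / w i0"
      have "s = u i0 / w i0 - of_int k" using wi0 by (simp add: s_def x_def diff_divide_distrib)
      hence s: "\<bar>s\<bar> \<le> 1 / 2" unfolding k_def using of_int_round_abs_le[of "u i0 / w i0"] by (simp add: abs_minus_commute)
      have "\<bar>x i\<bar> \<le> sup_norm J (pr u) + nu / 2" if i: "i \<in> I" for i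
      proof -
        have "x i = pr u i + s * w i" unfolding px[symmetric] by (simp add: pr_def s_def)
        hence "\<bar>x i\<bar> \<le> \<bar>pr u i\<bar> + \<bar>s\<bar> * \<bar>w i\<bar>" by (simp add: abs_triangle_ineq abs_mult flip: abs_mult)
        moreover have "\<bar>s\<bar> * \<bar>w i\<bar> \<le> 1 / 2 * nu" using s wle[OF i] by (intro mult_mono) auto
        moreover have "\<bar>pr u i\<bar> \<le> sup_norm J (pr u)"
        proof (cases "i = i0")
          case True
          thus ?thesis using wi0 sup_norm_nonneg[OF J(1)] by (simp add: pr_def)
        next
          case False
          thus ?thesis using i J by (intro abs_le_sup_norm) (auto simp: J_def)
        qed
        ultimately show ?thesis by linarith
      qed
      hence "sup_norm I x \<le> sup_norm J (pr u) + nu / 2"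
        using I J nu sup_norm_nonneg[OF J(1), of "pr u"] by (simp add: sup_norm_le_iff)
      thus ?thesis using x px by blast
    qed
    have dg': "discrete_group J (pr ` G)"
      unfolding discrete_group_def
    proof (intro conjI ballI allI impI)
      have "pr (\<lambda>_. 0) = (\<lambda>_. 0)" by (simp add: pr_def)
      thus "(\<lambda>_. 0) \<in> pr ` G" using z by (metis imageI)
    next
      fix u v assume "u \<in> pr ` G" "v \<in> pr ` G"
      then obtain a b where ab: "u = pr a" "v = pr b" "a \<in> G" "b \<in> G" by blast
      have "(\<lambda>i. u i - v i) = pr (\<lambda>i. a i - b i)"
        unfolding ab pr_def by (simp add: fun_eq_iff diff_divide_distrib left_diff_distrib)
      thus "(\<lambda>i. u i - v i) \<in> pr ` G" using sub[OF ab(3,4)] by simp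
    next
      fix v i assume "v \<in> pr ` G" "i \<notin> J"
      then obtain u where u: "u \<in> G" "v = pr u" "i \<notin> I \<or> i = i0" by (auto simp: J_def)
      thus "v i = 0" using supp[of u i] supp[of w i] w(1) wi0 by (auto simp: pr_def)
    next
      fix r
      have "{v \<in> pr ` G. sup_norm J v \<le> r} \<subseteq> pr ` {x \<in> G. sup_norm I x \<le> r + nu / 2}"
      proof
        fix v assume "v \<in> {v \<in> pr ` G. sup_norm J v \<le> r}"
        then obtain u where u: "u \<in> G" "v = pr u" "sup_norm J (pr u) \<le> r" by blast
        obtain x where x: "x \<in> G" "pr x = pr u" "sup_norm I x \<le> sup_norm J (pr u) + nu / 2"
          using reduce[OF u(1)] by blast
        have "sup_norm I x \<le> r + nu / 2" using x(3) u(3) by linarith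
        thus "v \<in> pr ` {x \<in> G. sup_norm I x \<le> r + nu / 2}" using x(1,2) u(2)
          by (intro image_eqI[of _ _ x]) simp_all
      qed
      thus "finite {v \<in> pr ` G. sup_norm J v \<le> r}" using fin finite_subset by blast
    qed
    obtain n y where n: "n \<le> d" and y: "\<And>j. j < n \<Longrightarrow> y j \<in> pr ` G" "\<And>j. j < n \<Longrightarrow> sup_norm J (y j) > 0"
      and ind: "int_span_independent n y"
      and cnt: "\<And>r. r \<ge> 0 \<Longrightarrow> card {u \<in> pr ` G. sup_norm J u \<le> r} \<le> (\<Prod>j<n. 1 + 4 ^ d * r / sup_norm J (y j))"
      using Suc.IH[OF J(1) dg' J(2)] by blast
    \<comment> \<open>A reduced lift has norm at most the norm of \<open>y j\<close> plus
      \<open>nu / 2\<close>, and being non-zero it has norm at least \<open>nu\<close>; so half of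
      its own norm absorbs the extra term, which gives the factor 2.\<close>
    have "\<exists>x. j < n \<longrightarrow> x \<in> G \<and> pr x = y j \<and> nu \<le> sup_norm I x \<and> sup_norm I x \<le> 2 * sup_norm J (y j)" for j
    proof (cases "j < n")
      case True
      obtain u where u: "u \<in> G" "y j = pr u" using y(1)[OF True] by blast
      obtain x where x: "x \<in> G" "pr x = pr u" "sup_norm I x \<le> sup_norm J (pr u) + nu / 2"
        using reduce[OF u(1)] by blast
      have "x \<noteq> (\<lambda>_. 0)"
      proof
        assume "x = (\<lambda>_. 0)"
        hence "y j = (\<lambda>_. 0)" using u x by (simp add: pr_def)
        hence "sup_norm J (y j) \<le> 0" using J(1) by (simp add: sup_norm_le_iff)
        thus False using y(2)[OF True] by linarith
      qed
      hence "nu \<le> sup_norm I x" using shortest x(1) by (simp add: nu_def)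
      thus ?thesis using x u by (intro exI[of _ x]) auto
    qed simp
    then obtain x where x: "\<And>j. j < n \<Longrightarrow> x j \<in> G" "\<And>j. j < n \<Longrightarrow> pr (x j) = y j"
      "\<And>j. j < n \<Longrightarrow> nu \<le> sup_norm I (x j)" "\<And>j. j < n \<Longrightarrow> sup_norm I (x j) \<le> 2 * sup_norm J (y j)"
      by metis
    define v where "v = case_nat w x"
    have v0: "v 0 = w" "v (Suc j) = x j" for j by (simp_all add: v_def)
    have "int_span_independent (Suc n) v"
      unfolding int_span_independent_def
    proof (intro allI impI)
      fix c :: "nat \<Rightarrow> int" and j
      assume "\<forall>i. (\<Sum>j<Suc n. of_int (c j) * v j i) = 0" and j: "j < Suc n"
      hence S: "of_int (c 0) * w i + (\<Sum>j<n. of_int (c (Suc j)) * x j i) = 0" for i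
        by (simp only: sum.lessThan_Suc_shift v0)
      have "(\<Sum>j<n. of_int (c (Suc j)) * y j i) = 0" for i
      proof -
        have "(\<Sum>j<n. of_int (c (Suc j)) * y j i) = (\<Sum>j<n. of_int (c (Suc j)) * x j i - (of_int (c (Suc j)) * x j i0) * (w i / w i0))"
          by (rule sum.cong) (auto simp: x(2)[symmetric] pr_def algebra_simps)
        also have "\<dots> = (\<Sum>j<n. of_int (c (Suc j)) * x j i) - (\<Sum>j<n. of_int (c (Suc j)) * x j i0) * (w i / w i0)"
          by (simp only: sum_subtractf sum_distrib_right)
        also have "\<dots> = - of_int (c 0) * w i - (- of_int (c 0) * w i0) * (w i / w i0)"
        proof -
          have "(\<Sum>j<n. of_int (c (Suc j)) * x j i) = - of_int (c 0) * w i" for i using S[of i] by simp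
          thus ?thesis by (simp only:)
        qed
        also have "\<dots> = 0" using wi0 by simp
        finally show ?thesis .
      qed
      hence c: "\<forall>j<n. c (Suc j) = 0"
        using ind unfolding int_span_independent_def by (elim allE[of _ "\<lambda>j. c (Suc j)"]) simp
      hence "of_int (c 0) * w i0 = 0" using S[of i0] by simp
      hence "c 0 = 0" using wi0 by simp
      thus "c j = 0" using c j by (cases j) auto
    qed
    moreover have "card {u \<in> G. sup_norm I u \<le> r} \<le> (\<Prod>j<Suc n. 1 + 4 ^ Suc d * r / sup_norm I (v j))" if r: "r \<ge> 0" for r
    proof -
      define B where "B = {u \<in> G. sup_norm I u \<le> r}"
      have finB: "finite B" unfolding B_def by (rule fin)
      \<comment> \<open>Two points of a fibre differ by a real multiple of \<open>w\<close>. If the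
        multiple is below 1 in absolute value, the difference is a group element shorter than
        \<open>w\<close>, hence 0; so the fibre is counted by integer parts.\<close>
      have fib: "real (card {u \<in> B. pr u = p}) \<le> 1 + 2 * r / nu" for p
      proof -
        define F where "F = {u \<in> B. pr u = p}"
        define g where "g u = \<lfloor>u i0 / w i0 + r / nu\<rfloor>" for u :: "'a \<Rightarrow> real"
        have "inj_on g F"
        proof (rule inj_onI)
          fix u u' assume u: "u \<in> F" "u' \<in> F" and g: "g u = g u'"
          define s where "s = u i0 / w i0 - u' i0 / w i0"
          have s1: "\<bar>s\<bar> < 1" using g unfolding g_def s_def by linarith
          have uu: "u i - u' i = s * w i" for i
          proof -
            have "pr u i = pr u' i" using u by (simp add: F_def)
            thus ?thesis by (simp add: pr_def s_def left_diff_distrib)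
          qed
          define t where "t = (\<lambda>i. u i - u' i)"
          have tG: "t \<in> G" unfolding t_def using u by (intro sub) (auto simp: F_def B_def)
          have "t = (\<lambda>_. 0)"
          proof (rule ccontr)
            assume ne: "t \<noteq> (\<lambda>_. 0)"
            have "\<bar>t i\<bar> \<le> \<bar>s\<bar> * nu" if "i \<in> I" for i
              using wle[OF that] by (simp add: t_def uu abs_mult mult_left_mono)
            hence "sup_norm I t \<le> \<bar>s\<bar> * nu" using I nu by (simp add: sup_norm_le_iff)
            also have "\<dots> < nu" using s1 nu by simp
            finally show False using shortest[OF tG ne] by (simp add: nu_def)
          qed
          thus "u = u'" by (simp add: t_def fun_eq_iff)
        qed
        moreover have "g ` F \<subseteq> {0..\<lfloor>2 * r / nu\<rfloor>}"
        proof
          fix q assume "q \<in> g ` F"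
          then obtain u where u: "q = g u" "u \<in> F" by blast
          have "\<bar>u i0\<bar> \<le> sup_norm I u" using I i0(1) by (rule abs_le_sup_norm)
          hence "\<bar>u i0\<bar> \<le> r" using u by (simp add: F_def B_def)
          hence "\<bar>u i0 / w i0\<bar> \<le> r / nu" using i0(2) nu by (simp add: divide_right_mono)
          hence "0 \<le> u i0 / w i0 + r / nu" "u i0 / w i0 + r / nu \<le> 2 * r / nu" by linarith+
          thus "q \<in> {0..\<lfloor>2 * r / nu\<rfloor>}" using u(1) by (simp add: g_def floor_mono)
        qed
        ultimately have "card F \<le> card {0..\<lfloor>2 * r / nu\<rfloor>}" by (intro card_inj_on_le) auto
        also have "real \<dots> = of_int \<lfloor>2 * r / nu\<rfloor> + 1" using r nu by simp
        also have "\<dots> \<le> 1 + 2 * r / nu" by linarith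
        finally show ?thesis by (simp add: F_def)
      qed
      \<comment> \<open>Projection can double the norm, because the multiple of \<open>w\<close>
        removed has norm at most \<open>r\<close>. This 2 and the 2 from lifting produce the factor
        4 per dimension.\<close>
      have "pr ` B \<subseteq> {u \<in> pr ` G. sup_norm J u \<le> 2 * r}"
      proof
        fix p assume "p \<in> pr ` B"
        then obtain u where u: "p = pr u" "u \<in> B" by blast
        have ur: "\<bar>u i\<bar> \<le> r" if "i \<in> I" for i
          using abs_le_sup_norm[OF I that, of u] u by (simp add: B_def)
        have "\<bar>p i\<bar> \<le> 2 * r" if i: "i \<in> J" for i
        proof -
          have iI: "i \<in> I" using i by (simp add: J_def)
          have "\<bar>u i0 / w i0\<bar> * \<bar>w i\<bar> \<le> (r / nu) * nu"
            using ur[OF i0(1)] wle[OF iI] i0(2) nu r by (intro mult_mono) (auto simp: divide_right_mono)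
          hence "\<bar>(u i0 / w i0) * w i\<bar> \<le> r" using nu by (simp only: abs_mult) simp
          thus ?thesis using ur[OF iI] unfolding u pr_def by linarith
        qed
        hence "sup_norm J p \<le> 2 * r" using J r by (simp add: sup_norm_le_iff)
        thus "p \<in> {u \<in> pr ` G. sup_norm J u \<le> 2 * r}" using u by (auto simp: B_def)
      qed
      moreover have "finite {u \<in> pr ` G. sup_norm J u \<le> 2 * r}" using dg' by (simp add: discrete_group_def)
      ultimately have "real (card (pr ` B)) \<le> card {u \<in> pr ` G. sup_norm J u \<le> 2 * r}"
        by (simp add: card_mono)
      also have "\<dots> \<le> (\<Prod>j<n. 1 + 4 ^ d * (2 * r) / sup_norm J (y j))" using cnt[of "2 * r"] r by simp
      also have "\<dots> \<le> (\<Prod>j<n. 1 + 4 ^ Suc d * r / sup_norm I (x j))"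
      proof (rule prod_mono, safe)
        fix j assume j: "j < n"
        show "0 \<le> 1 + 4 ^ d * (2 * r) / sup_norm J (y j)" using r y(2)[OF j] by simp
        have xp: "sup_norm I (x j) > 0" using x(3)[OF j] nu by linarith
        have "4 ^ d * (2 * r) / sup_norm J (y j) = 4 ^ Suc d * r / (2 * sup_norm J (y j))"
          using y(2)[OF j] by (simp add: field_simps)
        also have "\<dots> \<le> 4 ^ Suc d * r / sup_norm I (x j)"
          using x(4)[OF j] xp r by (intro divide_left_mono) auto
        finally show "1 + 4 ^ d * (2 * r) / sup_norm J (y j) \<le> 1 + 4 ^ Suc d * r / sup_norm I (x j)" by simp
      qed
      finally have pB: "real (card (pr ` B)) \<le> (\<Prod>j<n. 1 + 4 ^ Suc d * r / sup_norm I (x j))" .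
      have "real (card B) \<le> card (pr ` B) * (1 + 2 * r / nu)"
        by (rule card_le_fibers[OF finB fib])
      also have "\<dots> \<le> (\<Prod>j<n. 1 + 4 ^ Suc d * r / sup_norm I (x j)) * (1 + 4 ^ Suc d * r / nu)"
      proof (rule mult_mono[OF pB])
        have "(2::real) \<le> 4 ^ Suc d" unfolding power_Suc using one_le_power[of "4::real" d] by linarith
        hence "2 * r \<le> 4 ^ Suc d * r" using r by (intro mult_right_mono) auto
        thus "1 + 2 * r / nu \<le> 1 + 4 ^ Suc d * r / nu" using nu by (simp add: divide_right_mono)
        show "0 \<le> (\<Prod>j<n. 1 + 4 ^ Suc d * r / sup_norm I (x j))"
          using r sup_norm_nonneg[OF I] by (intro prod_nonneg) (auto intro!: add_nonneg_nonneg divide_nonneg_nonneg)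
        show "0 \<le> 1 + 2 * r / nu" using r nu by simp
      qed
      also have "\<dots> = (\<Prod>j<Suc n. 1 + 4 ^ Suc d * r / sup_norm I (v j))"
        by (simp only: prod.lessThan_Suc_shift v0 nu_def mult.commute)
      finally show ?thesis by (simp add: B_def)
    qed
    moreover have "\<forall>j<Suc n. v j \<in> G \<and> sup_norm I (v j) > 0"
    proof (intro allI impI)
      fix j assume "j < Suc n"
      thus "v j \<in> G \<and> sup_norm I (v j) > 0"
        using x(1,3) w nu by (cases j) (fastforce simp: v0)+
    qed
    ultimately show ?thesis using n by (intro exI[of _ "Suc n"] exI[of _ v]) auto
  qed
qed

text \<open>The lattice \<open>(y * i)\<^sub>i + N * \<int>\<^sup>I\<close>; short vectors correspond to elements \<open>y\<close> of a Bohr set.\<close>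

definition bohr_lattice :: "int \<Rightarrow> int set \<Rightarrow> (int \<Rightarrow> real) set" where
  "bohr_lattice N I = {v. (\<forall>i. i \<notin> I \<longrightarrow> v i = 0) \<and> (\<exists>y::int. \<forall>i\<in>I. \<exists>z::int. v i = of_int (i * y - N * z))}"

lemma discrete_group_bohr_lattice:
  assumes I: "finite I"
  shows "discrete_group I (bohr_lattice N I)"
  unfolding discrete_group_def
proof (intro conjI ballI allI impI)
  show "(\<lambda>_. 0) \<in> bohr_lattice N I" unfolding bohr_lattice_def by (auto intro!: exI[of _ "0::int"])
next
  fix u v assume "u \<in> bohr_lattice N I" "v \<in> bohr_lattice N I"
  then obtain y y' where u: "\<And>i. i \<notin> I \<Longrightarrow> u i = 0" "\<And>i. i \<in> I \<Longrightarrow> \<exists>z::int. u i = of_int (i * y - N * z)"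
    and v: "\<And>i. i \<notin> I \<Longrightarrow> v i = 0" "\<And>i. i \<in> I \<Longrightarrow> \<exists>z::int. v i = of_int (i * y' - N * z)"
    unfolding bohr_lattice_def by blast
  have "\<exists>z::int. u i - v i = of_int (i * (y - y') - N * z)" if i: "i \<in> I" for i
  proof -
    obtain z :: int where z: "u i = of_int (i * y - N * z)" using u(2)[OF i] by blast
    obtain z' :: int where z': "v i = of_int (i * y' - N * z')" using v(2)[OF i] by blast
    show ?thesis by (intro exI[of _ "z - z'"]) (simp add: z z' algebra_simps)
  qed
  moreover have "u i - v i = 0" if "i \<notin> I" for i using u(1) v(1) that by simp
  ultimately show "(\<lambda>i. u i - v i) \<in> bohr_lattice N I"
    unfolding bohr_lattice_def mem_Collect_eq by blast
next
  fix v i assume "v \<in> bohr_lattice N I" "i \<notin> I"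
  thus "v i = 0" by (simp add: bohr_lattice_def)
next
  fix r :: real
  define F where "F = real_of_int ` {- \<lceil>r\<rceil>..\<lceil>r\<rceil>}"
  have "{v \<in> bohr_lattice N I. sup_norm I v \<le> r} \<subseteq> {v. \<forall>i. (i \<in> I \<longrightarrow> v i \<in> F) \<and> (i \<notin> I \<longrightarrow> v i = 0)}"
  proof (safe)
    fix v i assume v: "v \<in> bohr_lattice N I" "sup_norm I v \<le> r" and i: "i \<in> I"
    have "\<bar>v i\<bar> \<le> r" using abs_le_sup_norm[OF I i, of v] v(2) by linarith
    moreover obtain k :: int where "v i = of_int k" using v(1) i unfolding bohr_lattice_def by blast
    ultimately have "\<bar>k\<bar> \<le> \<lceil>r\<rceil>" by linarith
    thus "v i \<in> F" using \<open>v i = of_int k\<close> by (auto simp: F_def abs_le_iff)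
  next
    fix v i assume "v \<in> bohr_lattice N I" "i \<notin> I"
    thus "v i = 0" by (simp add: bohr_lattice_def)
  qed
  moreover have "finite {v. \<forall>i. (i \<in> I \<longrightarrow> v i \<in> F) \<and> (i \<notin> I \<longrightarrow> v i = 0)}"
    using I by (intro finite_set_of_finite_funs) (auto simp: F_def)
  ultimately show "finite {v \<in> bohr_lattice N I. sup_norm I v \<le> r}" by (rule finite_subset)
qed

text \<open>At index 1 the vector records its parameter \<open>y\<close> mod \<open>N\<close>, and
  all coordinates depend on \<open>y\<close> only mod \<open>N\<close>. Hence the integer
  \<open>\<lfloor>v 1\<rfloor>\<close> can serve as the parameter.\<close>

lemma bohr_lattice_coord:
  assumes v: "v \<in> bohr_lattice N I" and 1: "1 \<in> I" and i: "i \<in> I"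
  shows "\<exists>z::int. v i = of_int (i * \<lfloor>v 1\<rfloor> - N * z)"
proof -
  obtain y where y: "\<And>i. i \<in> I \<Longrightarrow> \<exists>z::int. v i = of_int (i * y - N * z)"
    using v unfolding bohr_lattice_def by blast
  obtain z1 :: int where z1: "v 1 = of_int (1 * y - N * z1)" using y[OF 1] by blast
  obtain z :: int where z: "v i = of_int (i * y - N * z)" using y[OF i] by blast
  have "\<lfloor>v 1\<rfloor> = y - N * z1" unfolding z1 by (simp only: floor_of_int mult_1)
  hence y1: "y = \<lfloor>v 1\<rfloor> + N * z1" by simp
  have "i * y - N * z = i * \<lfloor>v 1\<rfloor> - N * (z - i * z1)" unfolding y1 by (simp add: algebra_simps)
  thus ?thesis using z by metis
qed

text \<open>Dirichlet's pigeonhole argument: divide the torus into \<open>M ^ card I\<close> cubes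
  of side \<open>N / M\<close>, and subtract a fixed point \<open>x0\<close> of a fullest cube from
  all its points. Coordinate 1 recovers \<open>x\<close>, so no lattice vector is counted
  twice.\<close>

lemma card_bohr_lattice_ball:
  fixes M :: nat
  assumes N: "N > 0" and I: "finite I" "1 \<in> I" and M: "M > 0"
  shows "of_int N \<le> real M ^ card I * card {v \<in> bohr_lattice N I. sup_norm I v \<le> of_int N / M}"
proof -
  define f where "f x = (\<lambda>i\<in>I. (int M * ((i * x) mod N)) div N)" for x
  define P where "P = PiE I (\<lambda>_. {0..<int M})"
  have finP: "finite P" unfolding P_def using I by (intro finite_PiE) auto
  have cP: "card P = M ^ card I" unfolding P_def using I by (simp add: card_PiE)
  have fP: "f ` {0..<N} \<subseteq> P"
  proof
    fix w assume "w \<in> f ` {0..<N}"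
    then obtain x where x: "w = f x" by blast
    have "0 \<le> (int M * ((i * x) mod N)) div N" "(int M * ((i * x) mod N)) div N < int M" for i
    proof -
      have b: "0 \<le> (i * x) mod N" "(i * x) mod N < N" using N by simp_all
      show "0 \<le> (int M * ((i * x) mod N)) div N" using b N by (simp add: pos_imp_zdiv_nonneg_iff)
      show "(int M * ((i * x) mod N)) div N < int M"
      proof (rule ccontr)
        assume "\<not> (int M * ((i * x) mod N)) div N < int M"
        hence "int M * N \<le> ((int M * ((i * x) mod N)) div N) * N" using N by (intro mult_right_mono) auto
        also have "\<dots> \<le> int M * ((i * x) mod N)" using N by (simp flip: minus_mod_eq_div_mult)
        finally show False using b M by simp
      qed
    qed
    thus "w \<in> P" by (auto simp: x f_def P_def)
  qed
  have "P \<noteq> {}" using fP N by auto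
  then obtain b where b: "card {0..<N} \<le> card P * card {x \<in> {0..<N}. f x = b}"
    using pigeonhole_fiber[OF _ finP fP] by auto
  define F where "F = {x \<in> {0..<N}. f x = b}"
  have "card {0..<N} > 0" using N by simp
  hence "card P * card F > 0" using b unfolding F_def by linarith
  hence "F \<noteq> {}" by auto
  then obtain x0 where x0: "x0 \<in> F" by blast
  define g where "g x = (\<lambda>i. if i \<in> I then real_of_int ((i * x) mod N - (i * x0) mod N) else 0)" for x
  have "card F \<le> card {v \<in> bohr_lattice N I. sup_norm I v \<le> of_int N / M}"
  proof (rule card_inj_on_le[where f = g])
    show "inj_on g F"
    proof (rule inj_onI)
      fix x y assume xy: "x \<in> F" "y \<in> F" "g x = g y"
      have "g x 1 = g y 1" using xy by simp
      hence "x mod N = y mod N" using I by (simp add: g_def)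
      thus "x = y" using xy by (simp add: F_def)
    qed
    show "g ` F \<subseteq> {v \<in> bohr_lattice N I. sup_norm I v \<le> of_int N / M}"
    proof
      fix v assume "v \<in> g ` F"
      then obtain x where x: "v = g x" "x \<in> F" by blast
      have "\<bar>v i\<bar> \<le> of_int N / M" if i: "i \<in> I" for i
      proof -
        let ?a = "int M * ((i * x) mod N)" and ?b = "int M * ((i * x0) mod N)"
        have "f x i = f x0 i" using x x0 by (simp add: F_def)
        hence "?a div N = ?b div N" using i by (simp add: f_def)
        hence "?a - ?b = ?a mod N - ?b mod N" by (simp add: minus_div_mult_eq_mod[symmetric])
        hence "\<bar>?a - ?b\<bar> \<le> N"
          using pos_mod_bound[OF N, of ?a] pos_mod_sign[OF N, of ?a] pos_mod_bound[OF N, of ?b] pos_mod_sign[OF N, of ?b] by linarith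
        hence "real_of_int \<bar>?a - ?b\<bar> \<le> of_int N" by (simp only: of_int_le_iff)
        moreover have "real_of_int \<bar>?a - ?b\<bar> = M * \<bar>v i\<bar>"
          using i by (simp add: x(1) g_def abs_mult flip: right_diff_distrib)
        ultimately show ?thesis using M by (simp add: field_simps)
      qed
      hence "sup_norm I v \<le> of_int N / M" using I N by (simp add: sup_norm_le_iff)
      moreover have "v \<in> bohr_lattice N I"
      proof -
        have "\<forall>i\<in>I. \<exists>z::int. v i = of_int (i * (x - x0) - N * z)"
        proof
          fix i assume i: "i \<in> I"
          have "(i * x) mod N - (i * x0) mod N = i * (x - x0) - N * ((i * x) div N - (i * x0) div N)"
            by (simp add: minus_mult_div_eq_mod[symmetric] algebra_simps)
          thus "\<exists>z::int. v i = of_int (i * (x - x0) - N * z)" using i unfolding x(1) g_def by metis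
        qed
        moreover have "v i = 0" if "i \<notin> I" for i using that by (simp add: x(1) g_def)
        ultimately show ?thesis unfolding bohr_lattice_def by blast
      qed
      ultimately show "v \<in> {v \<in> bohr_lattice N I. sup_norm I v \<le> of_int N / M}" by simp
    qed
    show "finite {v \<in> bohr_lattice N I. sup_norm I v \<le> of_int N / M}"
      using discrete_group_bohr_lattice[OF I(1)] by (simp add: discrete_group_def)
  qed
  hence "card P * card F \<le> M ^ card I * card {v \<in> bohr_lattice N I. sup_norm I v \<le> of_int N / M}"
    by (simp add: cP)
  hence "card {0..<N} \<le> M ^ card I * card {v \<in> bohr_lattice N I. sup_norm I v \<le> of_int N / M}"
    using b by (simp add: F_def)
  hence "real (card {0..<N}) \<le> real (M ^ card I * card {v \<in> bohr_lattice N I. sup_norm I v \<le> of_int N / M})"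
    by (rule of_nat_mono)
  thus ?thesis using N by simp
qed

definition in_box :: "nat \<Rightarrow> (nat \<Rightarrow> nat) \<Rightarrow> (nat \<Rightarrow> int) \<Rightarrow> bool" where
  "in_box n l c \<longleftrightarrow> (\<forall>j<n. 0 \<le> c j \<and> c j \<le> int (l j))"

text \<open>The progression is the image of a box spanned by a basis of the Bohr lattice, with sides
  inversely proportional to the basis lengths. Adjoining 1 to \<open>L\<close> lets lattice vectors
  be read as integers. The size bound compares the pigeonhole count of lattice points of norm at
  most \<open>N / M\<close> with the upper count from the basis theorem, whose factors match the
  sides up to \<open>2 D 4 ^ D\<close>.\<close>

theorem bohr_contains_progression:
  fixes M :: nat
  assumes N: "N > 0" and L: "finite L" and M: "M \<ge> 2"
  defines "D \<equiv> card (insert 1 L)"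
  obtains n x l where "n \<le> D"
    "\<And>c. in_box n l c \<Longrightarrow> (\<Sum>j<n. c j * x j) \<in> bohr N L (1 / M)"
    "\<And>c c'. in_box n l c \<Longrightarrow> in_box n l c' \<Longrightarrow>
        N dvd (\<Sum>j<n. c j * x j) - (\<Sum>j<n. c' j * x j) \<Longrightarrow> (\<forall>j<n. c j = c' j)"
    "of_int N \<le> real M ^ D * (\<Prod>j<n. 2 * real D * 4 ^ D * (real (l j) + 1))"
proof -
  define I where "I = insert 1 L"
  have I: "finite I" "1 \<in> I" "card I = D" using L by (simp_all add: I_def D_def)
  have D: "D > 0" using I by (auto simp: card_gt_0_iff)
  define r where "r = real_of_int N / M"
  have r: "r > 0" using N M by (simp add: r_def)
  obtain n v where n: "n \<le> D" and v: "\<And>j. j < n \<Longrightarrow> v j \<in> bohr_lattice N I" "\<And>j. j < n \<Longrightarrow> sup_norm I (v j) > 0"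
    and ind: "int_span_independent n v"
    and cnt: "\<And>r. r \<ge> 0 \<Longrightarrow> card {u \<in> bohr_lattice N I. sup_norm I u \<le> r} \<le> (\<Prod>j<n. 1 + 4 ^ D * r / sup_norm I (v j))"
    using discrete_group_basis[OF I(1) discrete_group_bohr_lattice[OF I(1), of N] I(3)] by blast
  \<comment> \<open>Each of the at most \<open>D\<close> basis vectors may contribute
    \<open>r / D\<close> to the norm, so every point of the box has norm at most
    \<open>r\<close>.\<close>
  define t where "t j = r / (D * sup_norm I (v j))" for j
  define l where "l j = nat \<lfloor>t j\<rfloor>" for j
  define x where "x j = \<lfloor>v j 1\<rfloor>" for j
  have t: "t j > 0" if "j < n" for j using v(2)[OF that] r D by (simp add: t_def)
  have l: "real (l j) \<le> t j" "t j \<le> real (l j) + 1" if "j < n" for j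
    using t[OF that] unfolding l_def by linarith+
  have size: "\<bar>\<Sum>j<n. of_int (c j) * v j i\<bar> \<le> r" if c: "\<And>j. j < n \<Longrightarrow> \<bar>c j\<bar> \<le> int (l j)" and i: "i \<in> I" for c :: "nat \<Rightarrow> int" and i
  proof -
    have "\<bar>\<Sum>j<n. of_int (c j) * v j i\<bar> \<le> (\<Sum>j<n. \<bar>of_int (c j) * v j i\<bar>)" by (rule sum_abs)
    also have "\<dots> \<le> (\<Sum>j<n. r / D)"
    proof (rule sum_mono)
      fix j assume "j \<in> {..<n}"
      hence j: "j < n" by simp
      have "\<bar>real_of_int (c j)\<bar> \<le> real (l j)" using c[OF j] by linarith
      hence "\<bar>real_of_int (c j)\<bar> * \<bar>v j i\<bar> \<le> t j * sup_norm I (v j)"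
        using l(1)[OF j] abs_le_sup_norm[OF I(1) i, of "v j"] t[OF j] by (intro mult_mono) auto
      also have "\<dots> = r / D" using v(2)[OF j] by (simp add: t_def)
      finally show "\<bar>of_int (c j) * v j i\<bar> \<le> r / D" by (simp add: abs_mult)
    qed
    also have "\<dots> = real n * (r / D)" by simp
    also have "\<dots> \<le> real D * (r / D)" using n r by (intro mult_right_mono) auto
    also have "\<dots> = r" using D by simp
    finally show ?thesis .
  qed
  have coord: "\<exists>Z::int. (\<Sum>j<n. of_int (c j) * v j i) = of_int (i * (\<Sum>j<n. c j * x j) - N * Z)" if i: "i \<in> I" for c :: "nat \<Rightarrow> int" and i
  proof -
    have "\<exists>z::int. j < n \<longrightarrow> v j i = of_int (i * x j - N * z)" for j
      using bohr_lattice_coord[OF v(1) I(2) i] unfolding x_def by blast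
    then obtain z :: "nat \<Rightarrow> int" where z: "\<And>j. j < n \<Longrightarrow> v j i = of_int (i * x j - N * z j)" by metis
    have "(\<Sum>j<n. of_int (c j) * v j i) = (\<Sum>j<n. of_int (c j * (i * x j - N * z j)))"
      by (rule sum.cong) (simp_all only: lessThan_iff z of_int_mult)
    also have "\<dots> = of_int (\<Sum>j<n. c j * (i * x j - N * z j))" by (simp only: of_int_sum)
    also have "(\<Sum>j<n. c j * (i * x j - N * z j)) = i * (\<Sum>j<n. c j * x j) - N * (\<Sum>j<n. c j * z j)"
      by (simp add: sum_distrib_left right_diff_distrib sum_subtractf mult_ac)
    finally show ?thesis by blast
  qed
  show ?thesis
  proof (rule that[of n l x, OF n])
    fix c :: "nat \<Rightarrow> int" assume "in_box n l c"
    hence c: "\<And>j. j < n \<Longrightarrow> 0 \<le> c j \<and> c j \<le> int (l j)" by (simp add: in_box_def)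
    show "(\<Sum>j<n. c j * x j) \<in> bohr N L (1 / M)"
      unfolding bohr_def
    proof (safe)
      fix i assume "i \<in> L"
      hence i: "i \<in> I" by (simp add: I_def)
      obtain Z :: int where Z: "(\<Sum>j<n. of_int (c j) * v j i) = of_int (i * (\<Sum>j<n. c j * x j) - N * Z)"
        using coord[OF i] by blast
      have "\<bar>\<Sum>j<n. of_int (c j) * v j i\<bar> \<le> r" by (rule size[OF _ i]) (use c in auto)
      hence "\<bar>real_of_int (i * (\<Sum>j<n. c j * x j) - N * Z)\<bar> \<le> 1 / real M * real_of_int N" unfolding Z r_def by simp
      thus "\<exists>z. \<bar>real_of_int (i * (\<Sum>j<n. c j * x j) - N * z)\<bar> \<le> 1 / real M * real_of_int N" by blast
    qed
  next
    fix c c' :: "nat \<Rightarrow> int"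
    assume "in_box n l c" "in_box n l c'" and dv: "N dvd (\<Sum>j<n. c j * x j) - (\<Sum>j<n. c' j * x j)"
    hence c: "\<And>j. j < n \<Longrightarrow> 0 \<le> c j \<and> c j \<le> int (l j)"
      and c': "\<And>j. j < n \<Longrightarrow> 0 \<le> c' j \<and> c' j \<le> int (l j)" by (simp_all add: in_box_def)
    define d where "d j = c j - c' j" for j
    have dv': "N dvd (\<Sum>j<n. d j * x j)" using dv by (simp add: d_def left_diff_distrib sum_subtractf)
    have "(\<Sum>j<n. of_int (d j) * v j i) = 0" for i
    proof (cases "i \<in> I")
      case True
      obtain Z :: int where Z: "(\<Sum>j<n. of_int (d j) * v j i) = of_int (i * (\<Sum>j<n. d j * x j) - N * Z)"
        using coord[OF True] by blast
      have "\<bar>\<Sum>j<n. of_int (d j) * v j i\<bar> \<le> r"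
      proof (rule size[OF _ True])
        \<comment> \<open>Both coefficients lie in \<open>0..l j\<close>, so their difference obeys
          the same bound as a single one and the norm estimate is not doubled.\<close>
        show "\<bar>d j\<bar> \<le> int (l j)" if "j < n" for j using c[OF that] c'[OF that] by (auto simp: d_def abs_if)
      qed
      \<comment> \<open>Coordinates divisible by \<open>N\<close> and smaller than \<open>N\<close>
        vanish; independence of the basis then gives properness mod \<open>N\<close>. This is where
        \<open>M \<ge> 2\<close> enters.\<close>
      also have "r < of_int N" using N M by (simp add: r_def divide_less_eq)
      finally have "\<bar>i * (\<Sum>j<n. d j * x j) - N * Z\<bar> < N" unfolding Z by linarith
      moreover have "N dvd i * (\<Sum>j<n. d j * x j) - N * Z" using dv' by (intro dvd_diff) auto
      ultimately have "i * (\<Sum>j<n. d j * x j) - N * Z = 0"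
        using dvd_imp_le_int[of "i * (\<Sum>j<n. d j * x j) - N * Z" N] N by linarith
      thus ?thesis unfolding Z by simp
    next
      case False
      hence "v j i = 0" if "j < n" for j using v(1)[OF that] by (simp add: bohr_lattice_def)
      thus ?thesis by simp
    qed
    hence "\<forall>j<n. d j = 0" using ind unfolding int_span_independent_def by blast
    thus "\<forall>j<n. c j = c' j" by (simp add: d_def)
  next
    have "of_int N \<le> real M ^ D * card {v \<in> bohr_lattice N I. sup_norm I v \<le> r}"
      using card_bohr_lattice_ball[OF N I(1,2)] M I(3) by (simp add: r_def)
    also have "\<dots> \<le> real M ^ D * (\<Prod>j<n. 1 + 4 ^ D * r / sup_norm I (v j))"
      using cnt[of r] r by (intro mult_left_mono) auto
    also have "\<dots> \<le> real M ^ D * (\<Prod>j<n. 2 * real D * 4 ^ D * (real (l j) + 1))"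
    proof (intro mult_left_mono prod_mono conjI)
      fix j assume "j \<in> {..<n}"
      hence j: "j < n" by simp
      show "0 \<le> 1 + 4 ^ D * r / sup_norm I (v j)" using r v(2)[OF j] by simp
      have a: "(1::real) \<le> D * 4 ^ D" using D one_le_power[of "4::real" D] mult_mono[of 1 "real D" 1 "4 ^ D"] by simp
      have "4 ^ D * r / sup_norm I (v j) = (real D * 4 ^ D) * t j" using D by (simp add: t_def)
      also have "\<dots> \<le> (real D * 4 ^ D) * (real (l j) + 1)" using l(2)[OF j] by (intro mult_left_mono) auto
      finally have 1: "4 ^ D * r / sup_norm I (v j) \<le> (real D * 4 ^ D) * (real (l j) + 1)" .
      have "1 * 1 \<le> (real D * 4 ^ D) * (real (l j) + 1)" using a by (intro mult_mono) auto
      thus "1 + 4 ^ D * r / sup_norm I (v j) \<le> 2 * real D * 4 ^ D * (real (l j) + 1)" using 1 by linarith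
    qed simp
    finally show "of_int N \<le> real M ^ D * (\<Prod>j<n. 2 * real D * 4 ^ D * (real (l j) + 1))" .
  qed
qed

section \<open>Progressions and covering\<close>

text \<open>The extensional counterpart of \<open>in_box\<close>: fixing the values outside
  \<open>{..<n}\<close> makes the box finite and countable by a product.\<close>

definition int_box :: "nat \<Rightarrow> (nat \<Rightarrow> nat) \<Rightarrow> (nat \<Rightarrow> int) set" where
  "int_box n l = PiE {..<n} (\<lambda>j. {0..int (l j)})"

lemma finite_int_box: "finite (int_box n l)"
  unfolding int_box_def by (intro finite_PiE) auto

lemma card_int_box: "card (int_box n l) = (\<Prod>j<n. l j + 1)"
  by (simp add: int_box_def card_PiE nat_add_distrib)

lemma int_box_bounds: "c \<in> int_box n l \<Longrightarrow> j < n \<Longrightarrow> 0 \<le> c j \<and> c j \<le> int (l j)"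
  by (auto simp: int_box_def PiE_iff)

lemma int_box_in_box: "c \<in> int_box n l \<Longrightarrow> in_box n l c"
  by (simp add: in_box_def int_box_bounds)

definition box_image :: "nat \<Rightarrow> (nat \<Rightarrow> int) \<Rightarrow> (nat \<Rightarrow> nat) \<Rightarrow> int set" where
  "box_image n x l = (\<lambda>c. \<Sum>j<n. c j * x j) ` int_box n l"

lemma box_imageI:
  assumes "in_box n l c"
  shows "(\<Sum>j<n. c j * x j) \<in> box_image n x l"
proof -
  have "(\<Sum>j<n. c j * x j) = (\<Sum>j<n. restrict c {..<n} j * x j)" by (rule sum.cong) auto
  moreover have "restrict c {..<n} \<in> int_box n l" using assms by (auto simp: int_box_def in_box_def)
  ultimately show ?thesis unfolding box_image_def by blast
qed

lemma card_box_image: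
  assumes "\<And>c c'. in_box n l c \<Longrightarrow> in_box n l c' \<Longrightarrow>
     (\<Sum>j<n. c j * x j) = (\<Sum>j<n. c' j * x j) \<Longrightarrow> (\<forall>j<n. c j = c' j)"
  shows "card (box_image n x l) = (\<Prod>j<n. l j + 1)"
proof -
  have "inj_on (\<lambda>c. \<Sum>j<n. c j * x j) (int_box n l)"
  proof (rule inj_onI)
    fix c c' assume c: "c \<in> int_box n l" "c' \<in> int_box n l" "(\<Sum>j<n. c j * x j) = (\<Sum>j<n. c' j * x j)"
    have "\<forall>j<n. c j = c' j" by (rule assms) (use c int_box_in_box in auto)
    thus "c = c'" using c(1,2) unfolding int_box_def by (intro PiE_ext[of c _ _ c']) auto
  qed
  thus ?thesis unfolding box_image_def by (simp add: card_image card_int_box)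
qed

lemma finite_box_image: "finite (box_image n x l)"
  by (simp add: box_image_def finite_int_box)

lemma sum_lessThan_add:
  fixes f :: "nat \<Rightarrow> 'a::comm_monoid_add"
  shows "(\<Sum>j<n + m. f j) = (\<Sum>j<n. f j) + (\<Sum>j<m. f (n + j))"
  by (induction m) (simp_all add: add.assoc)

text \<open>Boxes count generators from 0 with inclusive upper bounds. The definition of a
  progression reserves index 0 for the base point and uses strict bounds, hence the shift by one and
  the lengths \<open>l + 1\<close>.\<close>

lemma multidim_progression_box:
  "multidim_progression d ((\<lambda>y. b + y) ` box_image d g l)"
  unfolding multidim_progression_def
proof (rule exI[of _ "\<lambda>i. if i = 0 then b else g (i - 1)"], rule exI[of _ "\<lambda>i. int (l (i - 1)) + 1"], intro conjI)
  have s: "(\<Sum>i = 1..d. c i * (if i = 0 then b else g (i - 1))) = (\<Sum>j<d. c (Suc j) * g j)" for c :: "nat \<Rightarrow> int"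
    unfolding One_nat_def sum.atLeast1_atMost_eq by simp
  show "(\<lambda>y. b + y) ` box_image d g l = {(if (0::nat) = 0 then b else g (0 - 1)) + (\<Sum>i = 1..d. c i * (if i = 0 then b else g (i - 1))) | c :: nat \<Rightarrow> int.
      \<forall>i\<in>{1..d}. 0 \<le> c i \<and> c i < int (l (i - 1)) + 1}" (is "_ = ?R")
  proof
    show "(\<lambda>y. b + y) ` box_image d g l \<subseteq> ?R"
    proof
      fix z assume "z \<in> (\<lambda>y. b + y) ` box_image d g l"
      then obtain c where c: "c \<in> int_box d l" "z = b + (\<Sum>j<d. c j * g j)" by (auto simp: box_image_def)
      have "\<forall>i\<in>{1..d}. 0 \<le> c (i - 1) \<and> c (i - 1) < int (l (i - 1)) + 1"
      proof
        fix i assume "i \<in> {1..d}"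
        hence "i - 1 < d" by auto
        thus "0 \<le> c (i - 1) \<and> c (i - 1) < int (l (i - 1)) + 1" using int_box_bounds[OF c(1), of "i - 1"] by auto
      qed
      thus "z \<in> ?R" unfolding s c(2) by (intro CollectI exI[of _ "\<lambda>i. c (i - 1)"]) simp
    qed
    show "?R \<subseteq> (\<lambda>y. b + y) ` box_image d g l"
    proof
      fix z assume "z \<in> ?R"
      then obtain c where c: "z = b + (\<Sum>j<d. c (Suc j) * g j)" "\<forall>i\<in>{1..d}. 0 \<le> c i \<and> c i < int (l (i - 1)) + 1"
        unfolding s by auto
      have "0 \<le> c (Suc j) \<and> c (Suc j) \<le> int (l j)" if "j < d" for j
        using c(2)[rule_format, of "Suc j"] that by simp
      hence "(\<Sum>j<d. c (Suc j) * g j) \<in> box_image d g l" by (intro box_imageI) (simp add: in_box_def)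
      thus "z \<in> (\<lambda>y. b + y) ` box_image d g l" using c(1) by blast
    qed
  qed
qed simp

lemma card_box_image_le: "card (box_image d g l) \<le> (\<Prod>j<d. l j + 1)"
  unfolding box_image_def card_int_box[symmetric] by (rule card_image_le) (rule finite_int_box)

text \<open>Translating coefficients to be non-negative moves \<open>u - u'\<close> into
  \<open>0..2 l\<close> and \<open>c\<close> into \<open>0..2\<close>, at the cost of a new base
  point \<open>b\<close>. Thus a box side at most doubles and each \<open>e i\<close> contributes a
  factor 3.\<close>

lemma difference_box_in_progression:
  fixes y e :: "nat \<Rightarrow> int" and n m :: nat and l :: "nat \<Rightarrow> nat"
  defines "B \<equiv> {p - p' + (\<Sum>i<m. c i * e i) |p p' c. p \<in> box_image n y l \<and> p' \<in> box_image n y l \<and> (\<forall>i<m. c i \<in> {-1, 0, 1})}"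
  obtains P where "multidim_progression (n + m) P" "B \<subseteq> P" "card P \<le> 2 ^ n * 3 ^ m * (\<Prod>j<n. l j + 1)"
proof -
  define g where "g j = (if j < n then y j else e (j - n))" for j
  define L where "L j = (if j < n then 2 * l j else 2)" for j
  define b where "b = - (\<Sum>j<n. int (l j) * y j) - (\<Sum>i<m. e i)"
  define P where "P = (\<lambda>z. b + z) ` box_image (n + m) g L"
  have "B \<subseteq> P"
  proof
    fix z assume "z \<in> B"
    then obtain p p' c where z: "z = p - p' + (\<Sum>i<m. c i * e i)" "p \<in> box_image n y l" "p' \<in> box_image n y l"
      and c: "\<forall>i<m. c i \<in> {-1, 0, 1}" unfolding B_def by blast
    obtain u u' where u: "u \<in> int_box n l" "p = (\<Sum>j<n. u j * y j)" "u' \<in> int_box n l" "p' = (\<Sum>j<n. u' j * y j)"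
      using z by (auto simp: box_image_def)
    define w where "w j = (if j < n then u j - u' j + int (l j) else c (j - n) + 1)" for j
    have "(\<Sum>j<n + m. w j * g j) = (\<Sum>j<n. (u j - u' j + int (l j)) * y j) + (\<Sum>j<m. (c j + 1) * e j)"
      unfolding sum_lessThan_add by (simp add: w_def g_def)
    also have "\<dots> = z - b"
      unfolding z(1) u(2,4) b_def by (simp add: distrib_right left_diff_distrib sum.distrib sum_subtractf)
    finally have zb: "z = b + (\<Sum>j<n + m. w j * g j)" by simp
    have "0 \<le> w j \<and> w j \<le> int (L j)" if "j < n + m" for j
    proof (cases "j < n")
      case True
      thus ?thesis using int_box_bounds[OF u(1) True] int_box_bounds[OF u(3) True] by (simp add: w_def L_def)
    next
      case False
      hence "c (j - n) \<in> {-1, 0, 1}" using c that by auto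
      thus ?thesis using False by (auto simp: w_def L_def)
    qed
    hence "(\<Sum>j<n + m. w j * g j) \<in> box_image (n + m) g L" by (intro box_imageI) (simp add: in_box_def)
    thus "z \<in> P" unfolding P_def zb by blast
  qed
  moreover have "card P \<le> 2 ^ n * 3 ^ m * (\<Prod>j<n. l j + 1)"
  proof -
    have "card P \<le> card (box_image (n + m) g L)" unfolding P_def by (rule card_image_le) (rule finite_box_image)
    also have "\<dots> \<le> (\<Prod>j<n + m. L j + 1)" by (rule card_box_image_le)
    also have "\<dots> = (\<Prod>j<n. L j + 1) * (\<Prod>j<m. L (n + j) + 1)"
      by (induction m) (simp_all only: add_0_right lessThan_0 prod.empty mult_1_right add_Suc_right prod.lessThan_Suc mult.assoc)
    also have "(\<Prod>j<m. L (n + j) + 1) = 3 ^ m" by (simp add: L_def)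
    also have "(\<Prod>j<n. L j + 1) \<le> (\<Prod>j<n. 2 * (l j + 1))" by (rule prod_mono) (auto simp: L_def)
    also have "\<dots> = 2 ^ n * (\<Prod>j<n. l j + 1)" by (simp only: prod.distrib prod_constant card_lessThan)
    finally show ?thesis by (simp add: mult_ac)
  qed
  ultimately show ?thesis using that multidim_progression_box[of "n + m" b g L] unfolding P_def by blast
qed

section \<open>Covering by disjoint translates\<close>

lemma multi_sum_add: "a \<in> multi_sum n A \<Longrightarrow> s \<in> A \<Longrightarrow> a + s \<in> multi_sum (Suc n) A"
  unfolding multi_sum.simps add.commute[of a s] by (rule set_plus_intro)

definition disjoint_translates :: "int set \<Rightarrow> int set \<Rightarrow> bool" where
  "disjoint_translates Q S \<longleftrightarrow> (\<forall>s\<in>S. \<forall>s'\<in>S. \<forall>q\<in>Q. \<forall>q'\<in>Q. q + s = q' + s' \<longrightarrow> s = s')"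

lemma card_disjoint_translates:
  assumes "disjoint_translates Q S"
  shows "card (Q + S) = card Q * card S"
proof -
  have "inj_on (\<lambda>(q, s). q + s) (Q \<times> S)"
  proof (rule inj_onI)
    fix u v assume *: "u \<in> Q \<times> S" "v \<in> Q \<times> S" "(case u of (q, s) \<Rightarrow> q + s) = (case v of (q, s) \<Rightarrow> q + s)"
    obtain q s q' s' where uv: "u = (q, s)" "v = (q', s')" by (cases u, cases v)
    have "s \<in> S" "s' \<in> S" "q \<in> Q" "q' \<in> Q" "q + s = q' + s'" using * by (simp_all add: uv)
    hence "s = s'" using assms unfolding disjoint_translates_def by blast
    thus "u = v" using *(3) by (simp add: uv)
  qed
  moreover have "Q + S = (\<lambda>(q, s). q + s) ` (Q \<times> S)" unfolding set_plus_def by force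
  ultimately show ?thesis by (simp add: card_image card_cartesian_product)
qed

lemma maximal_disjoint_translates:
  assumes A: "finite A" and Q: "Q \<noteq> {}"
  obtains S where "S \<subseteq> A" "disjoint_translates Q S" "\<And>a. a \<in> A \<Longrightarrow> \<exists>s\<in>S. \<exists>q\<in>Q. \<exists>q'\<in>Q. q + a = q' + s"
proof -
  define F where "F = {S. S \<subseteq> A \<and> disjoint_translates Q S}"
  have "F \<subseteq> Pow A" by (auto simp: F_def)
  hence finF: "finite F" using A finite_subset by blast
  have "{} \<in> F" by (simp add: F_def disjoint_translates_def)
  then obtain S where S: "S \<in> F" "\<And>S'. S' \<in> F \<Longrightarrow> S \<subseteq> S' \<Longrightarrow> S' = S"
    using finite_has_maximal[OF finF] by blast
  have SA: "S \<subseteq> A" "disjoint_translates Q S" using S(1) by (auto simp: F_def)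
  show ?thesis
  proof (rule that[OF SA])
    fix a assume a: "a \<in> A"
    show "\<exists>s\<in>S. \<exists>q\<in>Q. \<exists>q'\<in>Q. q + a = q' + s"
    proof (rule ccontr)
      assume no: "\<not> ?thesis"
      obtain q0 where q0: "q0 \<in> Q" using Q by blast
      have "a \<notin> S" using no q0 by blast
      have "disjoint_translates Q (insert a S)"
        unfolding disjoint_translates_def
      proof (intro ballI impI)
        fix s s' q q' assume *: "s \<in> insert a S" "s' \<in> insert a S" "q \<in> Q" "q' \<in> Q" "q + s = q' + s'"
        show "s = s'"
        proof (cases "s = a \<or> s' = a")
          case True
          show ?thesis
          proof (rule ccontr)
            assume "s \<noteq> s'"
            hence "s = a \<and> s' \<in> S \<or> s' = a \<and> s \<in> S" using True * by blast
            thus False using no * by metis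
          qed
        next
          case False
          hence "s \<in> S" "s' \<in> S" using * by auto
          thus ?thesis using SA(2) * unfolding disjoint_translates_def by blast
        qed
      qed
      hence "insert a S \<in> F" using SA a by (simp add: F_def)
      hence "insert a S = S" using S(2) by blast
      thus False using \<open>a \<notin> S\<close> by blast
    qed
  qed
qed

text \<open>
  While \<open>A\<close> contains \<open>s \<ge> 2 K\<close> elements whose translates of \<open>Q\<close> are disjoint, replacing \<open>Q\<close> by
  \<open>Q + S\<close> multiplies its size by at least \<open>2 K\<close>, whereas Pluennecke only allows a factor \<open>K\<close>.
  So the process stops, and then a maximal family of disjoint translates covers \<open>A\<close>.
\<close>

definition cover_stage :: "int set \<Rightarrow> int set \<Rightarrow> nat \<Rightarrow> nat \<Rightarrow> int set \<Rightarrow> (nat \<Rightarrow> int) \<Rightarrow> bool" where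
  "cover_stage A P s t Q e \<longleftrightarrow> Q \<subseteq> sum_diff (t + 2) 2 A \<and> card Q = s ^ t * card P \<and>
     (\<forall>q\<in>Q. \<exists>p\<in>P. \<exists>c. (\<forall>i<s * t. c i \<in> {0, 1::int}) \<and> q = p + (\<Sum>i<s * t. c i * e i))"

lemma indicator_combination:
  fixes e :: "nat \<Rightarrow> int"
  assumes "j < m"
  shows "(\<Sum>i<m. (if i = j then 1 else 0) * e i) = e j"
proof -
  have "(\<Sum>i<m. (if i = j then 1 else 0) * e i) = (\<Sum>i<m. if i = j then e i else 0)" by (rule sum.cong) auto
  thus ?thesis using assms by simp
qed

lemma enumerate_subset:
  assumes "finite S" "card S \<le> s"
  obtains e :: "nat \<Rightarrow> 'a" where "\<And>x. x \<in> S \<Longrightarrow> \<exists>j<s. e j = x"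
proof -
  obtain h where "bij_betw h {0..<card S} S" using assms(1) ex_bij_betw_nat_finite by blast
  hence "h ` {0..<card S} = S" by (simp add: bij_betw_def)
  hence "\<exists>j<s. h j = x" if "x \<in> S" for x using that assms(2) by force
  thus ?thesis using that by blast
qed

text \<open>The \<open>s\<close> elements of \<open>S\<close> become new generators, and a point of
  \<open>Q + S\<close> uses exactly one of them with coefficient 1, so coefficients stay in
  \<open>{0, 1}\<close>.\<close>

lemma cover_stage_Suc:
  assumes stage: "cover_stage A P s t Q e" and S: "S \<subseteq> A" "disjoint_translates Q S" "card S = s" "finite S"
  shows "\<exists>Q' e'. cover_stage A P s (Suc t) Q' e'"
proof -
  obtain h where h: "\<And>x. x \<in> S \<Longrightarrow> \<exists>j<s. h j = x" using enumerate_subset[OF S(4)] S(3) by blast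
  define e' where "e' i = (if i < s * t then e i else h (i - s * t))" for i
  have Q: "Q \<subseteq> sum_diff (t + 2) 2 A" "card Q = s ^ t * card P"
    "\<And>q. q \<in> Q \<Longrightarrow> \<exists>p\<in>P. \<exists>c. (\<forall>i<s * t. c i \<in> {0, 1::int}) \<and> q = p + (\<Sum>i<s * t. c i * e i)"
    using stage unfolding cover_stage_def by blast+
  have "cover_stage A P s (Suc t) (Q + S) e'"
    unfolding cover_stage_def
  proof (intro conjI ballI)
    show "Q + S \<subseteq> sum_diff (Suc t + 2) 2 A"
    proof
      fix z assume "z \<in> Q + S"
      then obtain q x where z: "z = q + x" "q \<in> Q" "x \<in> S" by (auto elim: set_plus_elim)
      obtain a b where ab: "q = a - b" "a \<in> multi_sum (t + 2) A" "b \<in> multi_sum 2 A"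
        using z(2) Q(1) by (blast elim: diff_setE)
      have "(a + x) - b \<in> diff_set (multi_sum (Suc (t + 2)) A) (multi_sum 2 A)"
        by (rule diff_setI[OF multi_sum_add[OF ab(2)] ab(3)]) (use z S in blast)
      thus "z \<in> sum_diff (Suc t + 2) 2 A"
        unfolding z(1) ab(1) by (simp add: algebra_simps)
    qed
    show "card (Q + S) = s ^ Suc t * card P"
      using card_disjoint_translates[OF S(2)] Q(2) S(3) by simp
  next
    fix z assume "z \<in> Q + S"
    then obtain q x where z: "z = q + x" "q \<in> Q" "x \<in> S" by (auto elim: set_plus_elim)
    obtain p c where c: "p \<in> P" "\<forall>i<s * t. c i \<in> {0, 1::int}" "q = p + (\<Sum>i<s * t. c i * e i)"
      using Q(3)[OF z(2)] by blast
    obtain j where j: "j < s" "h j = x" using h[OF z(3)] by blast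
    define c' where "c' i = (if i < s * t then c i else if i - s * t = j then 1 else 0)" for i
    have "(\<Sum>i<s * Suc t. c' i * e' i) = (\<Sum>i<s * t + s. c' i * e' i)" by (simp add: add.commute)
    also have "\<dots> = (\<Sum>i<s * t. c i * e i) + (\<Sum>i<s. (if i = j then 1 else 0) * h i)"
      unfolding sum_lessThan_add by (simp add: c'_def e'_def)
    also have "\<dots> = (\<Sum>i<s * t. c i * e i) + x" using indicator_combination[OF j(1), of h] j(2) by simp
    finally have "z = p + (\<Sum>i<s * Suc t. c' i * e' i)" using z(1) c(3) by simp
    moreover have "\<forall>i<s * Suc t. c' i \<in> {0, 1::int}" using c(2) by (simp add: c'_def)
    ultimately show "\<exists>p\<in>P. \<exists>c. (\<forall>i<s * Suc t. c i \<in> {0, 1::int}) \<and> z = p + (\<Sum>i<s * Suc t. c i * e' i)"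
      using c(1) by blast
  qed
  thus ?thesis by blast
qed

theorem chang_covering:
  fixes A P :: "int set" and K :: real and s :: nat
  assumes A: "finite A" "A \<noteq> {}" and K: "real (card (A + A)) \<le> K * card A" "1 \<le> K"
    and P: "finite P" "P \<noteq> {}" "P \<subseteq> sum_diff 2 2 A" and s: "2 * K \<le> s"
  obtains t e where "2 ^ t * real (card P) \<le> K ^ 4 * card A"
    "A \<subseteq> {p - p' + (\<Sum>i<s * Suc t. c i * e i) |p p' c. p \<in> P \<and> p' \<in> P \<and> (\<forall>i<s * Suc t. c i \<in> {-1, 0, 1::int})}"
proof -
  define G where "G t \<longleftrightarrow> (\<exists>Q e. cover_stage A P s t Q e)" for t
  have cP: "card P > 0" using P by (simp add: card_gt_0_iff)
  have cA: "card A > 0" using A by (simp add: card_gt_0_iff)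
  \<comment> \<open>The set at stage \<open>t\<close> has size at least
    \<open>(2 K) ^ t * card P\<close> and lies in a sum-difference set of order
    \<open>t + 4\<close>; cancelling \<open>K ^ t\<close> leaves the geometric growth that ends the
    process.\<close>
  have bound: "2 ^ t * real (card P) \<le> K ^ 4 * card A" if G: "G t" for t
  proof -
    obtain Q e where Q: "cover_stage A P s t Q e" using G unfolding G_def by blast
    have "(2 * K) ^ t * real (card P) \<le> real s ^ t * card P"
      using s K by (intro mult_right_mono power_mono) auto
    also have "\<dots> = real (card Q)" using Q by (simp add: cover_stage_def)
    also have "\<dots> \<le> card (sum_diff (t + 2) 2 A)"
      using Q A by (intro of_nat_mono card_mono finite_diff_set finite_multi_sum) (auto simp: cover_stage_def)
    also have "\<dots> \<le> K ^ (t + 2 + 2) * card A" by (rule plunnecke[OF A K(1)])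
    also have "\<dots> = K ^ t * (K ^ 4 * card A)" by (simp add: power_add eval_nat_numeral)
    finally have "K ^ t * (2 ^ t * real (card P)) \<le> K ^ t * (K ^ 4 * card A)"
      by (simp add: power_mult_distrib mult_ac)
    thus ?thesis using K(2) by simp
  qed
  have "cover_stage A P s 0 P (\<lambda>_. 0)" 
    using P(3) by (simp add: cover_stage_def numeral_2_eq_2 del: multi_sum.simps)
  hence "G 0" unfolding G_def by blast
  have "\<exists>t. G t \<and> \<not> G (Suc t)"
  proof (rule ccontr)
    assume "\<not> ?thesis"
    hence "G t" for t using \<open>G 0\<close> by (induction t) auto
    hence "2 ^ t * real (card P) \<le> K ^ 4 * card A" for t using bound by blast
    hence le: "2 ^ t \<le> K ^ 4 * card A / card P" for t using cP by (simp add: field_simps)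
    obtain t where "K ^ 4 * card A / card P < 2 ^ t" using real_arch_pow[of 2] by auto
    thus False using le[of t] by linarith
  qed
  then obtain t where t: "G t" "\<not> G (Suc t)" by blast
  obtain Q e where Q: "cover_stage A P s t Q e" using t(1) unfolding G_def by blast
  have "s > 0" using s K by (cases s) auto
  hence "card Q > 0" using Q cP by (simp add: cover_stage_def)
  hence "Q \<noteq> {}" by auto
  then obtain S where S: "S \<subseteq> A" "disjoint_translates Q S" "\<And>a. a \<in> A \<Longrightarrow> \<exists>s\<in>S. \<exists>q\<in>Q. \<exists>q'\<in>Q. q + a = q' + s"
    using maximal_disjoint_translates[OF A(1)] by blast
  have finS: "finite S" using S(1) A(1) finite_subset by blast
  have "card S \<le> s"
  proof (rule ccontr)
    assume "\<not> card S \<le> s"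
    then obtain S' where S': "S' \<subseteq> S" "card S' = s" "finite S'"
      using obtain_subset_with_card_n[of s S] by (metis nat_le_linear)
    have "disjoint_translates Q S'" using S(2) S'(1) unfolding disjoint_translates_def by blast
    hence "G (Suc t)" unfolding G_def using cover_stage_Suc[OF Q _ _ S'(2,3)] S' S(1) by blast
    thus False using t(2) by blast
  qed
  then obtain h where h: "\<And>x. x \<in> S \<Longrightarrow> \<exists>j<s. h j = x" using enumerate_subset[OF finS] by blast
  define e' where "e' i = (if i < s * t then e i else h (i - s * t))" for i
  show ?thesis
  proof (rule that[OF bound[OF t(1)]])
    show "A \<subseteq> {p - p' + (\<Sum>i<s * Suc t. c i * e' i) |p p' c. p \<in> P \<and> p' \<in> P \<and> (\<forall>i<s * Suc t. c i \<in> {-1, 0, 1::int})}"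
    proof
      fix a assume "a \<in> A"
      then obtain x q q' where x: "x \<in> S" "q \<in> Q" "q' \<in> Q" "q + a = q' + x" using S(3) by blast
      have "\<forall>q\<in>Q. \<exists>p\<in>P. \<exists>c. (\<forall>i<s * t. c i \<in> {0, 1::int}) \<and> q = p + (\<Sum>i<s * t. c i * e i)"
        using Q unfolding cover_stage_def by blast
      then obtain p c p' c' where c: "p \<in> P" "\<forall>i<s * t. c i \<in> {0, 1::int}" "q = p + (\<Sum>i<s * t. c i * e i)"
        and c': "p' \<in> P" "\<forall>i<s * t. c' i \<in> {0, 1::int}" "q' = p' + (\<Sum>i<s * t. c' i * e i)"
        using x(2,3) by blast
      obtain j where j: "j < s" "h j = x" using h[OF x(1)] by blast
      \<comment> \<open>From \<open>a = q' - q + x\<close>: the generators shared by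
        \<open>q\<close> and \<open>q'\<close> get differences of two values in
        \<open>{0, 1}\<close>, and one new generator selects \<open>x\<close>.\<close>
      define d where "d i = (if i < s * t then c' i - c i else if i - s * t = j then 1 else 0)" for i
      have "(\<Sum>i<s * Suc t. d i * e' i) = (\<Sum>i<s * t + s. d i * e' i)" by (simp add: add.commute)
      also have "\<dots> = (\<Sum>i<s * t. (c' i - c i) * e i) + (\<Sum>i<s. (if i = j then 1 else 0) * h i)"
        unfolding sum_lessThan_add by (simp add: d_def e'_def)
      also have "\<dots> = (\<Sum>i<s * t. c' i * e i) - (\<Sum>i<s * t. c i * e i) + x"
        using indicator_combination[OF j(1), of h] j(2) by (simp add: left_diff_distrib sum_subtractf)
      finally have "a = p' - p + (\<Sum>i<s * Suc t. d i * e' i)" using x(4) c(3) c'(3) by simp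
      moreover have "\<forall>i<s * Suc t. d i \<in> {-1, 0, 1::int}"
      proof (intro allI impI)
        fix i assume "i < s * Suc t"
        show "d i \<in> {-1, 0, 1}"
        proof (cases "i < s * t")
          case True
          hence "c i \<in> {0, 1}" "c' i \<in> {0, 1}" using c(2) c'(2) by blast+
          thus ?thesis using True by (auto simp: d_def)
        qed (simp add: d_def)
      qed
      ultimately show "a \<in> {p - p' + (\<Sum>i<s * Suc t. c i * e' i) |p p' c. p \<in> P \<and> p' \<in> P \<and> (\<forall>i<s * Suc t. c i \<in> {-1, 0, 1::int})}"
        using c(1) c'(1) by blast
    qed
  qed
qed

section \<open>Lifting progressions from the model\<close>

lemma card_image_factor_le:
  assumes "finite S" "\<And>s t. s \<in> S \<Longrightarrow> t \<in> S \<Longrightarrow> g s = g t \<Longrightarrow> f s = f t"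
  shows "card (f ` S) \<le> card (g ` S)"
proof -
  have "f ` S \<subseteq> (\<lambda>u. f (inv_into S g u)) ` (g ` S)"
  proof
    fix v assume "v \<in> f ` S"
    then obtain s where s: "s \<in> S" "v = f s" by blast
    have "inv_into S g (g s) \<in> S" "g (inv_into S g (g s)) = g s"
      using s(1) by (auto intro: inv_into_into f_inv_into_f)
    hence "f (inv_into S g (g s)) = f s" using assms(2) s(1) by blast
    thus "v \<in> (\<lambda>u. f (inv_into S g u)) ` (g ` S)" using s by force
  qed
  hence "card (f ` S) \<le> card ((\<lambda>u. f (inv_into S g u)) ` (g ` S))" using assms(1) by (intro card_mono) auto
  also have "\<dots> \<le> card (g ` S)" using assms(1) by (intro card_image_le) auto
  finally show ?thesis .
qed

lemma freiman_embeddingD: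
  assumes "freiman_embedding 6 N A psi" "{a1, a2, a3, a4, a5, a6, b1, b2, b3, b4, b5, b6} \<subseteq> A"
  shows "N dvd (psi a1 + psi a2 + psi a3 + psi a4 + psi a5 + psi a6) - (psi b1 + psi b2 + psi b3 + psi b4 + psi b5 + psi b6)
    \<longleftrightarrow> a1 + a2 + a3 + a4 + a5 + a6 = b1 + b2 + b3 + b4 + b5 + b6"
proof -
  have sets: "set [a1, a2, a3, a4, a5, a6] \<subseteq> A" "set [b1, b2, b3, b4, b5, b6] \<subseteq> A" using assms(2) by simp_all
  have "N dvd sum_list (map psi [a1, a2, a3, a4, a5, a6]) - sum_list (map psi [b1, b2, b3, b4, b5, b6]) \<longleftrightarrow>
      sum_list [a1, a2, a3, a4, a5, a6] = sum_list [b1, b2, b3, b4, b5, b6]"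
    by (rule assms(1)[unfolded freiman_embedding_def, rule_format, OF sets]) simp_all
  thus ?thesis by (simp add: add.assoc)
qed

text \<open>Relations with fewer than six terms on a side are padded on both sides with copies of
  one element.\<close>

lemma freiman_embedding_card:
  assumes emb: "freiman_embedding 6 N A psi" and A: "finite A"
  defines "X \<equiv> (\<lambda>a. psi a mod N) ` A"
  shows "card X = card A" "card ((\<lambda>(x, y). (x + y) mod N) ` (X \<times> X)) \<le> card (A + A)"
proof -
  have "inj_on (\<lambda>a. psi a mod N) A"
  proof (rule inj_onI)
    fix a b assume ab: "a \<in> A" "b \<in> A" "psi a mod N = psi b mod N"
    have "N dvd psi a - psi b" using ab by (simp add: mod_eq_dvd_iff)
    thus "a = b" using freiman_embeddingD[OF emb, of a a a a a a b a a a a a] ab by simp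
  qed
  thus "card X = card A" unfolding X_def by (rule card_image)
  have "(\<lambda>(x, y). (x + y) mod N) ` (X \<times> X) = (\<lambda>(a, b). (psi a + psi b) mod N) ` (A \<times> A)"
    unfolding X_def by (force simp: mod_simps image_iff)
  moreover have "A + A = (\<lambda>(a, b). a + b) ` (A \<times> A)" unfolding set_plus_def by force
  moreover have "card ((\<lambda>(a, b). (psi a + psi b) mod N) ` (A \<times> A)) \<le> card ((\<lambda>(a, b). a + b) ` (A \<times> A))"
  proof (rule card_image_factor_le)
    fix u v assume uv: "u \<in> A \<times> A" "v \<in> A \<times> A" "(case u of (a, b) \<Rightarrow> a + b) = (case v of (a, b) \<Rightarrow> a + b)"
    obtain a b c d where u: "u = (a, b)" "v = (c, d)" by (cases u, cases v)
    have abcd: "a \<in> A" "b \<in> A" "c \<in> A" "d \<in> A" "a + b = c + d" using uv by (simp_all add: u)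
    hence "N dvd (psi a + psi b + psi a + psi a + psi a + psi a) - (psi c + psi d + psi a + psi a + psi a + psi a)"
      by (subst freiman_embeddingD[OF emb]) auto
    hence "N dvd (psi a + psi b) - (psi c + psi d)" by (simp add: algebra_simps)
    thus "(case u of (a, b) \<Rightarrow> (psi a + psi b) mod N) = (case v of (a, b) \<Rightarrow> (psi a + psi b) mod N)"
      by (simp add: u mod_eq_dvd_iff)
  qed (use A in simp)
  ultimately show "card ((\<lambda>(x, y). (x + y) mod N) ` (X \<times> X)) \<le> card (A + A)" by simp
qed

text \<open>Relates a residue represented in \<open>2X - 2X\<close> to the corresponding element of
  \<open>2A - 2A\<close>. It is kept as a relation, since independence of the chosen representation
  has to be deduced from the Freiman property.\<close>

definition lift_rel :: "int \<Rightarrow> int set \<Rightarrow> (int \<Rightarrow> int) \<Rightarrow> int \<Rightarrow> int \<Rightarrow> bool" where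
  "lift_rel N A psi b n \<longleftrightarrow> (\<exists>p\<in>A. \<exists>q\<in>A. \<exists>r\<in>A. \<exists>s\<in>A. n = p + q - r - s \<and> N dvd b - (psi p + psi q - psi r - psi s))"

text \<open>Three elements of \<open>2A - 2A\<close> are compared, giving twelve terms, six on each
  side; this is why the model is built with order 6.\<close>

lemma lift_rel_add:
  assumes emb: "freiman_embedding 6 N A psi"
    and "lift_rel N A psi b n" "lift_rel N A psi b' n'" "lift_rel N A psi (b + b') n''"
  shows "n'' = n + n'"
proof -
  obtain p q r s where 1: "p \<in> A" "q \<in> A" "r \<in> A" "s \<in> A" "n = p + q - r - s" "N dvd b - (psi p + psi q - psi r - psi s)"
    using assms(2) unfolding lift_rel_def by blast
  obtain p' q' r' s' where 2: "p' \<in> A" "q' \<in> A" "r' \<in> A" "s' \<in> A" "n' = p' + q' - r' - s'" "N dvd b' - (psi p' + psi q' - psi r' - psi s')"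
    using assms(3) unfolding lift_rel_def by blast
  obtain u v w x where 3: "u \<in> A" "v \<in> A" "w \<in> A" "x \<in> A" "n'' = u + v - w - x" "N dvd (b + b') - (psi u + psi v - psi w - psi x)"
    using assms(4) unfolding lift_rel_def by blast
  have "N dvd ((b + b') - (psi u + psi v - psi w - psi x)) - (b - (psi p + psi q - psi r - psi s)) - (b' - (psi p' + psi q' - psi r' - psi s'))"
    by (intro dvd_diff 1(6) 2(6) 3(6))
  also have "((b + b') - (psi u + psi v - psi w - psi x)) - (b - (psi p + psi q - psi r - psi s)) - (b' - (psi p' + psi q' - psi r' - psi s'))
     = (psi p + psi q + psi p' + psi q' + psi w + psi x) - (psi r + psi s + psi r' + psi s' + psi u + psi v)" by simp
  finally have "p + q + p' + q' + w + x = r + s + r' + s' + u + v"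
    using freiman_embeddingD[OF emb, of p q p' q' w x r s r' s' u v] 1 2 3 by simp
  thus ?thesis using 1(5) 2(5) 3(5) by simp
qed

lemma lift_rel_inj:
  assumes emb: "freiman_embedding 6 N A psi" and "lift_rel N A psi b n" "lift_rel N A psi b' n"
  shows "N dvd b - b'"
proof -
  obtain p q r s where 1: "p \<in> A" "q \<in> A" "r \<in> A" "s \<in> A" "n = p + q - r - s" "N dvd b - (psi p + psi q - psi r - psi s)"
    using assms(2) unfolding lift_rel_def by blast
  obtain p' q' r' s' where 2: "p' \<in> A" "q' \<in> A" "r' \<in> A" "s' \<in> A" "n = p' + q' - r' - s'" "N dvd b' - (psi p' + psi q' - psi r' - psi s')"
    using assms(3) unfolding lift_rel_def by blast
  have "N dvd (psi p + psi q + psi r' + psi s' + psi p + psi p) - (psi r + psi s + psi p' + psi q' + psi p + psi p)"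
    using 1 2 by (subst freiman_embeddingD[OF emb]) auto
  hence "N dvd ((psi p + psi q + psi r' + psi s' + psi p + psi p) - (psi r + psi s + psi p' + psi q' + psi p + psi p))
     + ((b - (psi p + psi q - psi r - psi s)) - (b' - (psi p' + psi q' - psi r' - psi s')))"
    by (rule dvd_add[OF _ dvd_diff[OF 1(6) 2(6)]])
  thus ?thesis by (simp add: algebra_simps)
qed

text \<open>Lift only the generators. Any point of the box is reached from 0 by adding one generator
  at a time without leaving the box, so every intermediate residue has a lift and
  \<open>lift_rel_add\<close> identifies it with the expected sum.\<close>

theorem lift_progression:
  fixes n :: nat and l :: "nat \<Rightarrow> nat"
  assumes emb: "freiman_embedding 6 N A psi"
    and rep: "\<And>c. in_box n l c \<Longrightarrow> \<exists>m. lift_rel N A psi (\<Sum>j<n. c j * x j) m"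
    and inj: "\<And>c c'. in_box n l c \<Longrightarrow> in_box n l c' \<Longrightarrow>
        N dvd (\<Sum>j<n. c j * x j) - (\<Sum>j<n. c' j * x j) \<Longrightarrow> (\<forall>j<n. c j = c' j)"
  obtains y where "box_image n y l \<subseteq> sum_diff 2 2 A" "card (box_image n y l) = (\<Prod>j<n. l j + 1)"
proof -
  \<comment> \<open>If \<open>l j = 0\<close>, the generator need not have a lift and the choice is
    arbitrary; it only ever occurs with coefficient 0.\<close>
  define y where "y j = (SOME m. lift_rel N A psi (x j) m)" for j
  have unit: "lift_rel N A psi (x j) (y j)" if j: "j < n" "l j > 0" for j
  proof -
    have "in_box n l (\<lambda>i. if i = j then 1 else 0)" using j by (auto simp: in_box_def)
    from rep[OF this] have "\<exists>m. lift_rel N A psi (x j) m" by (simp only: indicator_combination[OF j(1)])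
    thus ?thesis unfolding y_def by (rule someI_ex)
  qed
  have main: "lift_rel N A psi (\<Sum>j<n. c j * x j) (\<Sum>j<n. c j * y j)" if "in_box n l c" for c
    using that
  proof (induction "nat (\<Sum>j<n. c j)" arbitrary: c rule: less_induct)
    case less
    show ?case
    proof (cases "\<exists>j<n. c j \<noteq> 0")
      case False
      hence z: "(\<Sum>j<n. c j * f j) = 0" for f :: "nat \<Rightarrow> int" by simp
      obtain m where m: "lift_rel N A psi 0 m" using rep[OF less.prems] unfolding z by blast
      have "m = m + m" by (rule lift_rel_add[OF emb m m]) (use m in simp)
      thus ?thesis using m unfolding z by simp
    next
      case True
      then obtain j where j: "j < n" "c j \<noteq> 0" by blast
      have cj: "c j > 0" "c j \<le> int (l j)" using less.prems j unfolding in_box_def by (metis order_le_less)+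
      define c' where "c' = c(j := c j - 1)"
      have split: "(\<Sum>i<n. c i * f i) = (\<Sum>i<n. c' i * f i) + f j" for f :: "nat \<Rightarrow> int"
      proof -
        have "(\<Sum>i<n. c i * f i) = (\<Sum>i<n. c' i * f i + (if i = j then f i else 0))"
          by (rule sum.cong) (auto simp: c'_def algebra_simps)
        thus ?thesis using j(1) by (simp add: sum.distrib)
      qed
      have inb': "in_box n l c'" using less.prems cj unfolding in_box_def c'_def by auto
      have "0 \<le> (\<Sum>i<n. c' i)" using inb' unfolding in_box_def by (intro sum_nonneg) auto
      hence "nat (\<Sum>i<n. c' i) < nat (\<Sum>i<n. c i)" using split[of "\<lambda>_. 1"] by simp
      hence IH: "lift_rel N A psi (\<Sum>j<n. c' j * x j) (\<Sum>j<n. c' j * y j)" using less.hyps inb' by blast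
      obtain m where m: "lift_rel N A psi (\<Sum>j<n. c j * x j) m" using rep[OF less.prems] by blast
      have "m = (\<Sum>j<n. c' j * y j) + y j"
        by (rule lift_rel_add[OF emb IH unit]) (use j cj m split[of x] in auto)
      thus ?thesis using m split[of y] by simp
    qed
  qed
  show ?thesis
  proof (rule that[of y])
    show "box_image n y l \<subseteq> sum_diff 2 2 A"
    proof
      fix z assume "z \<in> box_image n y l"
      then obtain c where c: "c \<in> int_box n l" "z = (\<Sum>j<n. c j * y j)" by (auto simp: box_image_def)
      from main[OF int_box_in_box[OF c(1)]] obtain p q r s where "p \<in> A" "q \<in> A" "r \<in> A" "s \<in> A" "z = p + q - r - s"
        unfolding lift_rel_def c(2) by blast
      hence pq: "p \<in> A" "q \<in> A" "r \<in> A" "s \<in> A" and z: "z = (p + q) - (r + s)" by simp_all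
      have "sum_list [p, q] \<in> multi_sum (length [p, q]) A" "sum_list [r, s] \<in> multi_sum (length [r, s]) A"
        using pq by (intro sum_list_in_multi_sum; simp)+
      hence "p + q \<in> multi_sum 2 A" "r + s \<in> multi_sum 2 A"
        by (simp_all add: numeral_2_eq_2 del: multi_sum.simps)
      thus "z \<in> sum_diff 2 2 A" unfolding z by (rule diff_setI)
    qed
    show "card (box_image n y l) = (\<Prod>j<n. l j + 1)"
    proof (rule card_box_image)
      fix c c' :: "nat \<Rightarrow> int"
      assume c: "in_box n l c" "in_box n l c'" and eq: "(\<Sum>j<n. c j * y j) = (\<Sum>j<n. c' j * y j)"
      have m: "lift_rel N A psi (\<Sum>j<n. c j * x j) (\<Sum>j<n. c j * y j)"
        "lift_rel N A psi (\<Sum>j<n. c' j * x j) (\<Sum>j<n. c' j * y j)" using c by (auto intro: main)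
      show "\<forall>j<n. c j = c' j"
        by (rule inj[OF c lift_rel_inj[OF emb m(1) m(2)[folded eq]]])
    qed
  qed
qed

section \<open>Freiman's theorem\<close>

lemma two_power_le_exp: "(2::real) ^ n \<le> exp (real n)"
proof -
  have "(2::real) \<le> exp 1" using exp_ge_add_one_self[of 1] by simp
  hence "(2::real) ^ n \<le> exp 1 ^ n" by (intro power_mono) auto
  thus ?thesis by (simp flip: exp_of_nat_mult)
qed

lemma diff_set_mono: "A \<subseteq> B \<Longrightarrow> C \<subseteq> D \<Longrightarrow> diff_set A C \<subseteq> diff_set B D"
  by (auto simp: diff_set_def)

lemma multi_sum_mono: "A \<subseteq> B \<Longrightarrow> multi_sum n A \<subseteq> multi_sum n B"
  by (induction n) (auto intro: set_plus_mono2[THEN subsetD])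

text \<open>With \<open>K \<le> 2 ^ l\<close> every loss can be recorded as a power of 2. The
  passage to \<open>A'\<close> costs a factor 6, so the model has doubling at most
  \<open>6 K\<close>, bounded by \<open>2 ^ (4 * l)\<close>.\<close>

lemma exists_dense_progression:
  fixes A :: "int set" and K :: real and l :: nat
  assumes A: "finite A" "A \<noteq> {}" and K: "real (card (A + A)) \<le> K * card A" "1 \<le> K" "K \<le> 2 ^ l" and l: "l \<ge> 1"
  defines "D0 \<equiv> 2 ^ 27 * l ^ 4"
  obtains n y h where "n \<le> D0" "box_image n y h \<subseteq> sum_diff 2 2 A"
    "card (box_image n y h) = (\<Prod>j<n. h j + 1)"
    "real (card A) \<le> 2 ^ (3 + 14 * D0 * D0) * real (card (box_image n y h))"
proof -
  \<comment> \<open>The least modulus the model allows; by Pluennecke it is only polynomial in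
    \<open>K\<close> times \<open>card X\<close>.\<close>
  define N where "N = int (card (sum_diff 6 6 A)) + 1"
  have N: "N > 0" by (simp add: N_def)
  obtain A' psi where A': "A' \<subseteq> A" "A' \<noteq> {}" "card A \<le> 6 * card A'" "freiman_embedding 6 N A' psi"
    using ruzsa_model[OF A, of 6 N] by (auto simp: N_def)
  note emb = A'(4)
  have finA': "finite A'" using A' A finite_subset by blast
  define X where "X = (\<lambda>a. psi a mod N) ` A'"
  define C where "C = (\<lambda>(x, y). (x + y) mod N) ` (X \<times> X)"
  have XN: "X \<subseteq> {0..<N}" using N by (auto simp: X_def)
  have Xne: "X \<noteq> {}" using A' by (simp add: X_def)
  have cX: "card X = card A'" unfolding X_def by (rule freiman_embedding_card(1)[OF emb finA'])
  have finX: "finite X" unfolding X_def using finA' by simp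
  have X0: "card X > 0" using finX Xne by (simp add: card_gt_0_iff)
  have cA: "card A > 0" using A by (simp add: card_gt_0_iff)
  have AX: "real (card A) \<le> 6 * real (card X)" using A'(3) cX by linarith
  have p2: "(16::real) \<le> 2 ^ (4 * l)"
  proof -
    have "(2::real) ^ 4 \<le> 2 ^ (4 * l)" using l by (intro power_increasing) auto
    thus ?thesis by simp
  qed
  have NX: "of_int N \<le> 2 ^ (16 * l) * real (card X)"
  proof -
    have "real (card (sum_diff 6 6 A)) \<le> K ^ (6 + 6) * card A"
      by (rule plunnecke[OF A K(1)])
    also have "\<dots> \<le> ((2::real) ^ l) ^ (6 + 6) * real (card A)" using K by (intro mult_right_mono power_mono) auto
    also have "((2::real) ^ l) ^ (6 + 6) = 2 ^ (12 * l)" by (simp add: mult.commute flip: power_mult)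
    finally have "of_int N \<le> 2 ^ (12 * l) * real (card A) + 1" by (simp add: N_def)
    also have "1 \<le> 2 ^ (12 * l) * real (card A)" using cA mult_mono[of 1 "2 ^ (12 * l)" 1 "real (card A)"] by simp
    finally have "of_int N \<le> 2 * (2 ^ (12 * l) * real (card A))" by (simp add: mult_ac)
    also have "\<dots> \<le> 2 * (2 ^ (12 * l) * (6 * real (card X)))" using AX by (intro mult_left_mono) auto
    also have "\<dots> = 12 * (2 ^ (12 * l) * real (card X))" by simp
    also have "\<dots> \<le> 2 ^ (4 * l) * (2 ^ (12 * l) * real (card X))" using p2 by (intro mult_right_mono) auto
    also have "\<dots> = 2 ^ (16 * l) * real (card X)" by (simp flip: power_add)
    finally show ?thesis .
  qed
  have CX: "real (card C) \<le> 2 ^ (4 * l) * real (card X)"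
  proof -
    have "card C \<le> card (A' + A')" unfolding C_def X_def by (rule freiman_embedding_card(2)[OF emb finA'])
    also have "\<dots> \<le> card (A + A)" using A A'(1) by (intro card_mono finite_set_plus set_plus_mono2) auto
    finally have "real (card C) \<le> K * card A" using K(1) by linarith
    also have "\<dots> \<le> 2 ^ l * (6 * real (card X))" using K AX by (intro mult_mono) auto
    also have "\<dots> \<le> 2 ^ l * (2 ^ (3 * l) * real (card X))"
    proof -
      have "(2::real) ^ 3 \<le> 2 ^ (3 * l)" using l by (intro power_increasing) auto
      thus ?thesis by (intro mult_left_mono mult_right_mono) auto
    qed
    also have "\<dots> = 2 ^ (4 * l) * real (card X)" by (simp flip: power_add mult.assoc)
    finally show ?thesis .
  qed
  \<comment> \<open>Then \<open>4 ^ k\<close> is the square of the doubling bound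
    \<open>2 ^ (4 * l)\<close>, and one factor is at least 16.\<close>
  define k where "k = 4 * l"
  define m where "m = 1703936 * l ^ 3" \<comment> \<open>\<open>1703936 = 104 * 2 ^ 14\<close> makes \<open>\<epsilon>\<^sup>2 * m / 4\<close> equal to \<open>26 * l\<close>\<close>
  \<comment> \<open>The sampling accuracy uses exactly half of the budget in \<open>c1\<close>; the
    exceptional set takes at most the other half.\<close>
  define \<epsilon> :: real where "\<epsilon> = 1 / (32 * real k)"
  have l0: "real l \<ge> 1" using l by simp
  have \<epsilon>: "0 \<le> \<epsilon>" "\<epsilon> \<le> 1" using l0 by (simp_all add: \<epsilon>_def k_def)
  have m0: "m > 0" using l by (simp add: m_def)
  have \<epsilon>m: "- \<epsilon>\<^sup>2 * m / 4 = - real (26 * l)"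
    using l0 by (simp add: \<epsilon>_def k_def m_def power2_eq_square power3_eq_cube field_simps)
  have c1: "16 * k * (\<epsilon> * real (card X) + 4 * exp (- \<epsilon>\<^sup>2 * m / 4) * N) \<le> real (card X)"
  proof -
    have "512 * real l \<le> 2 ^ (9 * l) * 2 ^ l"
    proof (rule mult_mono)
      have "(2::real) ^ 9 \<le> 2 ^ (9 * l)" using l by (intro power_increasing) auto
      thus "512 \<le> (2::real) ^ (9 * l)" by simp
      show "real l \<le> 2 ^ l" using of_nat_less_two_power[of l, where 'a = real] by simp
    qed auto
    hence l10: "512 * real l \<le> 2 ^ (10 * l)" by (simp flip: power_add)
    have "4 * exp (- \<epsilon>\<^sup>2 * m / 4) * N = 4 * N / exp (real (26 * l))"
      unfolding \<epsilon>m exp_minus by (simp add: divide_inverse)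
    also have "\<dots> \<le> 4 * (2 ^ (16 * l) * real (card X)) / 2 ^ (26 * l)"
      using NX two_power_le_exp[of "26 * l"] by (intro frac_le mult_left_mono) auto
    also have "(2::real) ^ (26 * l) = 2 ^ (16 * l) * 2 ^ (10 * l)" by (simp flip: power_add)
    also have "4 * (2 ^ (16 * l) * real (card X)) / (2 ^ (16 * l) * 2 ^ (10 * l)) = 4 * real (card X) / 2 ^ (10 * l)" by simp
    also have "\<dots> \<le> 4 * real (card X) / (512 * real l)" using l10 l0 by (intro divide_left_mono) auto
    finally have "16 * real k * (4 * exp (- \<epsilon>\<^sup>2 * m / 4) * N) \<le> 16 * real k * (4 * real (card X) / (512 * real l))"
      by (intro mult_left_mono) auto
    also have "\<dots> = real (card X) / 2" using l0 by (simp add: k_def)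
    finally have "16 * real k * (4 * exp (- \<epsilon>\<^sup>2 * m / 4) * N) \<le> real (card X) / 2" .
    moreover have "16 * real k * (\<epsilon> * real (card X)) = real (card X) / 2" using l0 by (simp add: \<epsilon>_def k_def)
    ultimately show ?thesis by (simp only: of_nat_mult of_nat_numeral distrib_left)
  qed
  have c2: "8 * 2 ^ (4 * l) \<le> (4::real) ^ k"
  proof -
    have "(8::real) * 2 ^ (4 * l) \<le> 2 ^ (4 * l) * 2 ^ (4 * l)" using p2 by (intro mult_right_mono) auto
    also have "\<dots> = (2 * 2) ^ (4 * l)" by (simp only: power_mult_distrib)
    finally show ?thesis by (simp add: k_def)
  qed
  have K1: "(1::real) \<le> 2 ^ (4 * l)" by simp
  obtain L where L: "L \<subseteq> {0..<N}" "card L \<le> 16 * ln (2 * ((2::real) ^ (4 * l)) ^ m * of_int N / real (card X))"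
    and Lb: "\<And>\<delta> b. 8 * 2 ^ (4 * l) * pi * card L * \<delta> \<le> 1 \<Longrightarrow> b \<in> bohr N L \<delta> \<Longrightarrow>
      \<exists>x\<in>X. \<exists>a\<in>X. \<exists>y\<in>X. \<exists>z\<in>X. N dvd b + x + a - y - z"
    by (rule bogolyubov_cyclic[OF N XN Xne CX[unfolded C_def] K1 \<epsilon> m0 c1 c2]) (rule that, assumption+)
  have finL: "finite L" by (rule finite_subset[OF L(1)]) simp
  define D where "D = card (insert 1 L)"
  have DL: "D \<le> 1 + card L" unfolding D_def using card_insert_le_m1 by (simp add: card_insert_if finL)
  have LD: "card L \<le> D" unfolding D_def using finL by (intro card_mono) auto
  \<comment> \<open>The coefficient reached is \<open>17 + 64 * 1703936 + 256\<close>, which is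
    below \<open>2 ^ 27\<close>.\<close>
  have DD: "D \<le> D0"
  proof -
    have "2 * ((2::real) ^ (4 * l)) ^ m * of_int N / real (card X) \<le> 2 * (2 ^ (4 * l)) ^ m * (2 ^ (16 * l) * real (card X)) / real (card X)"
      using NX by (intro divide_right_mono mult_left_mono) auto
    also have "\<dots> = 2 ^ (1 + 4 * l * m + 16 * l)" using X0 by (simp add: power_add power_mult)
    finally have "ln (2 * ((2::real) ^ (4 * l)) ^ m * of_int N / real (card X)) \<le> ln ((2::real) ^ (1 + 4 * l * m + 16 * l))"
      using N X0 by (intro ln_mono) auto
    also have "\<dots> = real (1 + 4 * l * m + 16 * l) * ln 2" by (rule ln_realpow)
    also have "\<dots> \<le> real (1 + 4 * l * m + 16 * l) * 1" using ln_2_less_1 by (intro mult_left_mono) auto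
    finally have "real (card L) \<le> 16 * real (1 + 4 * l * m + 16 * l)" using L(2) by linarith
    hence "card L \<le> 16 * (1 + 4 * l * m + 16 * l)" by linarith
    hence "D \<le> 17 + 64 * (l * m) + 256 * l" using DL by (simp add: algebra_simps)
    also have "l * m = 1703936 * l ^ 4" using power_Suc[of l 3] by (simp add: m_def)
    also have "17 + 64 * (1703936 * l ^ 4) + 256 * l \<le> 17 * l ^ 4 + 64 * (1703936 * l ^ 4) + 256 * l ^ 4"
    proof -
      have "1 \<le> l ^ 4" by (rule one_le_power[OF l])
      moreover have "l \<le> l ^ 4" using power_increasing[of 1 4 l] l by simp
      ultimately show ?thesis by linarith
    qed
    also have "\<dots> \<le> D0" by (simp add: D0_def)
    finally show ?thesis .
  qed
  have lD0: "l \<le> D0" "1 \<le> D0"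
  proof -
    have "l ^ 1 \<le> l ^ 4" using l by (intro power_increasing) auto
    also have "\<dots> \<le> D0" by (simp add: D0_def)
    finally show "l \<le> D0" by simp
    thus "1 \<le> D0" using l by linarith
  qed
  \<comment> \<open>\<open>1 / M\<close> is the Bohr radius: \<open>32\<close> is
    \<open>8 * 4\<close>, with \<open>pi < 4\<close> and \<open>card L \<le> D0\<close>.\<close>
  define M where "M = 32 * 2 ^ (4 * l) * D0"
  have M2: "M \<ge> 2"
  proof -
    have "32 * 1 * 1 \<le> M" unfolding M_def using lD0 by (intro mult_mono) auto
    thus ?thesis by simp
  qed
  have Mc: "8 * 2 ^ (4 * l) * pi * card L * (1 / M) \<le> 1"
  proof -
    have "8 * 2 ^ (4 * l) * pi * card L \<le> 8 * 2 ^ (4 * l) * 4 * real D0"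
      using pi_less_4 LD DD by (intro mult_mono) auto
    also have "\<dots> = M" by (simp add: M_def)
    finally show ?thesis using M2 by (simp add: divide_le_eq)
  qed
  obtain n x h where n: "n \<le> D"
    and inb: "\<And>c. in_box n h c \<Longrightarrow> (\<Sum>j<n. c j * x j) \<in> bohr N L (1 / M)"
    and inj: "\<And>c c'. in_box n h c \<Longrightarrow> in_box n h c' \<Longrightarrow>
        N dvd (\<Sum>j<n. c j * x j) - (\<Sum>j<n. c' j * x j) \<Longrightarrow> (\<forall>j<n. c j = c' j)"
    and Nle: "of_int N \<le> real M ^ D * (\<Prod>j<n. 2 * real D * 4 ^ D * (real (h j) + 1))"
    by (rule bohr_contains_progression[OF N finL M2, folded D_def]) (rule that, assumption+)
  have rep: "\<exists>w. lift_rel N A' psi (\<Sum>j<n. c j * x j) w" if c: "in_box n h c" for c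
  proof -
    define b where "b = (\<Sum>j<n. c j * x j)"
    have "b \<in> bohr N L (1 / M)" unfolding b_def by (rule inb[OF c])
    then obtain u a y z where "u \<in> X" "a \<in> X" "y \<in> X" "z \<in> X" "N dvd b + u + a - y - z"
      using Lb[OF Mc] by blast
    then obtain u' a' y' z' where q: "u' \<in> A'" "a' \<in> A'" "y' \<in> A'" "z' \<in> A'"
      "N dvd b + psi u' mod N + psi a' mod N - psi y' mod N - psi z' mod N" unfolding X_def by blast
    have "b - (psi y' + psi z' - psi u' - psi a') = (b + psi u' mod N + psi a' mod N - psi y' mod N - psi z' mod N)
        + N * (psi u' div N + psi a' div N - psi y' div N - psi z' div N)"
      by (simp add: minus_mult_div_eq_mod[symmetric] algebra_simps)
    hence "N dvd b - (psi y' + psi z' - psi u' - psi a')" using q(5) by (metis dvd_add dvd_triv_left)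
    thus ?thesis unfolding lift_rel_def b_def[symmetric] using q by blast
  qed
  obtain y where y: "box_image n y h \<subseteq> sum_diff 2 2 A'" "card (box_image n y h) = (\<Prod>j<n. h j + 1)"
    by (rule lift_progression[OF emb rep inj])
  \<comment> \<open>The powers of \<open>M\<close> and of \<open>2 D 4 ^ D\<close> give the
    exponents \<open>(5 + 4 l + D0) D0\<close> and \<open>(1 + 3 D0) D0\<close>, together at most
    \<open>14 D0^2\<close> since \<open>1 \<le> l \<le> D0\<close>. The further \<open>2 ^ 3\<close>
    covers the factor 6 from the model.\<close>
  have size: "real (card A) \<le> 2 ^ (3 + 14 * D0 * D0) * real (card (box_image n y h))"
  proof -
    define b where "b = real (card (box_image n y h))"
    have [simp]: "0 \<le> b" by (simp add: b_def)
    let ?Q = "\<Prod>j<n. 2 * real D * 4 ^ D * (real (h j) + 1)"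
    have prod: "(\<Prod>j<n. real (h j) + 1) = b" unfolding b_def y(2) by (simp add: of_nat_prod add.commute)
    have D02: "real D0 \<le> 2 ^ D0" using of_nat_less_two_power[of D0, where 'a = real] by simp
    have "?Q = (2 * real D * 4 ^ D) ^ n * b"
      by (simp only: prod.distrib prod_constant card_lessThan prod power_mult_distrib)
    also have "\<dots> \<le> (2 * real D0 * 4 ^ D0) ^ D0 * b"
    proof (intro mult_right_mono)
      have "(2 * real D * 4 ^ D) ^ n \<le> (2 * real D0 * 4 ^ D0) ^ n"
        using DD by (intro power_mono mult_mono power_increasing) auto
      also have "\<dots> \<le> (2 * real D0 * 4 ^ D0) ^ D0"
      proof (rule power_increasing)
        show "n \<le> D0" using n DD by simp
        have "1 * 1 * 1 \<le> 2 * real D0 * 4 ^ D0" using lD0 by (intro mult_mono) auto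
        thus "1 \<le> 2 * real D0 * 4 ^ D0" by simp
      qed
      finally show "(2 * real D * 4 ^ D) ^ n \<le> (2 * real D0 * 4 ^ D0) ^ D0" .
    qed simp
    also have "\<dots> \<le> ((2::real) ^ (1 + 3 * D0)) ^ D0 * b"
    proof (intro mult_right_mono power_mono)
      have "2 * real D0 * 4 ^ D0 \<le> 2 * 2 ^ D0 * (2 * 2) ^ D0" using D02 by (intro mult_mono) auto
      also have "\<dots> = 2 ^ (1 + 3 * D0)" by (simp only: power_mult_distrib) (simp flip: power_add power_Suc add: numeral_3_eq_3)
      finally show "2 * real D0 * 4 ^ D0 \<le> 2 ^ (1 + 3 * D0)" .
    qed auto
    finally have b1: "?Q \<le> ((2::real) ^ (1 + 3 * D0)) ^ D0 * b" .
    have "real M ^ D \<le> real M ^ D0" using M2 DD by (intro power_increasing) auto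
    also have "\<dots> \<le> ((2::real) ^ (5 + 4 * l + D0)) ^ D0"
    proof (intro power_mono)
      have "real M \<le> 2 ^ 5 * 2 ^ (4 * l) * 2 ^ D0" using D02 by (simp add: M_def)
      thus "real M \<le> 2 ^ (5 + 4 * l + D0)" by (simp only: power_add)
    qed simp
    finally have b2: "real M ^ D \<le> ((2::real) ^ (5 + 4 * l + D0)) ^ D0" .
    have "of_int N \<le> ((2::real) ^ (5 + 4 * l + D0)) ^ D0 * (((2::real) ^ (1 + 3 * D0)) ^ D0 * b)"
      using b1 b2 Nle by (intro order.trans[OF Nle] mult_mono prod_nonneg) auto
    also have "\<dots> = 2 ^ ((6 + 4 * l + 4 * D0) * D0) * b"
      by (simp add: algebra_simps flip: power_mult power_add)
    also have "\<dots> \<le> 2 ^ (14 * D0 * D0) * b"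
      using lD0 by (intro mult_right_mono power_increasing) auto
    finally have N2: "of_int N \<le> 2 ^ (14 * D0 * D0) * b" .
    have "card X \<le> card {0..<N}" using XN by (intro card_mono) auto
    hence "real (card X) \<le> of_int N" using N by simp
    hence "real (card A) \<le> 8 * of_int N" using AX N by linarith
    also have "\<dots> \<le> 8 * (2 ^ (14 * D0 * D0) * b)" using N2 by simp
    finally show ?thesis by (simp add: b_def power_add)
  qed
  have sub: "box_image n y h \<subseteq> sum_diff 2 2 A"
    using y(1) diff_set_mono[OF multi_sum_mono[OF A'(1)] multi_sum_mono[OF A'(1)]] by blast
  have nD: "n \<le> D0" using n DD by simp
  show ?thesis using that[OF nD sub y(2) size] .
qed

text \<open>The density of the box bounds the number of covering rounds by a multiple of
  \<open>E = D0^2\<close>, and each round adds \<open>s \<le> 3 K\<close> generators; the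
  \<open>n \<le> D0\<close> original generators are of lower order.\<close>

lemma freiman_dyadic:
  fixes A :: "int set" and K :: real and l :: nat
  assumes A: "finite A" "A \<noteq> {}" and K: "real (card (A + A)) \<le> K * card A" "1 \<le> K" "K \<le> 2 ^ l" and l: "l \<ge> 1"
  shows "\<exists>d P. multidim_progression d P \<and> A \<subseteq> P \<and> real d \<le> 138 * 2 ^ 54 * K * real l ^ 8 \<and>
    real (card P) \<le> exp (138 * 2 ^ 54 * K * real l ^ 8) * real (card A)"
proof -
  define D0 where "D0 = 2 ^ 27 * l ^ 4"
  define E where "E = real D0 * real D0"
  have E: "E = 2 ^ 54 * real l ^ 8" by (simp add: E_def D0_def flip: power_add)
  obtain n y h where n: "n \<le> D0" and sub: "box_image n y h \<subseteq> sum_diff 2 2 A"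
    and cbox: "card (box_image n y h) = (\<Prod>j<n. h j + 1)"
    and big: "real (card A) \<le> 2 ^ (3 + 14 * D0 * D0) * real (card (box_image n y h))"
    using exists_dense_progression[OF A K l] unfolding D0_def by blast
  define B where "B = box_image n y h"
  have B: "finite B" by (simp add: B_def finite_box_image)
  have cB: "card B > 0" unfolding B_def cbox by (simp add: prod_pos)
  hence Bne: "B \<noteq> {}" by auto
  define s where "s = nat \<lceil>2 * K\<rceil>"
  have s: "2 * K \<le> real s" "real s \<le> 3 * K"
    using K(2) unfolding s_def by linarith+
  obtain t e where t: "2 ^ t * real (card B) \<le> K ^ 4 * card A"
    and cov: "A \<subseteq> {p - p' + (\<Sum>i<s * Suc t. c i * e i) |p p' c. p \<in> B \<and> p' \<in> B \<and> (\<forall>i<s * Suc t. c i \<in> {-1, 0, 1::int})}"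
    by (rule chang_covering[OF A K(1,2) B Bne sub[folded B_def] s(1)])
  define m where "m = s * Suc t"
  obtain P where P: "multidim_progression (n + m) P"
    "{p - p' + (\<Sum>i<m. c i * e i) |p p' c. p \<in> box_image n y h \<and> p' \<in> box_image n y h \<and> (\<forall>i<m. c i \<in> {-1, 0, 1})} \<subseteq> P"
    "card P \<le> 2 ^ n * 3 ^ m * (\<Prod>j<n. h j + 1)"
    by (rule difference_box_in_progression)
  have AP: "A \<subseteq> P" using cov P(2) unfolding m_def B_def by (rule subset_trans)
  have K4: "K ^ 4 \<le> 2 ^ (4 * l)"
  proof -
    have "K ^ 4 \<le> (2 ^ l) ^ 4" using K by (intro power_mono) auto
    thus ?thesis by (simp add: mult.commute flip: power_mult)
  qed
  have "2 ^ t * real (card B) \<le> 2 ^ (4 * l) * (2 ^ (3 + 14 * D0 * D0) * real (card B))"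
    using t K4 big unfolding B_def[symmetric] by (intro order.trans[OF t] mult_mono) auto
  hence "2 ^ t * real (card B) \<le> 2 ^ (4 * l + (3 + 14 * D0 * D0)) * real (card B)"
    by (simp only: power_add mult.assoc)
  hence "(2::real) ^ t \<le> 2 ^ (4 * l + (3 + 14 * D0 * D0))" using cB by simp
  hence tle: "t \<le> 4 * l + (3 + 14 * D0 * D0)" by (rule power_le_imp_le_exp[rotated]) simp
  have lD0: "l \<le> D0"
  proof -
    have "l ^ 1 \<le> l ^ 4" using l by (intro power_increasing) auto
    also have "\<dots> \<le> D0" by (simp add: D0_def)
    finally show ?thesis by simp
  qed
  have D1: "1 \<le> real D0" using lD0 l by linarith
  have D0E: "real D0 \<le> E" unfolding E_def using D1 by (simp add: mult_le_cancel_right1)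
  have lE: "real l \<le> E" using lD0 D0E by linarith
  have E1: "1 \<le> E" using D1 D0E by linarith
  have KE: "E \<le> K * E" using K(2) E1 by (simp add: mult_le_cancel_right1)
  have "real t \<le> real (4 * l + (3 + 14 * D0 * D0))" using tle by (rule of_nat_mono)
  \<comment> \<open>\<open>22 = 4 + 4 + 14\<close>, from \<open>4 l\<close>, the constant
    \<open>3 + 1\<close> and \<open>14 D0^2\<close>, each measured in \<open>E\<close>.\<close>
  hence "real (Suc t) \<le> 22 * E" using lE E1 by (simp add: E_def)
  hence "real m \<le> (3 * K) * (22 * E)" unfolding m_def of_nat_mult using s K(2) by (intro mult_mono) auto
  hence m: "real m \<le> 66 * (K * E)" by simp
  have nle: "real n \<le> K * E" using n D0E KE by linarith
  have d: "real (n + m) \<le> 67 * (K * E)" using m nle by simp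
  have KE0: "0 \<le> K * E" using K(2) E1 by simp
  have "real (card P) \<le> exp (138 * (K * E)) * real (card A)"
  proof -
    have "real (card P) \<le> real (2 ^ n * 3 ^ m * card (box_image n y h))" using P(3) unfolding cbox by (rule of_nat_mono)
    also have "\<dots> = 2 ^ n * 3 ^ m * real (card B)" by (simp add: B_def)
    also have "\<dots> \<le> 2 ^ n * 2 ^ (2 * m) * (2 ^ (4 * l) * real (card A))"
    proof (intro mult_mono)
      have "(3::real) ^ m \<le> 4 ^ m" by (intro power_mono) auto
      thus "(3::real) ^ m \<le> 2 ^ (2 * m)" by (simp add: power_mult)
      have "real (card B) \<le> card (sum_diff 2 2 A)"
        using sub A unfolding B_def by (intro of_nat_mono card_mono finite_diff_set finite_multi_sum) auto
      also have "\<dots> \<le> K ^ (2 + 2) * card A" by (rule plunnecke[OF A K(1)])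
      also have "\<dots> \<le> 2 ^ (4 * l) * real (card A)" using K4 by (intro mult_right_mono) auto
      finally show "real (card B) \<le> 2 ^ (4 * l) * real (card A)" .
    qed auto
    also have "\<dots> = 2 ^ (n + 2 * m + 4 * l) * real (card A)" by (simp add: power_add)
    also have "\<dots> \<le> exp (real (n + 2 * m + 4 * l)) * real (card A)"
      by (intro mult_right_mono two_power_le_exp) auto
    also have "\<dots> \<le> exp (138 * (K * E)) * real (card A)"
    proof (intro mult_right_mono)
      \<comment> \<open>The parts contribute \<open>1\<close>, \<open>2 * 66\<close> and
        \<open>4\<close> multiples of \<open>K E\<close>, that is 137.\<close>
      have "real (n + 2 * m + 4 * l) \<le> 138 * (K * E)" using nle m lE KE by simp
      thus "exp (real (n + 2 * m + 4 * l)) \<le> exp (138 * (K * E))" by simp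
    qed simp
    finally show ?thesis .
  qed
  moreover have "real (n + m) \<le> 138 * (K * E)" using d KE0 by linarith
  moreover have eq: "138 * 2 ^ 54 * K * real l ^ 8 = 138 * (K * E)" by (simp add: E)
  ultimately show ?thesis using P(1) AP unfolding eq by blast
qed

text \<open>The translates \<open>Min A + A\<close> and \<open>A + Max A\<close> share only the
  point \<open>Min A + Max A\<close>. This is what forces \<open>K \<ge> 3 / 2\<close> once
  \<open>A\<close> has two elements.\<close>

lemma card_sumset_int_ge:
  fixes A :: "int set"
  assumes "finite A" "A \<noteq> {}"
  shows "2 * card A \<le> card (A + A) + 1"
proof -
  define S where "S = (\<lambda>a. Min A + a) ` A"
  define T where "T = (\<lambda>a. a + Max A) ` A"
  have c: "card S = card A" "card T = card A" unfolding S_def T_def by (simp_all add: card_image)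
  have fin: "finite S" "finite T" unfolding S_def T_def using assms by auto
  have "S \<inter> T \<subseteq> {Min A + Max A}"
  proof
    fix z assume "z \<in> S \<inter> T"
    then obtain a b where ab: "a \<in> A" "b \<in> A" "z = Min A + a" "z = b + Max A" by (auto simp: S_def T_def)
    have "a \<le> Max A" "Min A \<le> b" using ab assms by auto
    thus "z \<in> {Min A + Max A}" using ab by auto
  qed
  hence "card (S \<inter> T) \<le> 1" using card_mono[of "{Min A + Max A}" "S \<inter> T"] by simp
  moreover have "card S + card T = card (S \<union> T) + card (S \<inter> T)" by (rule card_Un_Int[OF fin])
  moreover have "Min A \<in> A" "Max A \<in> A" using assms by simp_all
  hence "card (S \<union> T) \<le> card (A + A)"
    using assms(1) by (intro card_mono finite_set_plus) (auto simp: S_def T_def intro!: set_plus_intro)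
  ultimately show ?thesis using c by linarith
qed

lemma multidim_progression_singleton: "multidim_progression 0 {a}"
  unfolding multidim_progression_def by (intro exI[of _ "\<lambda>_. a"] exI[of _ "\<lambda>_. 1"]) auto

lemma ln_le_powr:
  fixes x a :: real
  assumes "x > 0" "a > 0"
  shows "ln x \<le> x powr a / a"
proof -
  have "a * ln x = ln (x powr a)" using assms by (simp add: ln_powr)
  also have "\<dots> \<le> x powr a" using assms by (intro less_imp_le ln_less_self) auto
  finally show ?thesis using assms by (simp add: field_simps)
qed

theorem theorem1p1:
  "\<exists>C::real. 0 < C \<and>
     (\<forall>(A :: int set) (K :: real).
        finite A \<longrightarrow> A \<noteq> {} \<longrightarrow> real (card (A + A)) \<le> K * real (card A) \<longrightarrow>
        (\<exists>(d :: nat) (P :: int set).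
           multidim_progression d P \<and> A \<subseteq> P \<and>
           real d \<le> C * K powr (7 / 4) * (ln K) ^ 3 \<and>
           real (card P) \<le> exp (C * K powr (7 / 4) * (ln K) ^ 3) * real (card A)))"
proof -
  \<comment> \<open>\<open>5 ^ 8\<close> comes from \<open>l \<le> 5 ln K\<close>, and
    \<open>(20 / 3) ^ 5\<close> from bounding \<open>ln K\<close> by
    \<open>(20 / 3) K powr (3 / 20)\<close>, whose fifth power contains
    \<open>K powr (3 / 4)\<close>.\<close>
  define C :: real where "C = 138 * 2 ^ 54 * 5 ^ 8 * (20 / 3) ^ 5"
  have C0: "C > 0" by (simp add: C_def)
  show ?thesis
  proof (intro exI[of _ C] conjI C0 allI impI)
    fix A :: "int set" and K :: real
    assume A: "finite A" "A \<noteq> {}" and K: "real (card (A + A)) \<le> K * real (card A)"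
    have cA: "card A > 0" using A by (simp add: card_gt_0_iff)
    have two: "2 * real (card A) \<le> K * real (card A) + 1" using card_sumset_int_ge[OF A] K by linarith
    have K1: "K \<ge> 1"
    proof (rule ccontr)
      assume "\<not> K \<ge> 1"
      hence "K * real (card A) < 1 * real (card A)" using cA by (intro mult_strict_right_mono) auto
      moreover have "1 \<le> real (card A)" using cA by simp
      ultimately show False using two by linarith
    qed
    show "\<exists>d P. multidim_progression d P \<and> A \<subseteq> P \<and> real d \<le> C * K powr (7 / 4) * (ln K) ^ 3 \<and>
        real (card P) \<le> exp (C * K powr (7 / 4) * (ln K) ^ 3) * real (card A)"
    \<comment> \<open>The target bound vanishes at \<open>K = 1\<close>, whereas the dyadic bound
      has \<open>l \<ge> 1\<close>. Below \<open>3 / 2\<close> the set is a single point and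
      dimension 0 suffices; above, \<open>ln K \<ge> 1 / 3\<close>.\<close>
    proof (cases "K < 3 / 2")
      case True
      have "card A < 2"
      proof (rule ccontr)
        assume "\<not> card A < 2"
        hence "2 \<le> real (card A)" by simp
        moreover have "K * real (card A) \<le> 3 / 2 * real (card A)" using True by (intro mult_right_mono) auto
        moreover have "K * real (card A) < 3 / 2 * real (card A)" using True cA by (intro mult_strict_right_mono) auto
        ultimately show False using two by linarith
      qed
      hence "card A = 1" using cA by linarith
      then obtain a where a: "A = {a}" by (rule card_1_singletonE)
      have nn: "0 \<le> C * K powr (7 / 4) * (ln K) ^ 3" using C0 K1 by simp
      show ?thesis
        by (intro exI[of _ 0] exI[of _ "{a}"]) (use nn multidim_progression_singleton a in simp)
    next
      case False
      hence K32: "K \<ge> 3 / 2" by simp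
      have lnK: "ln K \<ge> 1 / 3"
      proof -
        have "ln (inverse K) \<le> inverse K - 1" using K1 by (intro ln_le_minus_one) auto
        moreover have "inverse K \<le> 2 / 3" using K32 by (simp add: field_simps)
        ultimately show ?thesis using K1 by (simp add: ln_inverse)
      qed
      define l where "l = nat \<lceil>log 2 K\<rceil>"
      have log0: "log 2 K > 0" using K32 by simp
      have l1: "l \<ge> 1" using log0 unfolding l_def by linarith
      have logl: "log 2 K \<le> real l" "real l \<le> log 2 K + 1" using log0 unfolding l_def by linarith+
      have Kl: "K \<le> 2 ^ l"
      proof -
        have "K = 2 powr (log 2 K)" using K1 by simp
        also have "\<dots> \<le> 2 powr (real l)" using logl by (intro powr_mono) auto
        finally show ?thesis by (simp add: powr_realpow)
      qed
      \<comment> \<open>\<open>2 ln K\<close> bounds \<open>log 2 K\<close> since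
        \<open>ln 2 \<ge> 1 / 2\<close>, and \<open>3 ln K \<ge> 1\<close> pays for rounding
        up.\<close>
      have l5: "real l \<le> 5 * ln K"
      proof -
        have "(1::real) / 2 \<le> ln 2" using ln_le_minus_one[of "1/2"] by (simp add: ln_div)
        hence "log 2 K \<le> 2 * ln K" using lnK by (simp add: log_def divide_le_eq mult.commute)
        thus ?thesis using logl(2) lnK by linarith
      qed
      have l8: "real l ^ 8 \<le> (5 * ln K) ^ 8" using l5 by (intro power_mono) auto
      \<comment> \<open>\<open>ln K \<ge> 1 / 3\<close> and polynomial growth absorb the surplus \<open>(ln K) ^ 5\<close> into \<open>K powr (3 / 4)\<close>.\<close>
      have ln5: "ln K ^ 5 \<le> K powr (3 / 4) * (20 / 3) ^ 5"
      proof -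
        have "ln K \<le> K powr (3 / 20) / (3 / 20)" using K1 by (intro ln_le_powr) auto
        hence "ln K ^ 5 \<le> (K powr (3 / 20) * (20 / 3)) ^ 5" using lnK by (intro power_mono) auto
        also have "\<dots> = (K powr (3 / 20)) ^ 5 * (20 / 3) ^ 5" by (rule power_mult_distrib)
        also have "(K powr (3 / 20)) ^ 5 = K powr (3 / 4)" using K1 by (simp add: powr_powr flip: powr_realpow)
        finally show ?thesis .
      qed
      have bound: "138 * 2 ^ 54 * K * real l ^ 8 \<le> C * K powr (7 / 4) * (ln K) ^ 3"
      proof -
        have "138 * 2 ^ 54 * K * real l ^ 8 \<le> 138 * 2 ^ 54 * K * (5 * ln K) ^ 8"
          using l8 K1 by (intro mult_left_mono) auto
        also have "\<dots> = 138 * 2 ^ 54 * 5 ^ 8 * K * ln K ^ 3 * ln K ^ 5"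
          by (simp add: power_mult_distrib flip: power_add)
        also have "\<dots> \<le> 138 * 2 ^ 54 * 5 ^ 8 * K * ln K ^ 3 * (K powr (3 / 4) * (20 / 3) ^ 5)"
          using ln5 K1 lnK by (intro mult_left_mono) auto
        also have "\<dots> = C * (K * K powr (3 / 4)) * ln K ^ 3" by (simp add: C_def)
        also have "K * K powr (3 / 4) = K powr (7 / 4)"
        proof -
          have "K powr 1 * K powr (3 / 4) = K powr (1 + 3 / 4)" by (rule powr_add[symmetric])
          thus ?thesis using K1 by simp
        qed
        finally show ?thesis .
      qed
      obtain d P where dP: "multidim_progression d P" "A \<subseteq> P" "real d \<le> 138 * 2 ^ 54 * K * real l ^ 8"
        "real (card P) \<le> exp (138 * 2 ^ 54 * K * real l ^ 8) * real (card A)"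
        using freiman_dyadic[OF A K K1 Kl l1] by blast
      have "real d \<le> C * K powr (7 / 4) * (ln K) ^ 3" using dP(3) bound by linarith
      moreover have "real (card P) \<le> exp (C * K powr (7 / 4) * (ln K) ^ 3) * real (card A)"
        using bound by (intro order.trans[OF dP(4)] mult_right_mono) auto
      ultimately show ?thesis using dP(1,2) by blast
    qed
  qed
qed

end
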